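(* Given $\alpha\in(0,2]$, let $w_\alpha$ be a symmetric-$\alpha$-stable (S$\alpha$S) white noise on $\mathbb{T}^d$. \begin{itemize} \item If $\alpha=2$, then for every $0<p,q\leq\infty$ and every $\tau<-d/2$, we have $w_2\in B_{p,q}^{\tau}(\mathbb{T}^d)$ almost surely. \item If $\alpha<2$, then for every $0<p,q\leq\infty$ and $\tau\in\mathbb{R}$ such that $$\tau<d\left(\frac{1}{\max(p,\alpha)}-1\right),$$ we have $w_\alpha\in B_{p,q}^{\tau}(\mathbb{T}^d)$ almost surely. \end{itemize}
   Context: $\mathbb{T}^d=\mathbb{R}^d/\mathbb{Z}^d$ with normalized Lebesgue measure. $\mathcal{S}(\mathbb{T}^d)$ is the space of smooth periodic (real-valued) functions, $\mathcal{S}'(\mathbb{T}^d)$ its topological dual, $\langle u,\varphi\rangle$ the (bilinear) duality product. The cylindrical $\sigma$-field $\mathcal{B}_c(\mathcal{S}'(\mathbb{T}^d))$ is generated by the sets $\{u : (\langle u,\varphi_1\rangle,\dots,\langle u,\varphi_N\rangle)\in B\}$ with $N\in\mathbb{N}$, $\varphi_i\in\mathcal{S}(\mathbb{T}^d)$, $B\subset\mathbb{R}^N$ Borel. A generalized periodic process is a measurable map $s$ from a probability space $(\Omega,\mathcal{F},\mathscr{P})$ to $(\mathcal{S}'(\mathbb{T}^d),\mathcal{B}_c(\mathcal{S}'(\mathbb{T}^d)))$; its characteristic functional is $\widehat{\mathscr{P}}_s(\varphi)=\mathbb{E}[e^{\mathrm{i}\langle s,\varphi\rangle}]$, $\varphi\in\mathcal{S}(\mathbb{T}^d)$.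 For $\alpha\in(0,2]$, a symmetric-$\alpha$-stable white noise $w_\alpha$ is a generalized periodic process with characteristic functional $$\widehat{\mathscr{P}}_{w_\alpha}(\varphi)=\exp\left(-\gamma^\alpha\|\varphi\|_{L_\alpha(\mathbb{T}^d)}^\alpha\right),\qquad\varphi\in\mathcal{S}(\mathbb{T}^d),$$ where $\gamma>0$ is a parameter and $\|\varphi\|_{L_\alpha(\mathbb{T}^d)}^\alpha=\int_{\mathbb{T}^d}|\varphi(\mathbf{r})|^\alpha\,\mathrm{d}\mathbf{r}$. For $\alpha=2$, $w_2$ is the Gaussian white noise. Wavelets: for $u\in\mathbb{N}$, a wavelet system of regularity $u$ is obtained from real compactly supported $\psi_F,\psi_M\in C^u(\mathbb{R})$ (scaling function and orthonormal Daubechies-type wavelet, $\psi_M$ having vanishing moments up to order $u-1$). $G^0=\{F,M\}^d$ and, for $j\geq1$, $G^j$ is the set of $G\in\{F,M\}^d$ with at least one component equal to $M$. $L\in\mathbb{N}$ is fixed large enough that the scale-$0$ wavelets are supported within the torus, $\mathbb{P}_j^d=\{m\in\mathbb{Z}^d : 0\leq m_k<2^{j+L},\ 1\leq k\leq d\}$, and $\Psi_{G,m}^{j,\mathrm{per}}$ is the $\mathbb{Z}^d$-periodization of $2^{(j+L)d/2}\prod_{a=1}^d\psi_{G_a}(2^{j+L}x_a-m_a)$. The family $\{\Psi_{G,m}^{j,\mathrm{per}} : j\in\mathbb{N}_0,\ G\in G^j,\ m\in\mathbb{P}_j^d\}$ is an orthonormal basis of $L_2(\mathbb{T}^d)$.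 Besov sequence spaces: $b_{p,q}^{\tau,\mathrm{per}}$ is the set of sequences $\lambda=(\lambda_m^{j,G})$ of complex numbers with $$\|\lambda\|_{b_{p,q}^{\tau,\mathrm{per}}}=\Big(\sum_{j\geq0}2^{j(\tau-d/p)q}\sum_{G\in G^j}\Big(\sum_{m\in\mathbb{P}_j^d}|\lambda_m^{j,G}|^p\Big)^{q/p}\Big)^{1/q}<\infty$$ (usual supremum modifications if $p=\infty$ or $q=\infty$; $1/\infty=0$). Besov spaces: $B_{p,q}^{\tau}(\mathbb{T}^d)$ is the usual periodic Besov space, equivalently (with $(x)_+=\max(x,0)$): choosing a wavelet system of regularity $u>\max(\tau,d(1/p-1)_+-\tau)$, it is the set of $f\in\mathcal{S}'(\mathbb{T}^d)$ that can be written $f=\sum_{j,G,m}\lambda_m^{j,G}2^{-(j+L)d/2}\Psi_{G,m}^{j,\mathrm{per}}$ with $\lambda\in b_{p,q}^{\tau,\mathrm{per}}$ (unconditional convergence in $\mathcal{S}'(\mathbb{T}^d)$); the representation is unique and the space does not depend on the choice of wavelet system. Besov spaces belong to $\mathcal{B}_c(\mathcal{S}'(\mathbb{T}^d))$, so the almost-sure statement is meaningful. *)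

theory Defs
  imports "HOL-Probability.Probability"
begin

section \<open>Test functions and distributions on the torus\<close>

text \<open>Functions on the torus are represented by functions on \<open>real^'d\<close> that are 1-periodic in each
  coordinate; the dimension is \<open>CARD('d)\<close>.\<close>

definition torus_measure :: "(real^'d) measure" where
  "torus_measure = restrict_space lborel (cbox 0 1)"

definition periodic :: "(real^'d \<Rightarrow> real) \<Rightarrow> bool" where
  "periodic f \<longleftrightarrow> (\<forall>x i. f (x + axis i 1) = f x)"

definition partial_deriv :: "'d \<Rightarrow> (real^'d \<Rightarrow> real) \<Rightarrow> real^'d \<Rightarrow> real" where
  "partial_deriv i f x = deriv (\<lambda>t. f (x + t *\<^sub>R axis i 1)) 0"

definition iterated_partial :: "'d list \<Rightarrow> (real^'d \<Rightarrow> real) \<Rightarrow> real^'d \<Rightarrow> real" where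
  "iterated_partial is f = foldr partial_deriv is f"

definition test_functions :: "(real^'d \<Rightarrow> real) set" where
  "test_functions =
     {\<phi>. periodic \<phi> \<and> (\<forall>is x. iterated_partial is \<phi> differentiable (at x))}"

text \<open>The Frechet topology on test functions is generated by the increasing sequence of norms
  \<open>\<Sum>\<^bsub>|is| \<le> N\<^esub> sup |\<partial>\<^sup>i\<^sup>s \<phi>|\<close>, so that a linear functional is continuous iff it is bounded by a multiple
  of one of them. Functionals are extensional in order that equality in the dual is equality
  in HOL.\<close>

definition test_seminorm :: "nat \<Rightarrow> (real^'d \<Rightarrow> real) \<Rightarrow> real" where
  "test_seminorm N \<phi> = (\<Sum>is | length is \<le> N. SUP x. \<bar>iterated_partial is \<phi> x\<bar>)"

definition periodic_distributions :: "((real^'d \<Rightarrow> real) \<Rightarrow> real) set" where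
  "periodic_distributions =
     {u \<in> extensional test_functions.
        (\<forall>\<phi>\<in>test_functions. \<forall>\<eta>\<in>test_functions. u (\<lambda>x. \<phi> x + \<eta> x) = u \<phi> + u \<eta>) \<and>
        (\<forall>c. \<forall>\<phi>\<in>test_functions. u (\<lambda>x. c * \<phi> x) = c * u \<phi>) \<and>
        (\<exists>N C. \<forall>\<phi>\<in>test_functions. \<bar>u \<phi>\<bar> \<le> C * test_seminorm N \<phi>)}"


section \<open>Generalized periodic processes\<close>

text \<open>The Borel subsets of \<open>\<real>\<^sup>N\<close> are the measurable sets of the product of \<open>N\<close> copies
  of the Borel line.\<close>

definition cylindrical_algebra :: "((real^'d \<Rightarrow> real) \<Rightarrow> real) measure" where
  "cylindrical_algebra = sigma periodic_distributions
     {{u \<in> periodic_distributions. (\<lambda>i\<in>{..<N}. u (\<phi> i)) \<in> B} | (N::nat) \<phi> B.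
        (\<forall>i<N. \<phi> i \<in> test_functions) \<and> B \<in> sets (\<Pi>\<^sub>M i\<in>{..<N}. (borel :: real measure))}"

definition generalized_periodic_process ::
  "'a measure \<Rightarrow> ('a \<Rightarrow> (real^'d \<Rightarrow> real) \<Rightarrow> real) \<Rightarrow> bool" where
  "generalized_periodic_process P s \<longleftrightarrow> prob_space P \<and> s \<in> measurable P cylindrical_algebra"

definition characteristic_functional ::
  "'a measure \<Rightarrow> ('a \<Rightarrow> (real^'d \<Rightarrow> real) \<Rightarrow> real) \<Rightarrow> (real^'d \<Rightarrow> real) \<Rightarrow> complex" where
  "characteristic_functional P s \<phi> = (\<integral>\<omega>. exp (\<i> * complex_of_real (s \<omega> \<phi>)) \<partial>P)"

definition sas_white_noise ::
  "real \<Rightarrow> real \<Rightarrow> 'a measure \<Rightarrow> ('a \<Rightarrow> (real^'d \<Rightarrow> real) \<Rightarrow> real) \<Rightarrow> bool" where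
  "sas_white_noise \<alpha> \<gamma> P w \<longleftrightarrow>
     0 < \<alpha> \<and> \<alpha> \<le> 2 \<and> 0 < \<gamma> \<and> generalized_periodic_process P w \<and>
     (\<forall>\<phi>\<in>test_functions. characteristic_functional P w \<phi> =
        complex_of_real (exp (- (\<gamma> powr \<alpha>) * (\<integral>x. \<bar>\<phi> x\<bar> powr \<alpha> \<partial>torus_measure))))"


section \<open>Wavelet systems\<close>

datatype gender = Father | Mother

definition C_times_differentiable :: "nat \<Rightarrow> (real \<Rightarrow> real) \<Rightarrow> bool" where
  "C_times_differentiable u f \<longleftrightarrow>
     (\<forall>k<u. \<forall>x. (deriv ^^ k) f differentiable (at x)) \<and> continuous_on UNIV ((deriv ^^ u) f)"

text \<open>In the totality clause, \<open>f - (\<Sum>i\<in>J. c i * e i)\<close> is square integrable because the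
  orthonormality relations force every \<open>e i\<close> to be square integrable.\<close>

definition orthonormal_basis_L2 :: "'x measure \<Rightarrow> 'i set \<Rightarrow> ('i \<Rightarrow> 'x \<Rightarrow> real) \<Rightarrow> bool" where
  "orthonormal_basis_L2 M I e \<longleftrightarrow>
     (\<forall>i\<in>I. e i \<in> borel_measurable M) \<and>
     (\<forall>i\<in>I. \<forall>j\<in>I. (\<integral>x. e i x * e j x \<partial>M) = of_bool (i = j)) \<and>
     (\<forall>f\<in>borel_measurable M. integrable M (\<lambda>x. (f x)\<^sup>2) \<longrightarrow>
        (\<forall>\<epsilon>>0. \<exists>J c. finite J \<and> J \<subseteq> I \<and> (\<integral>x. (f x - (\<Sum>i\<in>J. c i * e i x))\<^sup>2 \<partial>M) < \<epsilon>))"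

text \<open>A father function is a scaling function: it satisfies a two-scale relation, as does the
  mother wavelet, and the integer translates of the father together with the dyadic dilates and
  translates of the mother form an orthonormal basis of \<open>L\<^sub>2\<close> of the line. Compact support makes
  the masks \<open>h g\<close> finite.\<close>

definition wavelet_system :: "nat \<Rightarrow> (gender \<Rightarrow> real \<Rightarrow> real) \<Rightarrow> bool" where
  "wavelet_system u \<psi> \<longleftrightarrow>
     (\<forall>g. C_times_differentiable u (\<psi> g) \<and> compact (closure {x. \<psi> g x \<noteq> 0})) \<and>
     (\<exists>h :: gender \<Rightarrow> int \<Rightarrow> real. \<forall>g. finite {k. h g k \<noteq> 0} \<and>
        (\<forall>x. \<psi> g x = (\<Sum>k | h g k \<noteq> 0. h g k * \<psi> Father (2 * x - of_int k)))) \<and>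
     orthonormal_basis_L2 lborel {(j, g, k :: int). g = Mother \<or> j = 0}
       (\<lambda>(j :: nat, g, k) x. 2 powr (real j / 2) * \<psi> g (2 ^ j * x - of_int k)) \<and>
     (\<forall>k<u. (\<integral>x. x ^ k * \<psi> Mother x \<partial>lborel) = 0)"

text \<open>The scale-0 wavelets, i.e. the dilates by \<open>2\<^sup>L\<close>, fit into one period of the torus. The period
  need not be centred at the origin, so that all usual translation conventions for \<open>\<psi>\<close> are
  covered.\<close>

definition fits_torus :: "nat \<Rightarrow> (gender \<Rightarrow> real \<Rightarrow> real) \<Rightarrow> bool" where
  "fits_torus L \<psi> \<longleftrightarrow> (\<forall>g. \<exists>a. \<forall>x. \<psi> g (2 ^ L * x) \<noteq> 0 \<longrightarrow> a \<le> x \<and> x \<le> a + 1)"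

definition genders :: "nat \<Rightarrow> ('d::finite \<Rightarrow> gender) set" where
  "genders j = (if j = 0 then UNIV else {G. \<exists>a. G a = Mother})"

definition positions :: "nat \<Rightarrow> nat \<Rightarrow> (int^'d) set" where
  "positions L j = {m. \<forall>a. 0 \<le> m $ a \<and> m $ a < 2 ^ (j + L)}"

definition wavelet ::
  "nat \<Rightarrow> (gender \<Rightarrow> real \<Rightarrow> real) \<Rightarrow> nat \<Rightarrow> ('d \<Rightarrow> gender) \<Rightarrow> int^'d \<Rightarrow> real^'d \<Rightarrow> real" where
  "wavelet L \<psi> j G m x =
     2 powr (real (j + L) * real CARD('d) / 2) *
     (\<Prod>a\<in>UNIV. \<psi> (G a) (2 ^ (j + L) * x $ a - of_int (m $ a)))"

definition periodic_wavelet ::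
  "nat \<Rightarrow> (gender \<Rightarrow> real \<Rightarrow> real) \<Rightarrow> nat \<Rightarrow> ('d \<Rightarrow> gender) \<Rightarrow> int^'d \<Rightarrow> real^'d \<Rightarrow> real" where
  "periodic_wavelet L \<psi> j G m x =
     (\<Sum>\<^sub>\<infinity>k::int^'d. wavelet L \<psi> j G m (x - (\<chi> a. of_int (k $ a))))"


section \<open>Besov spaces\<close>

text \<open>Exponents range over \<open>ennreal\<close>; since \<open>1 / \<infinity> = 0\<close> there, \<open>enn2real (1 / p)\<close> is the
  real number \<open>1/p\<close> for every \<open>p > 0\<close>, infinite or not.\<close>

definition lp_norm :: "ennreal \<Rightarrow> 'i set \<Rightarrow> ('i \<Rightarrow> complex) \<Rightarrow> real" where
  "lp_norm p A a =
     (if p = \<infinity> then (SUP i\<in>A. cmod (a i))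
      else (\<Sum>i\<in>A. cmod (a i) powr enn2real p) powr enn2real (1 / p))"

definition ennreal_powr :: "ennreal \<Rightarrow> real \<Rightarrow> ennreal" where
  "ennreal_powr x r = (if x = \<infinity> then \<infinity> else ennreal (enn2real x powr r))"

definition besov_seq_norm ::
  "nat \<Rightarrow> ennreal \<Rightarrow> ennreal \<Rightarrow> real \<Rightarrow> (nat \<Rightarrow> ('d::finite \<Rightarrow> gender) \<Rightarrow> int^'d \<Rightarrow> complex) \<Rightarrow> ennreal" where
  "besov_seq_norm L p q \<tau> lam =
     (let s = \<tau> - real CARD('d) * enn2real (1 / p) in
      if q = \<infinity> then
        (SUP j. SUP G\<in>genders j. ennreal (2 powr (real j * s) * lp_norm p (positions L j) (lam j G)))
      else
        ennreal_powr
          (\<Sum>j. ennreal (2 powr (real j * s * enn2real q) *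
                 (\<Sum>G\<in>genders j. lp_norm p (positions L j) (lam j G) powr enn2real q)))
          (enn2real (1 / q)))"

definition besov_seq ::
  "nat \<Rightarrow> ennreal \<Rightarrow> ennreal \<Rightarrow> real \<Rightarrow> (nat \<Rightarrow> ('d::finite \<Rightarrow> gender) \<Rightarrow> int^'d \<Rightarrow> complex) set" where
  "besov_seq L p q \<tau> = {lam. besov_seq_norm L p q \<tau> lam < \<infinity>}"

text \<open>A wavelet system is admissible for the exponents \<open>p\<close>, \<open>\<tau>\<close> if its regularity exceeds
  \<open>max(\<tau>, d(1/p-1)\<^sub>+ - \<tau>)\<close>; \<open>d\<close> is passed as an explicit argument.\<close>

definition admissible_wavelets ::
  "nat \<Rightarrow> nat \<Rightarrow> nat \<Rightarrow> (gender \<Rightarrow> real \<Rightarrow> real) \<Rightarrow> ennreal \<Rightarrow> real \<Rightarrow> bool" where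
  "admissible_wavelets d u L \<psi> p \<tau> \<longleftrightarrow>
     wavelet_system u \<psi> \<and> fits_torus L \<psi> \<and>
     real u > max \<tau> (real d * max (enn2real (1 / p) - 1) 0 - \<tau>)"

text \<open>The Besov space as described by the wavelet system \<open>(L, \<psi>)\<close>; it does not depend on the choice
  of an admissible system. Convergence in the space of distributions is convergence
  against every test function, and \<open>has_sum\<close> is unconditional summation. The wavelets act on
  test functions by integration over the torus.\<close>

definition besov_space ::
  "nat \<Rightarrow> (gender \<Rightarrow> real \<Rightarrow> real) \<Rightarrow> ennreal \<Rightarrow> ennreal \<Rightarrow> real \<Rightarrow> ((real^'d \<Rightarrow> real) \<Rightarrow> real) set" where
  "besov_space L \<psi> p q \<tau> =
     {f \<in> periodic_distributions. \<exists>lam \<in> besov_seq L p q \<tau>. \<forall>\<phi>\<in>test_functions.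
        ((\<lambda>(j, G, m). lam j G m *
            complex_of_real (2 powr (- (real (j + L) * real CARD('d) / 2)) *
              (\<integral>x. periodic_wavelet L \<psi> j G m x * \<phi> x \<partial>torus_measure)))
          has_sum complex_of_real (f \<phi>))
        {(j, G, m). G \<in> genders j \<and> m \<in> positions L j}}"

end

theory Submission
  imports Defs
begin

text \<open>The moments of order \<open>r < \<alpha>\<close> (all orders if \<open>\<alpha> = 2\<close>) of \<open>w \<phi>\<close> are bounded by a multiple of
  \<open>\<parallel>\<phi>\<parallel>\<^sub>\<alpha>\<^sup>r\<close>, so \<open>w\<close> extends to the wavelets, which are limits of test functions. Since
  a wavelet of level \<open>j\<close> has \<open>\<parallel>\<Psi>\<parallel>\<^sub>\<alpha>\<close> of order \<open>2\<close> to the power \<open>j d (1/2 - 1/\<alpha>)\<close>, summing the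
  \<open>r\<close>-th moments of the coefficients bounds their \<open>\<ell>\<^sub>r\<close> norms on all levels almost surely; taking
  \<open>r = p\<close> or \<open>r\<close> slightly below \<open>\<alpha>\<close> (very large if \<open>\<alpha> = 2\<close>, \<open>p = \<infinity>\<close>) and \<open>\<ell>\<^sub>r \<subseteq> \<ell>\<^sub>p\<close> gives the Besov
  sequence norm. The vanishing moments make the wavelet coefficients of a test function decay, so
  the expansion converges absolutely. Its sum is \<open>w \<phi>\<close> almost surely for each single \<open>\<phi>\<close>, because
  the wavelet expansion of \<open>\<phi>\<close> converges uniformly, and hence for all \<open>\<phi>\<close> simultaneously by
  continuity and separability of the space of test functions.\<close>

section \<open>Scaling functions and wavelets on the line\<close>

text \<open>The bounds on \<tau> come from counting exponents. A coefficient of level j in the Besov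
  normalization is 2^((j+L)d/2) times the pairing of the noise with a wavelet, hence of size
  2^(jd(1-1/\<alpha>)). A level has about 2^(jd) of them, so its l_r norm grows like
  2^(jd(1/r+1-1/\<alpha>)), and the weight 2^(j(\<tau>-d/p)) beats this when \<tau> < d/p - d/r - d
  + d/\<alpha>. Larger r is better, but r is limited by p and, for \<alpha> < 2, by the infinite
  moment of order \<alpha>. The obstacle is that \<open>w \<omega>\<close> acts only on smooth
  functions, with an order depending on \<omega>, while wavelets have only u derivatives. Hence the
  expansion cannot be obtained path by path from continuity; it is identified through moments, and a
  geometric rate for the wavelet expansion of a test function makes these summable. Totality in L2
  gives no rate. The rate is extracted from orthonormality and the two-scale relations: the kernels
  of the projections onto the father spaces have integral 1, shrinking supports and bounded L1
  norms.\<close>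

lemma integrable_continuous_compact_support:
  fixes f :: "'a::euclidean_space \<Rightarrow> real"
  assumes "continuous_on UNIV f" and "compact S" and "\<And>x. x \<notin> S \<Longrightarrow> f x = 0"
  shows "integrable lborel f"
proof -
  have "integrable lborel (\<lambda>x. indicator S x *\<^sub>R f x)"
    using assms borel_integrable_compact continuous_on_subset by blast
  moreover have "(\<lambda>x. indicator S x *\<^sub>R f x) = f"
    using assms(3) by (auto simp: indicator_def fun_eq_iff)
  ultimately show ?thesis by simp
qed

text \<open>The set where a continuous function does not vanish is open, and a nonempty open set is
  never negligible.\<close>

lemma continuous_zero_if_square_integral_zero:
  fixes f :: "real \<Rightarrow> real"
  assumes "continuous_on UNIV f" "integrable lborel (\<lambda>x. (f x)\<^sup>2)" "(\<integral>x. (f x)\<^sup>2 \<partial>lborel) = 0"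
  shows "f x = 0"
proof -
  have "AE x in lborel. (f x)\<^sup>2 = 0"
    using integral_nonneg_eq_0_iff_AE[OF assms(2)] assms(3) by auto
  then have "AE x in lborel. f x = 0" by simp
  then have n: "{x. f x \<noteq> 0} \<in> null_sets lborel"
    using assms(1) by (subst AE_iff_null_sets) (auto intro!: open_Collect_neq continuous_intros borel_open)
  have "open {x. f x \<noteq> 0}"
    using assms(1) by (intro open_Collect_neq continuous_intros)
  then have "{x. f x \<noteq> 0} = {}"
    using n open_not_negligible negligible_iff_null_sets null_sets_completionI by blast
  then show ?thesis by blast
qed

lemma UNIV_gender: "(UNIV :: gender set) = {Father, Mother}"
  using gender.exhaust by auto

lemma finite_UNIV_gender [simp]: "finite (UNIV :: gender set)"
  by (simp add: UNIV_gender)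

lemma integral_dilate:
  fixes f :: "real \<Rightarrow> real" and c t :: real
  assumes "c > 0"
  shows "(\<integral>x. f (c * x + t) \<partial>lborel) = (\<integral>x. f x \<partial>lborel) / c"
  using lborel_integral_real_affine[of c f t] assms by (simp add: add.commute)

text \<open>\<open>R\<close> bounds both supports at once, so that sums over translates are finite.
  Positivity of \<open>u\<close> gives the mother function mean zero; it holds in every admissible
  system because \<open>u\<close> exceeds both \<tau> and -\<tau>.\<close>

locale wavelets =
  fixes u :: nat and \<psi> :: "gender \<Rightarrow> real \<Rightarrow> real" and R :: real
  assumes ws: "wavelet_system u \<psi>" and u_pos: "0 < u"
    and R_ge: "1 \<le> R" and supp: "\<And>g x. R \<le> \<bar>x\<bar> \<Longrightarrow> \<psi> g x = 0"
begin

lemma cont: "continuous_on UNIV (\<psi> g)"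
proof -
  have "\<forall>x. (deriv ^^ 0) (\<psi> g) differentiable (at x)"
    using ws u_pos unfolding wavelet_system_def C_times_differentiable_def by blast
  then have "\<forall>x. \<psi> g differentiable (at x)" by simp
  then show ?thesis
    by (auto intro!: continuous_at_imp_continuous_on differentiable_imp_continuous_within)
qed

lemma cont' [continuous_intros]: "continuous_on S f \<Longrightarrow> continuous_on S (\<lambda>x. \<psi> g (f x))"
  using continuous_on_compose2[OF cont, of S f g] by simp

lemma meas [measurable]: "\<psi> g \<in> borel_measurable borel"
  using cont by (rule borel_measurable_continuous_onI)

lemma outside: "\<psi> g (c * x - k) = 0" if "c > 0" "x \<notin> {(k-R)/c..(k+R)/c}"
proof -
  have "R \<le> \<bar>c * x - k\<bar>" using that by (auto simp: field_simps abs_if)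
  then show ?thesis by (rule supp)
qed

lemma integrable_mult: "integrable lborel (\<lambda>x. f x * \<psi> g (c * x - k))"
  if "continuous_on UNIV f" "c > 0"
  by (rule integrable_continuous_compact_support[where S="{(k-R)/c..(k+R)/c}"])
     (use that outside in \<open>auto intro!: continuous_intros\<close>)

lemma integrable_mult': "integrable lborel (\<lambda>x. f x * \<psi> g (x - k))"
  if "continuous_on UNIV f"
  using integrable_mult[OF that, of 1] by simp

lemma int_psi: "integrable lborel (\<psi> g)"
  using integrable_mult'[of "\<lambda>_. 1" g 0] by simp

section \<open>Orthogonality and completeness on the line\<close>

definition ONB where
  "ONB = (\<lambda>(j :: nat, g, k :: int) x. 2 powr (real j / 2) * \<psi> g (2 ^ j * x - of_int k))"

definition Idx where "Idx = {(j :: nat, g, k :: int). g = Mother \<or> j = 0}"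

lemma ONB_basis: "orthonormal_basis_L2 lborel Idx ONB"
  using ws unfolding wavelet_system_def ONB_def Idx_def by blast

lemma orthonormal: "i \<in> Idx \<Longrightarrow> i' \<in> Idx \<Longrightarrow> (\<integral>x. ONB i x * ONB i' x \<partial>lborel) = of_bool (i = i')"
  using ONB_basis unfolding orthonormal_basis_L2_def by blast

lemma total: "f \<in> borel_measurable lborel \<Longrightarrow> integrable lborel (\<lambda>x. (f x)\<^sup>2) \<Longrightarrow> \<epsilon> > 0 \<Longrightarrow>
  \<exists>J c. finite J \<and> J \<subseteq> Idx \<and> (\<integral>x. (f x - (\<Sum>i\<in>J. c i * ONB i x))\<^sup>2 \<partial>lborel) < \<epsilon>"
  using ONB_basis unfolding orthonormal_basis_L2_def by blast

lemma cont_ONB [continuous_intros]: "continuous_on UNIV (ONB i)"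
  unfolding ONB_def by (cases i) (auto intro!: continuous_intros)

lemma integrable_ONB: "continuous_on UNIV f \<Longrightarrow> integrable lborel (\<lambda>x. f x * ONB i x)"
proof (cases i)
  case (fields j g k)
  assume f: "continuous_on UNIV f"
  have "integrable lborel (\<lambda>x. 2 powr (real j / 2) * (f x * \<psi> g (2 ^ j * x - of_int k)))"
    by (intro integrable_mult_right integrable_mult f) auto
  then show ?thesis by (simp add: fields ONB_def ac_simps)
qed

lemma orthonormal_shift:
  "(\<integral>x. \<psi> g (x - of_int k) * \<psi> g' (x - of_int l) \<partial>lborel) = of_bool (g = g' \<and> k = l)"
  using orthonormal[of "(0,g,k)" "(0,g',l)"] by (simp add: Idx_def ONB_def)

lemma orthonormal_level:
  assumes "j > 0 \<or> g = Father"
  shows "(\<integral>x. \<psi> g (x - of_int k) * \<psi> Mother (2 ^ j * x - of_int l) \<partial>lborel) = 0"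
proof (cases "j = 0")
  case True
  then show ?thesis using assms orthonormal_shift[of g k Mother l] by simp
next
  case False
  have "(\<integral>x. ONB (0,g,k) x * ONB (j,Mother,l) x \<partial>lborel) = 0"
    using False by (subst orthonormal) (auto simp: Idx_def)
  then have "2 powr (real j/2) * (\<integral>x. \<psi> g (x - of_int k) * \<psi> Mother (2 ^ j * x - of_int l) \<partial>lborel) = 0"
    by (simp add: ONB_def ac_simps flip: integral_mult_right_zero)
  then show ?thesis by simp
qed

text \<open>For an arbitrary finite combination with coefficients c, the squared error is the
  squared norm of f minus the sum of 2cb - c^2, where b are the inner products with f. As 2cb - c^2
  \<le> b^2, the unknown coefficients from \<open>total\<close> may be replaced by the inner
  products.\<close>

lemma bessel_total:
  assumes f: "continuous_on UNIV f" "integrable lborel (\<lambda>x. (f x)\<^sup>2)" and "\<epsilon> > 0"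
  shows "\<exists>J. finite J \<and> J \<subseteq> Idx \<and> (\<integral>x. (f x)\<^sup>2 \<partial>lborel) < \<epsilon> + (\<Sum>i\<in>J. (\<integral>x. f x * ONB i x \<partial>lborel)\<^sup>2)"
proof -
  have "f \<in> borel_measurable lborel" using f by (simp add: borel_measurable_continuous_onI)
  from total[OF this f(2) assms(3)] obtain J c where J: "finite J" "J \<subseteq> Idx"
    and lt: "(\<integral>x. (f x - (\<Sum>i\<in>J. c i * ONB i x))\<^sup>2 \<partial>lborel) < \<epsilon>"
    by (elim exE conjE) (rule that)
  let ?g = "\<lambda>x. \<Sum>i\<in>J. c i * ONB i x"
  let ?b = "\<lambda>i. (\<integral>x. f x * ONB i x \<partial>lborel)"
  have gc: "continuous_on UNIV ?g" by (intro continuous_intros)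
  have pull: "h x * ?g x = (\<Sum>i\<in>J. c i * (h x * ONB i x))" for h :: "real \<Rightarrow> real" and x
    unfolding sum_distrib_left by (intro sum.cong refl) (rule mult.left_commute)
  have if1: "integrable lborel (\<lambda>x. f x * ?g x)"
    unfolding pull by (intro Bochner_Integration.integrable_sum integrable_mult_right integrable_ONB f)
  have ig1: "integrable lborel (\<lambda>x. ?g x * ?g x)"
    unfolding pull[of ?g] by (intro Bochner_Integration.integrable_sum integrable_mult_right integrable_ONB gc)
  have fg: "(\<integral>x. f x * ?g x \<partial>lborel) = (\<Sum>i\<in>J. c i * ?b i)"
    unfolding pull by (subst Bochner_Integration.integral_sum)
      (auto intro!: integrable_mult_right integrable_ONB f)
  have gO: "(\<integral>x. ?g x * ONB i x \<partial>lborel) = c i" if "i \<in> J" for i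
  proof -
    have "(\<integral>x. ?g x * ONB i x \<partial>lborel) = (\<Sum>i'\<in>J. c i' * (\<integral>x. ONB i' x * ONB i x \<partial>lborel))"
      unfolding sum_distrib_right mult.assoc
      by (subst Bochner_Integration.integral_sum) (auto intro!: integrable_mult_right integrable_ONB cont_ONB)
    also have "\<dots> = (\<Sum>i'\<in>J. c i' * of_bool (i' = i))"
      by (intro sum.cong refl) (use J that in \<open>subst orthonormal, auto\<close>)
    also have "\<dots> = c i" using J that by (simp add: of_bool_def sum.delta if_distrib cong: if_cong)
    finally show ?thesis .
  qed
  have gg: "(\<integral>x. ?g x * ?g x \<partial>lborel) = (\<Sum>i\<in>J. (c i)\<^sup>2)"
  proof -
    have "(\<integral>x. ?g x * ?g x \<partial>lborel) = (\<integral>x. (\<Sum>i\<in>J. c i * (?g x * ONB i x)) \<partial>lborel)"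
      unfolding pull[of ?g] ..
    also have "\<dots> = (\<Sum>i\<in>J. c i * (\<integral>x. ?g x * ONB i x \<partial>lborel))"
      by (subst Bochner_Integration.integral_sum) (auto intro!: integrable_mult_right integrable_ONB gc)
    finally show ?thesis by (simp add: gO power2_eq_square)
  qed
  have "(\<integral>x. (f x - ?g x)\<^sup>2 \<partial>lborel) = (\<integral>x. (f x)\<^sup>2 - 2 * (f x * ?g x) + ?g x * ?g x \<partial>lborel)"
    by (intro Bochner_Integration.integral_cong) (auto simp: power2_eq_square algebra_simps)
  also have "\<dots> = (\<integral>x. (f x)\<^sup>2 \<partial>lborel) - 2 * (\<integral>x. f x * ?g x \<partial>lborel) + (\<integral>x. ?g x * ?g x \<partial>lborel)"
    using f if1 ig1 by simp
  also have "\<dots> = (\<integral>x. (f x)\<^sup>2 \<partial>lborel) - (\<Sum>i\<in>J. 2 * (c i * ?b i) - (c i)\<^sup>2)"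
    unfolding fg gg by (simp add: sum_subtractf sum_distrib_left)
  also have "\<dots> \<ge> (\<integral>x. (f x)\<^sup>2 \<partial>lborel) - (\<Sum>i\<in>J. (?b i)\<^sup>2)"
  proof -
    have "2 * (c i * ?b i) - (c i)\<^sup>2 \<le> (?b i)\<^sup>2" for i
      using zero_le_power2[of "c i - ?b i"] by (simp add: power2_eq_square algebra_simps)
    then show ?thesis by (simp add: sum_mono)
  qed
  finally show ?thesis using lt J by (intro exI[of _ J]) auto
qed

lemma complete:
  assumes f: "continuous_on UNIV f" "integrable lborel (\<lambda>x. (f x)\<^sup>2)"
    and orth: "\<And>i. i \<in> Idx \<Longrightarrow> (\<integral>x. f x * ONB i x \<partial>lborel) = 0"
  shows "f x = 0"
proof -
  have "(\<integral>x. (f x)\<^sup>2 \<partial>lborel) \<le> \<epsilon>" if e: "\<epsilon> > 0" for \<epsilon>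
  proof -
    obtain J where J: "finite J" "J \<subseteq> Idx" "(\<integral>x. (f x)\<^sup>2 \<partial>lborel) < \<epsilon> + (\<Sum>i\<in>J. (\<integral>x. f x * ONB i x \<partial>lborel)\<^sup>2)"
      using bessel_total[OF f e] by (elim exE conjE) (rule that)
    moreover have "(\<Sum>i\<in>J. (\<integral>x. f x * ONB i x \<partial>lborel)\<^sup>2) = 0"
      using J orth by (intro sum.neutral) auto
    ultimately show ?thesis by simp
  qed
  then have "(\<integral>x. (f x)\<^sup>2 \<partial>lborel) \<le> 0" by (rule field_le_epsilon) simp
  moreover have "(\<integral>x. (f x)\<^sup>2 \<partial>lborel) \<ge> 0" by simp
  ultimately have "(\<integral>x. (f x)\<^sup>2 \<partial>lborel) = 0" by linarith
  then show ?thesis by (rule continuous_zero_if_square_integral_zero[OF f])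
qed

section \<open>Two-scale relations\<close>

definition mask :: "gender \<Rightarrow> int \<Rightarrow> real" where
  "mask = (SOME h. \<forall>g. finite {k. h g k \<noteq> 0} \<and>
        (\<forall>x. \<psi> g x = (\<Sum>k | h g k \<noteq> 0. h g k * \<psi> Father (2 * x - of_int k))))"

lemma mask: "finite {k. mask g k \<noteq> 0}"
    "\<psi> g x = (\<Sum>k | mask g k \<noteq> 0. mask g k * \<psi> Father (2 * x - of_int k))"
proof -
  have "\<exists>h. \<forall>g. finite {k. h g k \<noteq> 0} \<and>
        (\<forall>x. \<psi> g x = (\<Sum>k | h g k \<noteq> 0. h g k * \<psi> Father (2 * x - of_int k)))"
    using ws unfolding wavelet_system_def by (elim conjE) assumption
  from someI_ex[OF this, folded mask_def, THEN spec, of g]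
  show "finite {k. mask g k \<noteq> 0}"
    "\<psi> g x = (\<Sum>k | mask g k \<noteq> 0. mask g k * \<psi> Father (2 * x - of_int k))"
    by (rule conjunct1, rule spec[OF conjunct2])
qed

text \<open>Expanding the coarse function by its mask leaves inner products of fine father
  functions, which vanish unless the shifts agree. The factor 1/2 is the squared norm of a dilated
  father function, as the masks carry no normalization by the square root of 2.\<close>

lemma fine_father_inner:
  "(\<integral>x. \<psi> Father (2 * x - of_int k) * \<psi> g (x - of_int l) \<partial>lborel) = mask g (k - 2 * l) / 2"
proof -
  have *: "(\<integral>x. \<psi> Father (2 * x - of_int k) * \<psi> Father (2 * x - of_int m) \<partial>lborel) = of_bool (k = m) / 2" for m
    using integral_dilate[of 2 "\<lambda>x. \<psi> Father (x - of_int k) * \<psi> Father (x - of_int m)" 0] orthonormal_shift[of Father k Father m]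
    by simp
  have "(\<integral>x. \<psi> Father (2 * x - of_int k) * \<psi> g (x - of_int l) \<partial>lborel) =
     (\<integral>x. (\<Sum>n | mask g n \<noteq> 0. mask g n * (\<psi> Father (2 * x - of_int k) * \<psi> Father (2 * x - of_int (2 * l + n)))) \<partial>lborel)"
    by (intro Bochner_Integration.integral_cong refl) (subst mask(2), simp add: sum_distrib_left algebra_simps)
  also have "\<dots> = (\<Sum>n | mask g n \<noteq> 0. mask g n * (of_bool (k = 2 * l + n) / 2))"
    by (subst Bochner_Integration.integral_sum) (auto intro!: integrable_mult_right integrable_mult continuous_intros simp: * simp del: of_int_add)
  also have "\<dots> = (\<Sum>n | mask g n \<noteq> 0. if n = k - 2 * l then mask g n / 2 else 0)"
    by (intro sum.cong) auto
  also have "\<dots> = mask g (k - 2 * l) / 2"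
    using mask(1)[of g] by (simp add: sum.delta)
  finally show ?thesis .
qed

text \<open>The space spanned at level 1 by the father function is the sum of the father and mother
  spaces at level 0: the difference of both sides is orthogonal to the whole basis.\<close>

lemma fine_father_expand:
  assumes A: "finite A" "\<And>g l. mask g (k - 2 * l) \<noteq> 0 \<Longrightarrow> l \<in> A"
  shows "\<psi> Father (2 * x - of_int k) = (\<Sum>g\<in>UNIV. \<Sum>l\<in>A. mask g (k - 2 * l) / 2 * \<psi> g (x - of_int l))"
proof -
  define f where "f x = \<psi> Father (2 * x - of_int k) - (\<Sum>g\<in>UNIV. \<Sum>l\<in>A. mask g (k - 2 * l) / 2 * \<psi> g (x - of_int l))" for x
  have fc: "continuous_on UNIV f" unfolding f_def by (intro continuous_intros)
  have fi: "integrable lborel (\<lambda>x. (f x)\<^sup>2)"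
  proof -
    have "integrable lborel (\<lambda>x. f x * \<psi> Father (2 * x - of_int k) -
        (\<Sum>g\<in>UNIV. \<Sum>l\<in>A. mask g (k - 2 * l) / 2 * (f x * \<psi> g (x - of_int l))))"
      by (intro Bochner_Integration.integrable_diff Bochner_Integration.integrable_sum integrable_mult_right integrable_mult integrable_mult' fc) auto
    moreover have "(f x)\<^sup>2 = f x * \<psi> Father (2 * x - of_int k) -
        (\<Sum>g\<in>UNIV. \<Sum>l\<in>A. mask g (k - 2 * l) / 2 * (f x * \<psi> g (x - of_int l)))" for x
      unfolding power2_eq_square by (subst (2) f_def) (simp add: algebra_simps sum_distrib_left)
    ultimately show ?thesis by simp
  qed
  have key: "(\<integral>x. f x * \<psi> g' (2 ^ j * x - of_int m) \<partial>lborel) = 0" if "g' = Mother \<or> j = 0" for j g' m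
  proof -
    have ig: "integrable lborel (\<lambda>x. \<psi> g (x - of_int l) * \<psi> g' (2 ^ j * x - of_int m))" for g l
      by (intro integrable_mult continuous_intros) auto
    have e: "(\<integral>x. f x * \<psi> g' (2 ^ j * x - of_int m) \<partial>lborel) =
       (\<integral>x. \<psi> Father (2 * x - of_int k) * \<psi> g' (2 ^ j * x - of_int m) \<partial>lborel) -
       (\<Sum>g\<in>UNIV. \<Sum>l\<in>A. mask g (k - 2 * l) / 2 * (\<integral>x. \<psi> g (x - of_int l) * \<psi> g' (2 ^ j * x - of_int m) \<partial>lborel))"
    proof -
      have "(\<integral>x. f x * \<psi> g' (2 ^ j * x - of_int m) \<partial>lborel) =
        (\<integral>x. \<psi> Father (2 * x - of_int k) * \<psi> g' (2 ^ j * x - of_int m) -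
          (\<Sum>g\<in>UNIV. \<Sum>l\<in>A. mask g (k - 2 * l) / 2 * (\<psi> g (x - of_int l) * \<psi> g' (2 ^ j * x - of_int m))) \<partial>lborel)"
        unfolding f_def by (intro Bochner_Integration.integral_cong refl) (simp add: algebra_simps sum_distrib_right sum_distrib_left)
      also have "\<dots> = (\<integral>x. \<psi> Father (2 * x - of_int k) * \<psi> g' (2 ^ j * x - of_int m) \<partial>lborel) -
        (\<integral>x. (\<Sum>g\<in>UNIV. \<Sum>l\<in>A. mask g (k - 2 * l) / 2 * (\<psi> g (x - of_int l) * \<psi> g' (2 ^ j * x - of_int m))) \<partial>lborel)"
        by (intro Bochner_Integration.integral_diff Bochner_Integration.integrable_sum integrable_mult_right ig integrable_mult continuous_intros) auto
      also have "(\<integral>x. (\<Sum>g\<in>UNIV. \<Sum>l\<in>A. mask g (k - 2 * l) / 2 * (\<psi> g (x - of_int l) * \<psi> g' (2 ^ j * x - of_int m))) \<partial>lborel)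
        = (\<Sum>g\<in>UNIV. \<Sum>l\<in>A. mask g (k - 2 * l) / 2 * (\<integral>x. \<psi> g (x - of_int l) * \<psi> g' (2 ^ j * x - of_int m) \<partial>lborel))"
        by (simp only: Bochner_Integration.integral_sum Bochner_Integration.integrable_sum integrable_mult_right ig integral_mult_right_zero)
      finally show ?thesis .
    qed
    show ?thesis
    proof (cases j)
      case 0
      have "(\<Sum>g\<in>UNIV. \<Sum>l\<in>A. mask g (k - 2 * l) / 2 * (\<integral>x. \<psi> g (x - of_int l) * \<psi> g' (x - of_int m) \<partial>lborel))
         = (\<Sum>g\<in>UNIV. if g = g' then (\<Sum>l\<in>A. if l = m then mask g (k - 2 * l) / 2 else 0) else 0)"
        by (intro sum.cong refl) (auto simp: orthonormal_shift intro!: sum.cong sum.neutral)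
      also have "\<dots> = mask g' (k - 2 * m) / 2"
        using A by (auto simp: sum.delta)
      finally show ?thesis using 0 e by (simp add: fine_father_inner)
    next
      case (Suc i)
      \<comment> \<open>Undoing the dilation by 2 leaves a father function against a mother function
        of level i, which are orthogonal even for i = 0.\<close>
      have "(\<integral>x. \<psi> Father (2 * x - of_int k) * \<psi> Mother (2 ^ j * x - of_int m) \<partial>lborel) = 0"
        using integral_dilate[of 2 "\<lambda>x. \<psi> Father (x - of_int k) * \<psi> Mother (2 ^ i * x - of_int m)" 0]
        by (simp add: Suc orthonormal_level mult.left_commute mult.assoc)
      then show ?thesis using Suc e that orthonormal_level[of j] by simp
    qed
  qed
  have "f x = 0" for x
  proof (rule complete[OF fc fi])
    fix i assume "i \<in> Idx"
    then obtain j g m where i: "i = (j, g, m)" "g = Mother \<or> j = 0" by (auto simp: Idx_def)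
    have "(\<integral>x. f x * ONB i x \<partial>lborel) = (\<integral>x. 2 powr (real j / 2) * (f x * \<psi> g (2 ^ j * x - of_int m)) \<partial>lborel)"
      by (simp add: i ONB_def ac_simps)
    then show "(\<integral>x. f x * ONB i x \<partial>lborel) = 0" using key[OF i(2), of m] by simp
  qed
  from this[of x] show ?thesis unfolding f_def by (rule eq_iff_diff_eq_0[THEN iffD2])
qed

section \<open>Projection kernels\<close>

definition ker :: "gender \<Rightarrow> real \<Rightarrow> real \<Rightarrow> real" where
  "ker g x y = (\<Sum>k | \<psi> g (x - of_int k) \<noteq> 0. \<psi> g (x - of_int k) * \<psi> g (y - of_int k))"

lemma support_shifts: "{k. \<psi> g (x - of_int k) \<noteq> 0} \<subseteq> {\<lceil>x - R\<rceil>..\<lfloor>x + R\<rfloor>}"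
proof
  fix k assume "k \<in> {k. \<psi> g (x - of_int k) \<noteq> 0}"
  then have "\<bar>x - of_int k\<bar> < R" using supp[of "x - of_int k" g] by (cases "R \<le> \<bar>x - of_int k\<bar>") auto
  then show "k \<in> {\<lceil>x - R\<rceil>..\<lfloor>x + R\<rfloor>}" by (simp add: ceiling_le_iff le_floor_iff abs_less_iff)
qed

lemma finite_shifts [simp]: "finite {k. \<psi> g (x - of_int k) \<noteq> 0}"
  using finite_subset[OF support_shifts] by blast

lemma ker_superset:
  "finite A \<Longrightarrow> {k. \<psi> g (x - of_int k) \<noteq> 0} \<subseteq> A \<Longrightarrow>
    ker g x y = (\<Sum>k\<in>A. \<psi> g (x - of_int k) * \<psi> g (y - of_int k))"
  unfolding ker_def by (intro sum.mono_neutral_left) auto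

text \<open>\<open>ker g\<close> is the kernel of the orthogonal projection onto the span of the
  integer translates of \<open>\<psi> g\<close>; the left side is the kernel for the father space of
  level 1, which splits into the father and mother spaces of level 0. Expanding the factor in y by
  \<open>fine_father_expand\<close> and summing the masks against the factor in x restores the
  coarse functions in both variables.\<close>

lemma ker_two_scale: "2 * ker Father (2 * x) (2 * y) = (\<Sum>g\<in>UNIV. ker g x y)"
proof -
  define K where "K = {k. \<psi> Father (2 * x - of_int k) \<noteq> 0}"
  \<comment> \<open>The first part makes \<open>B\<close> large enough to evaluate
    \<open>ker g x y\<close>, the second to expand every fine father function that is nonzero at
    2x.\<close>
  define B where "B = (\<Union>g. {k. \<psi> g (x - of_int k) \<noteq> 0}) \<union> (\<Union>k\<in>K. \<Union>g. {l. mask g (k - 2 * l) \<noteq> 0})"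
  have fK: "finite K" by (simp add: K_def)
  have "finite {l. mask g (k - 2 * l) \<noteq> 0}" for g k
  proof -
    have "finite ((\<lambda>l. k - 2 * l) -` {n. mask g n \<noteq> 0})"
      by (intro finite_vimageI mask) (auto simp: inj_def)
    then show ?thesis by (simp add: vimage_def)
  qed
  then have fB: "finite B" unfolding B_def using fK by auto
  \<comment> \<open>The two-scale relation at x - l, reindexed by k = n + 2l; shifts outside
    \<open>K\<close> contribute nothing at x.\<close>
  have inner: "(\<Sum>k\<in>K. mask g (k - 2 * l) * \<psi> Father (2 * x - of_int k)) = \<psi> g (x - of_int l)" for g l
  proof -
    have "\<psi> g (x - of_int l) = (\<Sum>n | mask g n \<noteq> 0. mask g n * \<psi> Father (2 * (x - of_int l) - of_int n))"
      by (rule mask(2))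
    also have "\<dots> = (\<Sum>k\<in>(\<lambda>n. n + 2 * l) ` {n. mask g n \<noteq> 0}. mask g (k - 2 * l) * \<psi> Father (2 * x - of_int k))"
      by (subst sum.reindex) (auto simp: inj_on_def algebra_simps)
    also have "\<dots> = (\<Sum>k\<in>K. mask g (k - 2 * l) * \<psi> Father (2 * x - of_int k))"
    proof (rule sum.mono_neutral_cong)
      show "finite ((\<lambda>n. n + 2 * l) ` {n. mask g n \<noteq> 0})" by (simp add: mask)
      fix i assume "i \<in> K - (\<lambda>n. n + 2 * l) ` {n. mask g n \<noteq> 0}"
      then have "mask g (i - 2 * l) = 0" by (metis (mono_tags, lifting) DiffD2 diff_add_cancel image_eqI mem_Collect_eq)
      then show "mask g (i - 2 * l) * \<psi> Father (2 * x - of_int i) = 0" by simp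
    qed (auto simp: fK K_def)
    finally show ?thesis by simp
  qed
  have "2 * ker Father (2 * x) (2 * y) = 2 * (\<Sum>k\<in>K. \<psi> Father (2 * x - of_int k) * \<psi> Father (2 * y - of_int k))"
    by (simp add: ker_def K_def)
  also have "\<dots> = 2 * (\<Sum>k\<in>K. \<psi> Father (2 * x - of_int k) * (\<Sum>g\<in>UNIV. \<Sum>l\<in>B. mask g (k - 2 * l) / 2 * \<psi> g (y - of_int l)))"
    by (intro arg_cong[where f="(*) 2"] sum.cong refl arg_cong2[where f="(*)"] fine_father_expand fB) (auto simp: B_def)
  also have "\<dots> = (\<Sum>g\<in>UNIV. \<Sum>l\<in>B. (\<Sum>k\<in>K. mask g (k - 2 * l) * \<psi> Father (2 * x - of_int k)) * \<psi> g (y - of_int l))"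
  proof -
    let ?t = "\<lambda>k g l. mask g (k - 2 * l) * \<psi> Father (2 * x - of_int k) * \<psi> g (y - of_int l)"
    have "2 * (\<Sum>k\<in>K. \<psi> Father (2 * x - of_int k) * (\<Sum>g\<in>UNIV. \<Sum>l\<in>B. mask g (k - 2 * l) / 2 * \<psi> g (y - of_int l)))
       = (\<Sum>k\<in>K. \<Sum>g\<in>UNIV. \<Sum>l\<in>B. ?t k g l)"
      unfolding sum_distrib_left by (intro sum.cong refl) simp
    also have "\<dots> = (\<Sum>g\<in>UNIV. \<Sum>k\<in>K. \<Sum>l\<in>B. ?t k g l)" by (rule sum.swap)
    also have "\<dots> = (\<Sum>g\<in>UNIV. \<Sum>l\<in>B. \<Sum>k\<in>K. ?t k g l)" by (intro sum.cong refl sum.swap)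
    finally show ?thesis by (simp only: sum_distrib_right)
  qed
  also have "\<dots> = (\<Sum>g\<in>UNIV. ker g x y)"
    unfolding inner by (intro sum.cong refl ker_superset[symmetric] fB) (auto simp: B_def)
  finally show ?thesis .
qed


section \<open>Bounds for the generating functions and the mean of the father function\<close>

lemma bounded: "\<exists>B. \<forall>g x. \<bar>\<psi> g x\<bar> \<le> B"
proof -
  have "\<exists>B. \<forall>x. \<bar>\<psi> g x\<bar> \<le> B" for g
  proof -
    have "bounded (\<psi> g ` {-R..R})"
      by (intro compact_imp_bounded compact_continuous_image continuous_on_subset[OF cont]) auto
    then obtain B where B: "\<forall>x\<in>{-R..R}. \<bar>\<psi> g x\<bar> \<le> B" "B > 0"
      unfolding bounded_pos by auto
    have "\<bar>\<psi> g x\<bar> \<le> B" for x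
      using B supp[of x g] by (cases "x \<in> {-R..R}") auto
    then show ?thesis by blast
  qed
  then obtain B where B: "\<And>g x. \<bar>\<psi> g x\<bar> \<le> B g" by metis
  have "\<bar>\<psi> g x\<bar> \<le> max (B Father) (B Mother)" for g x
    using B[of g x] by (cases g) auto
  then show ?thesis by blast
qed

definition bound where "bound = (SOME B. \<forall>g x. \<bar>\<psi> g x\<bar> \<le> B)"

lemma bound: "\<bar>\<psi> g x\<bar> \<le> bound"
  using someI_ex[OF bounded, folded bound_def] by blast

lemma bound_nonneg: "0 \<le> bound"
  using bound[of Father 0] by linarith

lemma mother_moment: "k < u \<Longrightarrow> (\<integral>x. x ^ k * \<psi> Mother x \<partial>lborel) = 0"
  using ws unfolding wavelet_system_def by (elim conjE) blast

lemma mother_mean: "(\<integral>x. \<psi> Mother x \<partial>lborel) = 0"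
  using mother_moment[of 0] u_pos by simp

definition absint where "absint = (\<Sum>g\<in>UNIV. \<integral>x. \<bar>\<psi> g x\<bar> \<partial>lborel)"

lemma absint: "(\<integral>x. \<bar>\<psi> g x\<bar> \<partial>lborel) \<le> absint"
  unfolding absint_def by (rule member_le_sum) auto

lemma absint_nonneg: "0 \<le> absint"
  unfolding absint_def by (intro sum_nonneg) auto

text \<open>Mean zero allows subtracting the value of f at the centre b/a. On the support of the
  dilate f deviates from it by at most CR/a, and the dilation contributes the second factor
  1/a.\<close>

lemma integral_lipschitz_bound:
  assumes fc: "continuous_on UNIV f" and lip: "\<And>x y. \<bar>f x - f y\<bar> \<le> C * \<bar>x - y\<bar>" and "(\<integral>x. \<psi> g x \<partial>lborel) = 0" "0 < a"
  shows "\<bar>\<integral>x. f x * \<psi> g (a * x - b) \<partial>lborel\<bar> \<le> C * R * absint / a\<^sup>2"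
proof -
  have C: "0 \<le> C" using lip[of 0 1] by simp
  have f1: "continuous_on UNIV (\<lambda>y. f ((y + b) / a))"
    by (rule continuous_on_compose2[OF fc]) (use assms in \<open>auto intro!: continuous_intros\<close>)
  have i1: "integrable lborel (\<lambda>y. f ((y + b) / a) * \<psi> g y)"
    using integrable_mult'[OF f1, of g 0] by simp
  have eq: "(\<integral>x. f x * \<psi> g (a * x - b) \<partial>lborel) = (\<integral>y. f ((y + b) / a) * \<psi> g y \<partial>lborel) / a"
    using integral_dilate[of a "\<lambda>y. f ((y + b) / a) * \<psi> g y" "-b"] assms by simp
  have "(\<integral>y. f ((y + b) / a) * \<psi> g y \<partial>lborel) = (\<integral>y. (f ((y + b) / a) - f (b / a)) * \<psi> g y \<partial>lborel)"
    using i1 int_psi assms by (simp add: algebra_simps)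
  also have "\<bar>\<dots>\<bar> \<le> (\<integral>y. C * (R / a) * \<bar>\<psi> g y\<bar> \<partial>lborel)"
  proof -
    have "\<bar>(f ((y + b) / a) - f (b / a)) * \<psi> g y\<bar> \<le> C * (R / a) * \<bar>\<psi> g y\<bar>" for y
    proof (cases "\<bar>y\<bar> \<le> R")
      case True
      have "\<bar>f ((y + b) / a) - f (b / a)\<bar> \<le> C * \<bar>(y + b) / a - b / a\<bar>" by (rule lip)
      also have "\<dots> = C * (\<bar>y\<bar> / a)" using \<open>0 < a\<close> by (simp add: diff_divide_distrib[symmetric])
      also have "\<dots> \<le> C * (R / a)" using True C \<open>0 < a\<close> by (intro mult_left_mono divide_right_mono) auto
      finally show ?thesis unfolding abs_mult by (rule mult_right_mono) simp
    next
      case False then show ?thesis using supp[of y g] by simp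
    qed
    then show ?thesis
      by (intro order_trans[OF integral_abs_bound] integral_mono)
         (use i1 int_psi in \<open>auto intro!: integrable_abs simp: left_diff_distrib\<close>)
  qed
  also have "\<dots> = C * (R / a) * (\<integral>y. \<bar>\<psi> g y\<bar> \<partial>lborel)" by simp
  also have "\<dots> \<le> C * (R / a) * absint"
    using C R_ge \<open>0 < a\<close> by (intro mult_left_mono absint) auto
  finally have "\<bar>\<integral>y. f ((y + b) / a) * \<psi> g y \<partial>lborel\<bar> / a \<le> C * (R / a) * absint / a"
    using \<open>0 < a\<close> by (intro divide_right_mono) auto
  then show ?thesis unfolding eq using \<open>0 < a\<close> by (simp add: power2_eq_square)
qed

text \<open>If the father function had mean zero, all wavelet coefficients of a wide tent of width \<open>N\<close>
  would have a sum of squares of order \<open>1 / N\<close>, while the tent has squared norm of order \<open>N\<close>.\<close>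

lemma father_mean_nonzero: "(\<integral>x. \<psi> Father x \<partial>lborel) \<noteq> 0"
proof
  assume "(\<integral>x. \<psi> Father x \<partial>lborel) = 0"
  then have mean: "(\<integral>x. \<psi> g x \<partial>lborel) = 0" for g
    by (cases g) (simp_all add: mother_mean)
  define D where "D = (R * absint)\<^sup>2"
  \<comment> \<open>Chosen so that N/4 exceeds 1 + 20 D, where N/4 bounds the squared norm of the
    tent from below and 20 D will bound the sum of the squared coefficients; the 1 is the error
    allowed in \<open>bessel_total\<close>.\<close>
  define N where "N = R + 4 + 80 * D"
  have D: "0 \<le> D" by (simp add: D_def)
  have N: "N > 0" "N \<ge> R" "N \<ge> 1" using R_ge D by (auto simp: N_def)
  define f where "f x = max 0 (1 - \<bar>x\<bar> / N)" for x :: real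
  have fc: "continuous_on UNIV f" unfolding f_def using N by (intro continuous_intros) auto
  have lip: "\<bar>f x - f y\<bar> \<le> 1 / N * \<bar>x - y\<bar>" for x y
  proof -
    have "\<bar>f x - f y\<bar> \<le> \<bar>\<bar>x\<bar> / N - \<bar>y\<bar> / N\<bar>" unfolding f_def by linarith
    also have "\<dots> = \<bar>\<bar>x\<bar> - \<bar>y\<bar>\<bar> / N" using N by (simp add: diff_divide_distrib[symmetric])
    also have "\<dots> \<le> \<bar>x - y\<bar> / N" using N by (intro divide_right_mono) auto
    finally show ?thesis by simp
  qed
  have f0: "f x = 0" if "\<bar>x\<bar> \<ge> N" for x using that N by (simp add: f_def)
  have fi: "integrable lborel (\<lambda>x. (f x)\<^sup>2)"
    by (rule integrable_continuous_compact_support[where S="{-N..N}"])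
       (auto intro!: continuous_intros fc f0)
  have low: "N / 4 \<le> (\<integral>x. (f x)\<^sup>2 \<partial>lborel)"
  proof -
    have "N / 4 = (\<integral>x. 1 / 4 * indicator {-N/2..N/2} x \<partial>lborel)" using N by simp
    also have "\<dots> \<le> (\<integral>x. (f x)\<^sup>2 \<partial>lborel)"
    proof (rule integral_mono[OF _ fi])
      show "integrable lborel (\<lambda>x. 1 / 4 * indicator {-N/2..N/2} x :: real)"
        by (intro integrable_mult_right integrable_real_indicator) (auto simp: emeasure_lborel_Icc_eq)
      fix x :: real
      show "1 / 4 * indicator {-N/2..N/2} x \<le> (f x)\<^sup>2"
      proof (cases "x \<in> {-N/2..N/2}")
        case True
        then have "1 / 2 \<le> f x" using N by (auto simp: f_def field_simps abs_le_iff)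
        then have "(1 / 2)\<^sup>2 \<le> (f x)\<^sup>2" by (intro power_mono) auto
        then show ?thesis using True by (simp add: power2_eq_square)
      qed auto
    qed
    finally show ?thesis .
  qed
  define b where "b i = (\<integral>x. f x * ONB i x \<partial>lborel)\<^sup>2" for i
  have b_eq: "b (j, g, k) = 2 ^ j * (\<integral>x. f x * \<psi> g (2 ^ j * x - of_int k) \<partial>lborel)\<^sup>2" for j g k
  proof -
    have "(\<integral>x. f x * ONB (j, g, k) x \<partial>lborel) = (\<integral>x. 2 powr (real j / 2) * (f x * \<psi> g (2 ^ j * x - of_int k)) \<partial>lborel)"
      by (simp add: ONB_def ac_simps)
    moreover have "(2 powr (real j / 2))\<^sup>2 = (2::real) ^ j"
      by (simp add: power2_eq_square flip: powr_add powr_realpow)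
    ultimately show ?thesis by (simp add: b_def power_mult_distrib)
  qed
  \<comment> \<open>The squared integral decays like 16^-j, and the normalization costs a factor
    2^j.\<close>
  have b_le: "b (j, g, k) \<le> D / N\<^sup>2 * (1 / 8) ^ j" for j g k
  proof -
    have "\<bar>\<integral>x. f x * \<psi> g (2 ^ j * x - of_int k) \<partial>lborel\<bar> \<le> 1 / N * R * absint / (2 ^ j)\<^sup>2"
      by (rule integral_lipschitz_bound[OF fc lip mean]) simp
    from power_mono[OF this abs_ge_zero, of 2]
    have "(\<integral>x. f x * \<psi> g (2 ^ j * x - of_int k) \<partial>lborel)\<^sup>2 \<le> (1 / N * R * absint / (2 ^ j)\<^sup>2)\<^sup>2"
      by (simp only: power2_abs)
    then have "b (j, g, k) \<le> 2 ^ j * (1 / N * R * absint / (2 ^ j)\<^sup>2)\<^sup>2"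
      unfolding b_eq by simp
    also have "\<dots> = D / N\<^sup>2 * (2 ^ j / ((2 ^ j)\<^sup>2)\<^sup>2)"
      by (simp add: D_def power_mult_distrib power_divide)
    also have "2 ^ j / ((2 ^ j)\<^sup>2)\<^sup>2 = (1 / 8 :: real) ^ j"
    proof -
      have "((2 ^ j)\<^sup>2)\<^sup>2 = (2::real) ^ j * 8 ^ j"
        by (simp add: power2_eq_square power_mult_distrib[symmetric])
      then show ?thesis by (simp add: power_divide)
    qed
    finally show ?thesis .
  qed
  have b_0: "b (j, g, k) = 0" if "\<bar>of_int k\<bar> > 2 ^ j * N + R" for j g k
  proof -
    have "f x * \<psi> g (2 ^ j * x - of_int k) = 0" for x
    proof (cases "\<bar>x\<bar> \<ge> N")
      case False
      then have "\<bar>2 ^ j * x\<bar> \<le> 2 ^ j * N" by (simp add: abs_mult)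
      then have "R \<le> \<bar>2 ^ j * x - of_int k\<bar>" using that by linarith
      then show ?thesis by (simp add: supp)
    qed (simp add: f0)
    then have "(\<lambda>x. f x * \<psi> g (2 ^ j * x - of_int k)) = (\<lambda>x. 0)" by blast
    then show ?thesis by (simp only: b_eq) simp
  qed
  obtain J where J: "finite J" and lt: "(\<integral>x. (f x)\<^sup>2 \<partial>lborel) < 1 + (\<Sum>i\<in>J. b i)"
    using bessel_total[OF fc fi zero_less_one] by (elim exE conjE, intro that) (simp_all add: b_def)
  obtain m where m: "\<And>i. i \<in> J \<Longrightarrow> fst i < m"
  proof -
    have "finite (fst ` J)" using J by simp
    then obtain m where "\<forall>j\<in>fst ` J. j < m" using finite_nat_set_iff_bounded by blast
    then show ?thesis using that by auto
  qed
  \<comment> \<open>Outside \<open>T j\<close> the tent and the translate have disjoint supports.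
    The remaining shifts, of order N 2^j on each level, turn the factor 8^-j of \<open>b_le\<close>
    into 4^-j.\<close>
  define T where "T j = {k :: int. \<bar>of_int k\<bar> \<le> 2 ^ j * N + R}" for j :: nat
  have T: "finite (T j)" "real (card (T j)) \<le> 5 * N * 2 ^ j" for j
  proof -
    let ?z = "2 ^ j * N + R"
    have z: "?z \<ge> 0" using N R_ge by simp
    have T_eq: "T j = {-\<lfloor>?z\<rfloor>..\<lfloor>?z\<rfloor>}"
      unfolding T_def by (auto simp: le_floor_iff abs_le_iff minus_le_iff)
    show "finite (T j)" by (simp add: T_eq)
    have "real (card (T j)) = 2 * of_int \<lfloor>?z\<rfloor> + 1" using z by (simp add: T_eq)
    also have "\<dots> \<le> 2 * ?z + 1"
      by (intro add_right_mono mult_left_mono of_int_floor_le) simp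
    also have "\<dots> \<le> 2 * (2 ^ j * N) + 2 * (2 ^ j * N) + 2 ^ j * N"
    proof -
      have "1 * N \<le> 2 ^ j * N" using N by (intro mult_right_mono) auto
      then have "R \<le> 2 ^ j * N" "1 \<le> 2 ^ j * N" using N by linarith+
      moreover have "R \<le> p \<Longrightarrow> 1 \<le> p \<Longrightarrow> 2 * (p + R) + 1 \<le> 2 * p + 2 * p + p" for p
        by simp
      ultimately show ?thesis by blast
    qed
    finally show "real (card (T j)) \<le> 5 * N * 2 ^ j" by simp
  qed
  have "(\<Sum>i\<in>J. b i) \<le> (\<Sum>i\<in>(SIGMA j:{..<m}. UNIV \<times> T j). b i)"
  proof -
    have "(\<Sum>i\<in>J. b i) = (\<Sum>i\<in>J \<inter> (SIGMA j:{..<m}. UNIV \<times> T j). b i)"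
    proof (rule sum.mono_neutral_right)
      show "\<forall>i\<in>J - J \<inter> (SIGMA j:{..<m}. UNIV \<times> T j). b i = 0"
        using m b_0 by (fastforce simp: T_def not_le)
    qed (use J in auto)
    also have "\<dots> \<le> (\<Sum>i\<in>(SIGMA j:{..<m}. UNIV \<times> T j). b i)"
      by (intro sum_mono2) (auto simp: T b_def)
    finally show ?thesis .
  qed
  also have "\<dots> = (\<Sum>j<m. \<Sum>i\<in>UNIV \<times> T j. b (j, i))"
    using sum.Sigma[of "{..<m}" "\<lambda>j. UNIV \<times> T j" "\<lambda>j i. b (j, i)"] by (simp add: T case_prod_eta)
  also have "\<dots> \<le> (\<Sum>j<m. 10 * D / N * (1 / 4) ^ j)"
  proof (intro sum_mono)
    fix j
    have "(\<Sum>i\<in>UNIV \<times> T j. b (j, i)) \<le> of_nat (card (UNIV \<times> T j :: (gender \<times> int) set)) * (D / N\<^sup>2 * (1 / 8) ^ j)"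
      by (rule sum_bounded_above) (use b_le in \<open>auto simp only: split_paired_all\<close>)
    also have "real (card (UNIV \<times> T j :: (gender \<times> int) set)) = 2 * real (card (T j))"
      by (simp add: card_cartesian_product UNIV_gender)
    also have "2 * real (card (T j)) * (D / N\<^sup>2 * (1 / 8) ^ j) \<le> 2 * (5 * N * 2 ^ j) * (D / N\<^sup>2 * (1 / 8) ^ j)"
      by (intro mult_right_mono mult_left_mono T) (use D in auto)
    also have "\<dots> = 10 * D / N * (2 ^ j * (1 / 8) ^ j)"
      using N by (simp add: power2_eq_square)
    also have "2 ^ j * (1 / 8) ^ j = (1 / 4 :: real) ^ j"
      by (simp add: power_mult_distrib[symmetric])
    finally show "(\<Sum>i\<in>UNIV \<times> T j. b (j, i)) \<le> 10 * D / N * (1 / 4) ^ j" .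
  qed
  also have "\<dots> = 10 * D / N * (\<Sum>j<m. (1 / 4) ^ j)" by (simp add: sum_distrib_left)
  also have "\<dots> \<le> 10 * D / N * 2"
  proof (rule mult_left_mono)
    have "(\<Sum>j<m. (1 / 4 :: real) ^ j) \<le> (\<Sum>j. (1 / 4) ^ j)"
      by (rule sum_le_suminf) auto
    also have "\<dots> = 4 / 3" by (subst suminf_geometric) auto
    finally show "(\<Sum>j<m. (1 / 4 :: real) ^ j) \<le> 2" by simp
  qed (use D N in auto)
  also have "\<dots> \<le> 20 * D"
    using N D by (simp add: field_simps mult_right_mono mult_left_mono)
  finally have "N / 4 < 1 + 20 * D" using lt low by linarith
  then show False using R_ge by (simp add: N_def)
qed

section \<open>The kernel of the father space integrates to one\<close>

lemma ker_cont [continuous_intros]: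
  "continuous_on S f \<Longrightarrow> continuous_on S (\<lambda>y. ker g x (f y))"
  unfolding ker_def by (intro continuous_intros)

lemma ker_outside: "ker g x y = 0" if "2 * R < \<bar>y - x\<bar>"
  unfolding ker_def
proof (rule sum.neutral, rule ballI)
  fix k
  show "\<psi> g (x - of_int k) * \<psi> g (y - of_int k) = 0"
    using supp[of "x - of_int k" g] supp[of "y - of_int k" g] that
    by (cases "R \<le> \<bar>x - of_int k\<bar>") (auto simp: abs_if split: if_splits)
qed

text \<open>At most 2R + 1 integers lie within distance R of x, and each contributes at most the
  square of \<open>bound\<close>.\<close>

lemma ker_bound: "\<bar>ker g x y\<bar> \<le> (2 * R + 1) * bound\<^sup>2"
proof -
  have "card {k. \<psi> g (x - of_int k) \<noteq> 0} \<le> card {\<lceil>x - R\<rceil>..\<lfloor>x + R\<rfloor>}"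
    by (intro card_mono support_shifts) auto
  also have "\<dots> = nat (\<lfloor>x + R\<rfloor> + 1 - \<lceil>x - R\<rceil>)" by simp
  finally have c: "real (card {k. \<psi> g (x - of_int k) \<noteq> 0}) \<le> real (nat (\<lfloor>x + R\<rfloor> + 1 - \<lceil>x - R\<rceil>))" by linarith
  have "of_int (\<lfloor>x + R\<rfloor> + 1 - \<lceil>x - R\<rceil>) \<le> 2 * R + 1" by linarith
  then have c': "real (card {k. \<psi> g (x - of_int k) \<noteq> 0}) \<le> 2 * R + 1" using c R_ge by linarith
  have "\<bar>ker g x y\<bar> \<le> (\<Sum>k | \<psi> g (x - of_int k) \<noteq> 0. \<bar>\<psi> g (x - of_int k) * \<psi> g (y - of_int k)\<bar>)"
    unfolding ker_def by (rule sum_abs)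
  also have "\<dots> \<le> real (card {k. \<psi> g (x - of_int k) \<noteq> 0}) * (bound * bound)"
    by (rule sum_bounded_above) (auto simp: abs_mult intro!: mult_mono bound bound_nonneg)
  also have "\<dots> \<le> (2 * R + 1) * (bound * bound)"
    using c' by (intro mult_right_mono) auto
  finally show ?thesis by (simp add: power2_eq_square)
qed

lemma ker_integrable: "integrable lborel (ker g x)"
  by (rule integrable_continuous_compact_support[where S="{x - 2 * R..x + 2 * R}"])
     (auto intro!: ker_outside ker_cont continuous_intros simp: abs_if)

definition periodic_sum where
  "periodic_sum x = (\<Sum>k | \<psi> Father (x - of_int k) \<noteq> 0. \<psi> Father (x - of_int k))"

text \<open>One index set serves a whole interval around 0, so that continuity of the sum at 0 and
  termwise integration become available.\<close>

lemma periodic_sum_superset: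
  assumes "\<bar>x\<bar> \<le> r" "r + R \<le> of_int m"
  shows "periodic_sum x = (\<Sum>k\<in>{-m..m}. \<psi> Father (x - of_int k))"
  unfolding periodic_sum_def
proof (rule sum.mono_neutral_left)
  show "{k. \<psi> Father (x - of_int k) \<noteq> 0} \<subseteq> {-m..m}"
  proof -
    have "\<lfloor>x + R\<rfloor> \<le> m" "-m \<le> \<lceil>x - R\<rceil>" using assms by linarith+
    then show ?thesis using support_shifts[of Father x] by auto
  qed
qed auto

lemma ker_integral_mean: "(\<integral>y. ker g x y \<partial>lborel) = (\<integral>y. \<psi> g y \<partial>lborel) * (\<Sum>k | \<psi> g (x - of_int k) \<noteq> 0. \<psi> g (x - of_int k))"
proof -
  have "(\<integral>y. \<psi> g (y - of_int k) \<partial>lborel) = (\<integral>y. \<psi> g y \<partial>lborel)" for k :: int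
    using integral_dilate[of 1 "\<psi> g" "- of_int k"] by simp
  moreover have "integrable lborel (\<lambda>y. \<psi> g (x - of_int k) * \<psi> g (y - of_int k))" for k :: int
    by (intro integrable_mult') simp
  ultimately show ?thesis
    unfolding ker_def by (subst Bochner_Integration.integral_sum) (auto simp: sum_distrib_left mult.commute)
qed

text \<open>The integral is the father mean times \<open>periodic_sum x\<close>. Integrating
  \<open>ker_two_scale\<close> in y, where the mother kernel has integral 0, shows that
  \<open>periodic_sum\<close> is invariant under doubling; being continuous at 0 it is constant. The
  constant is found by integrating it against the father function and using orthonormality of the
  translates.\<close>

lemma ker_integral: "(\<integral>y. ker Father x y \<partial>lborel) = 1"
proof -
  let ?\<mu> = "\<integral>y. \<psi> Father y \<partial>lborel"
  have c: "(\<integral>y. ker Father x y \<partial>lborel) = ?\<mu> * periodic_sum x" for x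
    by (simp add: ker_integral_mean periodic_sum_def)
  have "(\<integral>y. ker Father (2 * x) y \<partial>lborel) = (\<integral>y. ker Father x y \<partial>lborel)" for x
  proof -
    have "(\<integral>y. ker Father (2 * x) y \<partial>lborel) = (\<integral>y. 2 * ker Father (2 * x) (2 * y) \<partial>lborel)"
      using integral_dilate[of 2 "ker Father (2 * x)" 0] by simp
    also have "\<dots> = (\<Sum>g\<in>UNIV. \<integral>y. ker g x y \<partial>lborel)"
      unfolding ker_two_scale by (rule Bochner_Integration.integral_sum) (rule ker_integrable)
    also have "\<dots> = (\<integral>y. ker Father x y \<partial>lborel)"
      by (simp add: UNIV_gender ker_integral_mean[of Mother] mother_mean)
    finally show ?thesis .
  qed
  \<comment> \<open>Here the father mean is cancelled, which is why it had to be shown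
    nonzero.\<close>
  then have p2: "periodic_sum (2 * x) = periodic_sum x" for x
    using father_mean_nonzero by (simp add: c)
  have p: "periodic_sum (x / 2 ^ n) = periodic_sum x" for x n
  proof (induction n)
    case (Suc n)
    then show ?case using p2[of "x / 2 ^ Suc n"] by simp
  qed simp
  define m where "m = \<lceil>1 + R\<rceil>"
  define q where "q x = (\<Sum>k\<in>{-m..m}. \<psi> Father (x - of_int k))" for x
  \<comment> \<open>Repeated halving moves x to 0 without changing the value, and near 0 the sum
    agrees with the continuous function q.\<close>
  have const: "periodic_sum x = q 0" for x
  proof -
    have "isCont q 0"
    proof -
      have "continuous_on UNIV q" unfolding q_def by (intro continuous_intros)
      then show ?thesis by (simp add: continuous_on_eq_continuous_at)
    qed
    moreover have lim: "(\<lambda>n. x / 2 ^ n) \<longlonglongrightarrow> 0"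
      using LIMSEQ_divide_realpow_zero[of 2 x] by simp
    ultimately have "(\<lambda>n. q (x / 2 ^ n)) \<longlonglongrightarrow> q 0" by (rule isCont_tendsto_compose)
    moreover have "eventually (\<lambda>n. q (x / 2 ^ n) = periodic_sum x) sequentially"
    proof -
      have "eventually (\<lambda>n. dist (x / 2 ^ n) 0 < 1) sequentially"
        using lim by (rule tendstoD) simp
      then show ?thesis
      proof eventually_elim
        case (elim n)
        then have "periodic_sum (x / 2 ^ n) = q (x / 2 ^ n)" unfolding q_def
          by (intro periodic_sum_superset[where r=1]) (auto simp: m_def)
        then show ?case by (simp add: p)
      qed
    qed
    ultimately have "(\<lambda>n. periodic_sum x) \<longlonglongrightarrow> q 0" by (rule Lim_transform_eventually)
    then show ?thesis by (simp add: LIMSEQ_const_iff)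
  qed
  define l where "l = \<lceil>R + R\<rceil>"
  \<comment> \<open>Replacing the constant by the periodization makes this a sum of inner products
    of translates, of which only the one with k = 0 survives.\<close>
  have "?\<mu> * q 0 = (\<integral>x. \<psi> Father x * periodic_sum x \<partial>lborel)" by (simp add: const)
  also have "\<dots> = (\<integral>x. (\<Sum>k\<in>{-l..l}. \<psi> Father x * \<psi> Father (x - of_int k)) \<partial>lborel)"
  proof (intro Bochner_Integration.integral_cong refl)
    fix x
    show "\<psi> Father x * periodic_sum x = (\<Sum>k\<in>{-l..l}. \<psi> Father x * \<psi> Father (x - of_int k))"
    proof (cases "\<bar>x\<bar> \<le> R")
      case True
      then show ?thesis
        by (subst periodic_sum_superset[where r=R and m=l]) (auto simp: l_def sum_distrib_left)
    qed (simp add: supp)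
  qed
  also have "\<dots> = (\<Sum>k\<in>{-l..l}. of_bool (k = 0))"
  proof (subst Bochner_Integration.integral_sum)
    show "integrable lborel (\<lambda>x. \<psi> Father x * \<psi> Father (x - of_int k))" for k :: int
      by (intro integrable_mult' cont)
  qed (use orthonormal_shift[of Father 0 Father] in \<open>auto intro!: sum.cong\<close>)
  also have "\<dots> = 1"
  proof -
    have "0 \<in> {-l..l}" using R_ge by (simp add: l_def)
    then show ?thesis by (simp add: of_bool_def if_distrib sum.delta cong: if_cong)
  qed
  finally show ?thesis using c const by simp
qed

text \<open>The kernel of the same projection at scale 2^s; the factor 2^s collects the L2
  normalizations 2^(s/2) of the two dilated functions.\<close>

definition sker where
  "sker s g x y = 2 ^ s * ker g (2 ^ s * x) (2 ^ s * y)"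

lemma sker_Suc: "sker (Suc s) Father x y = (\<Sum>g\<in>UNIV. sker s g x y)"
  using ker_two_scale[of "2 ^ s * x" "2 ^ s * y"] by (simp add: sker_def mult.assoc flip: sum_distrib_left)

lemma sker_cont [continuous_intros]:
  "continuous_on S f \<Longrightarrow> continuous_on S (\<lambda>y. sker s g x (f y))"
  unfolding sker_def by (intro continuous_intros)

lemma sker_outside: "sker s g x y = 0" if "2 * R / 2 ^ s < \<bar>y - x\<bar>"
proof -
  have "2 * R < 2 ^ s * \<bar>y - x\<bar>" using that by (simp add: field_simps)
  also have "\<dots> = \<bar>2 ^ s * y - 2 ^ s * x\<bar>" by (simp add: abs_mult right_diff_distrib flip: right_diff_distrib)
  finally show ?thesis by (simp add: sker_def ker_outside)
qed

lemma sker_integrable: "integrable lborel (sker s g x)"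
  by (rule integrable_continuous_compact_support[where S="{x - 2 * R / 2 ^ s..x + 2 * R / 2 ^ s}"])
     (auto intro!: sker_outside sker_cont continuous_intros simp: abs_if)

lemma sker_integral: "(\<integral>y. sker s Father x y \<partial>lborel) = 1"
  using integral_dilate[of "2 ^ s" "ker Father (2 ^ s * x)" 0] by (simp add: sker_def ker_integral)

text \<open>The point is uniformity in s and x: rescaling removes s, and the unscaled kernel is
  bounded and lives on an interval of length 4R.\<close>

lemma sker_abs_integral: "(\<integral>y. \<bar>sker s g x y\<bar> \<partial>lborel) \<le> (2 * R + 1) * bound\<^sup>2 * (4 * R)"
proof -
  have "(\<integral>y. \<bar>sker s g x y\<bar> \<partial>lborel) = (\<integral>y. \<bar>ker g (2 ^ s * x) y\<bar> \<partial>lborel)"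
    using integral_dilate[of "2 ^ s" "\<lambda>y. \<bar>ker g (2 ^ s * x) y\<bar>" 0] by (simp add: sker_def abs_mult)
  also have "\<dots> \<le> (\<integral>y. (2 * R + 1) * bound\<^sup>2 * indicator {2 ^ s * x - 2 * R..2 ^ s * x + 2 * R} y \<partial>lborel)"
  proof (rule integral_mono)
    show "integrable lborel (\<lambda>y. \<bar>ker g (2 ^ s * x) y\<bar>)" by (intro integrable_abs ker_integrable)
    fix y
    show "\<bar>ker g (2 ^ s * x) y\<bar> \<le> (2 * R + 1) * bound\<^sup>2 * indicator {2 ^ s * x - 2 * R..2 ^ s * x + 2 * R} y"
      using ker_bound[of g "2 ^ s * x" y] ker_outside[where x="2 ^ s * x" and y=y and g=g]
      by (cases "y \<in> {2 ^ s * x - 2 * R..2 ^ s * x + 2 * R}") (auto simp: not_le)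
  qed (intro integrable_mult_right integrable_real_indicator, auto simp: emeasure_lborel_Icc_eq)
  also have "\<dots> = (2 * R + 1) * bound\<^sup>2 * (4 * R)" using R_ge by simp
  finally show ?thesis .
qed

end

section \<open>Lebesgue measure on the space and on the torus\<close>
lemma Basis_vec_real: "(Basis :: (real^'d) set) = (\<lambda>i. axis i 1) ` UNIV"
  by (auto simp: Basis_vec_def)

lemma inj_axis_1: "inj (\<lambda>i. axis i (1::real))"
  by (simp add: inj_def axis_eq_axis)

lemma vec_lambda_measurable:
  "(\<lambda>f. \<chi> i::'d::finite. (f i :: real)) \<in> measurable (\<Pi>\<^sub>M i\<in>UNIV. lborel) borel"
  by (subst borel_measurable_euclidean_space)
     (auto simp: Basis_vec_real inner_axis)

lemma vec_nth_measurable [measurable]: "(\<lambda>x::real^'d. x $ i) \<in> borel_measurable borel"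
  by (intro borel_measurable_continuous_onI continuous_intros)

interpretation lborel_product: product_sigma_finite "\<lambda>_::'d::finite. lborel :: real measure"
  by standard

text \<open>Makes Fubini for finite product measures available on vectors; both measures give every
  box the product of its side lengths.\<close>

lemma lborel_vec:
  "(lborel :: (real^'d) measure) = distr (\<Pi>\<^sub>M i\<in>UNIV. lborel) borel (\<lambda>f. \<chi> i. f i)"
proof (rule lborel_eqI)
  fix l u :: "real^'d"
  assume lu: "\<And>b. b \<in> Basis \<Longrightarrow> l \<bullet> b \<le> u \<bullet> b"
  have le: "l $ i \<le> u $ i" for i
    using lu[of "axis i 1"] by (simp add: Basis_vec_real inner_axis)
  have "emeasure (distr (\<Pi>\<^sub>M i\<in>UNIV. lborel) borel (\<lambda>f. \<chi> i. f i)) (box l u)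
    = emeasure (\<Pi>\<^sub>M i\<in>UNIV. lborel) ((\<lambda>f. \<chi> i. f i) -` box l u \<inter> space (\<Pi>\<^sub>M i\<in>UNIV. lborel))"
    by (intro emeasure_distr vec_lambda_measurable) auto
  also have "(\<lambda>f. \<chi> i. f i) -` box l u \<inter> space (\<Pi>\<^sub>M i\<in>(UNIV::'d set). lborel) = Pi\<^sub>E UNIV (\<lambda>i. {l $ i <..< u $ i})"
    by (auto simp: box_def Basis_vec_real inner_axis space_PiM PiE_def Pi_def)
  also have "emeasure (\<Pi>\<^sub>M i\<in>UNIV. lborel) (Pi\<^sub>E UNIV (\<lambda>i. {l $ i <..< u $ i})) = (\<Prod>i\<in>UNIV. emeasure lborel {l $ i <..< u $ i})"
    by (rule lborel_product.emeasure_PiM) auto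
  also have "\<dots> = ennreal (\<Prod>i\<in>UNIV. (u $ i - l $ i))"
    using le by (simp add: prod_ennreal)
  also have "(\<Prod>i\<in>UNIV. (u $ i - l $ i)) = (\<Prod>b\<in>Basis. (u - l) \<bullet> b)"
    unfolding Basis_vec_real by (subst prod.reindex) (auto simp: inj_axis_1 inner_axis)
  finally show "emeasure (distr (\<Pi>\<^sub>M i\<in>UNIV. lborel) borel (\<lambda>f. \<chi> i. f i)) (box l u) = (\<Prod>b\<in>Basis. (u - l) \<bullet> b)"
    by simp
qed simp

lemma integral_vec:
  fixes f :: "real^'d \<Rightarrow> real"
  assumes "f \<in> borel_measurable borel"
  shows "(\<integral>x. f x \<partial>lborel) = (\<integral>x. f (\<chi> i. x i) \<partial>(\<Pi>\<^sub>M i\<in>UNIV. lborel))"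
  by (subst lborel_vec) (rule integral_distr[OF vec_lambda_measurable assms])

lemma integrable_vec:
  fixes f :: "real^'d \<Rightarrow> real"
  assumes "f \<in> borel_measurable borel"
  shows "integrable lborel f \<longleftrightarrow> integrable (\<Pi>\<^sub>M i\<in>UNIV. lborel) (\<lambda>x. f (\<chi> i. x i))"
  by (subst lborel_vec) (rule integrable_distr_eq[OF vec_lambda_measurable assms])

lemma product_vec:
  fixes f :: "'d::finite \<Rightarrow> real \<Rightarrow> real"
  assumes f: "\<And>a. integrable lborel (f a)"
  shows integrable_product_vec: "integrable lborel (\<lambda>x::real^'d. \<Prod>a\<in>UNIV. f a (x $ a))"
    and integral_product_vec: "(\<integral>x. (\<Prod>a\<in>UNIV. f a ((x::real^'d) $ a)) \<partial>lborel) = (\<Prod>a\<in>UNIV. \<integral>t. f a t \<partial>lborel)"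
proof -
  have [measurable]: "f a \<in> borel_measurable borel" for a
    using borel_measurable_integrable[OF f] by simp
  have m: "(\<lambda>x::real^'d. \<Prod>a\<in>UNIV. f a (x $ a)) \<in> borel_measurable borel" by measurable
  show "integrable lborel (\<lambda>x::real^'d. \<Prod>a\<in>UNIV. f a (x $ a))"
    unfolding integrable_vec[OF m] using lborel_product.product_integrable_prod[of UNIV f] f by simp
  show "(\<integral>x. (\<Prod>a\<in>UNIV. f a ((x::real^'d) $ a)) \<partial>lborel) = (\<Prod>a\<in>UNIV. \<integral>t. f a t \<partial>lborel)"
    unfolding integral_vec[OF m] using lborel_product.product_integral_prod[of UNIV f] f by simp
qed

text \<open>Integrates over the coordinate \<open>a\<close> first.\<close>

lemma integral_coordinate_bound:
  fixes f :: "'d::finite \<Rightarrow> real \<Rightarrow> real" and \<phi> :: "real^'d \<Rightarrow> real"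
  assumes f: "\<And>b. integrable lborel (f b)" and "integrable lborel (\<lambda>x. (\<Prod>b\<in>UNIV. f b (x $ b)) * \<phi> x)"
    and E: "\<And>x. \<bar>\<integral>t. f a t * \<phi> (x + (t - x $ a) *\<^sub>R axis a 1) \<partial>lborel\<bar> \<le> E"
  shows "\<bar>\<integral>x. (\<Prod>b\<in>UNIV. f b (x $ b)) * \<phi> x \<partial>lborel\<bar> \<le> E * (\<Prod>b\<in>UNIV - {a}. \<integral>t. \<bar>f b t\<bar> \<partial>lborel)"
proof -
  let ?F = "\<lambda>x::real^'d. (\<Prod>b\<in>UNIV. f b (x $ b)) * \<phi> x"
  have E0: "0 \<le> E" using E[of 0] by linarith
  have m: "?F \<in> borel_measurable borel" using borel_measurable_integrable[OF assms(2)] by simp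
  have U: "insert a (UNIV - {a}) = UNIV" by auto
  have int: "integrable (Pi\<^sub>M (insert a (UNIV - {a})) (\<lambda>_. lborel)) (\<lambda>x. ?F (\<chi> i. x i))"
    using assms(2) unfolding U integrable_vec[OF m] .
  let ?g = "\<lambda>x. \<integral>t. ?F (\<chi> i. (x(a := t)) i) \<partial>lborel"
  let ?h = "\<lambda>x. E * (\<Prod>b\<in>UNIV - {a}. \<bar>f b (x b)\<bar>)"
  have g_le: "\<bar>?g x\<bar> \<le> ?h x" for x :: "'d \<Rightarrow> real"
  proof -
    have "?F (\<chi> i. (x(a := t)) i) = (\<Prod>b\<in>UNIV - {a}. f b (x b)) * (f a t * \<phi> ((\<chi> i. x i) + (t - (\<chi> i. x i) $ a) *\<^sub>R axis a 1))" for t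
    proof -
      have "(\<Prod>b\<in>UNIV. f b ((\<chi> i. (x(a := t)) i) $ b)) = (\<Prod>b\<in>insert a (UNIV - {a}). f b ((\<chi> i. (x(a := t)) i) $ b))"
        by (simp only: U)
      also have "\<dots> = f a t * (\<Prod>b\<in>UNIV - {a}. f b (x b))"
        by (subst prod.insert) (auto intro!: prod.cong)
      finally have p: "(\<Prod>b\<in>UNIV. f b ((\<chi> i. (x(a := t)) i) $ b)) = f a t * (\<Prod>b\<in>UNIV - {a}. f b (x b))" .
      have "(\<chi> i. (x(a := t)) i) = (\<chi> i. x i) + (t - (\<chi> i. x i) $ a) *\<^sub>R axis a 1"
        by (auto simp: vec_eq_iff axis_def)
      then show ?thesis using p by (simp only: ac_simps)
    qed
    then have "?g x = (\<Prod>b\<in>UNIV - {a}. f b (x b)) * (\<integral>t. f a t * \<phi> ((\<chi> i. x i) + (t - (\<chi> i. x i) $ a) *\<^sub>R axis a 1) \<partial>lborel)"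
      by (simp only: integral_mult_right_zero)
    then have "\<bar>?g x\<bar> = \<bar>\<Prod>b\<in>UNIV - {a}. f b (x b)\<bar> * \<bar>\<integral>t. f a t * \<phi> ((\<chi> i. x i) + (t - (\<chi> i. x i) $ a) *\<^sub>R axis a 1) \<partial>lborel\<bar>"
      by (simp only: abs_mult)
    also have "\<dots> \<le> \<bar>\<Prod>b\<in>UNIV - {a}. f b (x b)\<bar> * E" by (intro mult_left_mono E) simp
    finally show ?thesis by (simp only: abs_prod mult.commute)
  qed
  have hi: "integrable (Pi\<^sub>M (UNIV - {a}) (\<lambda>_. lborel)) ?h"
    by (intro integrable_mult_right lborel_product.product_integrable_prod integrable_abs f) simp
  have "(\<integral>x. ?F x \<partial>lborel) = (\<integral>x. ?F (\<chi> i. x i) \<partial>Pi\<^sub>M (insert a (UNIV - {a})) (\<lambda>_. lborel))"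
    unfolding U by (rule integral_vec[OF m])
  also have "\<dots> = (\<integral>x. ?g x \<partial>Pi\<^sub>M (UNIV - {a}) (\<lambda>_. lborel))"
    by (rule lborel_product.product_integral_insert[OF _ _ int]) auto
  also have "\<bar>\<dots>\<bar> \<le> (\<integral>x. ?h x \<partial>Pi\<^sub>M (UNIV - {a}) (\<lambda>_. lborel))"
  proof (cases "integrable (Pi\<^sub>M (UNIV - {a}) (\<lambda>_. lborel)) ?g")
    case True
    then show ?thesis
      by (intro order_trans[OF integral_abs_bound] integral_mono integrable_abs hi g_le)
  next
    \<comment> \<open>The integral of a non-integrable function is 0 by convention, and the right
      side is nonnegative.\<close>
    case False
    then show ?thesis
      unfolding not_integrable_integral_eq[OF False] using E0
      by (auto intro!: Bochner_Integration.integral_nonneg mult_nonneg_nonneg prod_nonneg)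
  qed
  also have "\<dots> = E * (\<Prod>b\<in>UNIV - {a}. \<integral>t. \<bar>f b t\<bar> \<partial>lborel)"
    by (simp only: integral_mult_right_zero)
       (subst lborel_product.product_integral_prod, auto intro!: integrable_abs f)
  finally show ?thesis .
qed

subsection \<open>Integration over the torus\<close>

definition int_vec :: "int^'d \<Rightarrow> real^'d" where
  "int_vec k = (\<chi> a. of_int (k $ a))"

lemma int_vec_nth [simp]: "int_vec k $ a = of_int (k $ a)"
  by (simp add: int_vec_def)

lemma periodic_int_vec:
  assumes "periodic f"
  shows "f (x + int_vec k) = f x"
proof -
  have nat: "f (x + real n *\<^sub>R axis a 1) = f x" for x n a
  proof (induction n)
    case (Suc n)
    have "x + real (Suc n) *\<^sub>R axis a 1 = (x + real n *\<^sub>R axis a 1) + axis a 1"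
      by (simp add: algebra_simps)
    then show ?case using Suc assms unfolding periodic_def by metis
  qed simp
  have int: "f (x + of_int i *\<^sub>R axis a 1) = f x" for x i a
  proof (cases "i \<ge> 0")
    case True
    then show ?thesis using nat[of x "nat i"] by simp
  next
    case False
    have "f (x + of_int i *\<^sub>R axis a 1 + real (nat (- i)) *\<^sub>R axis a 1) = f (x + of_int i *\<^sub>R axis a 1)" by (rule nat)
    moreover have "x + of_int i *\<^sub>R axis a 1 + real (nat (- i)) *\<^sub>R axis a 1 = x"
      using False by (simp add: add.assoc flip: scaleR_add_left)
    ultimately show ?thesis by simp
  qed
  have "f (x + (\<Sum>a\<in>A. of_int (k $ a) *\<^sub>R axis a 1)) = f x" if "finite A" for A x
    using that
  proof (induction A arbitrary: x)
    case (insert a A)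
    then show ?case using int[of "x" "k $ a" a] by (simp flip: add.assoc)
  qed simp
  moreover have "(\<Sum>a\<in>UNIV. of_int (k $ a) *\<^sub>R axis a 1) = int_vec k"
    by (simp add: vec_eq_iff axis_def if_distrib cong: if_cong)
  ultimately show ?thesis by (metis finite)
qed

definition int_box :: "int \<Rightarrow> (int^'d) set" where
  "int_box M = {k. \<forall>a. \<bar>k $ a\<bar> \<le> M}"

lemma finite_vec_PiE:
  fixes A :: "'d::finite \<Rightarrow> 'b set"
  assumes "\<And>a. finite (A a)"
  shows "finite {k :: 'b^'d. \<forall>a. k $ a \<in> A a}"
proof -
  have "{k :: 'b^'d. \<forall>a. k $ a \<in> A a} \<subseteq> vec_lambda ` Pi\<^sub>E UNIV A"
  proof
    fix k :: "'b^'d" assume "k \<in> {k. \<forall>a. k $ a \<in> A a}"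
    then have "k = vec_lambda (vec_nth k)" "vec_nth k \<in> Pi\<^sub>E UNIV A" by (auto simp: vec_nth_inverse)
    then show "k \<in> vec_lambda ` Pi\<^sub>E UNIV A" by blast
  qed
  then show ?thesis by (rule finite_subset) (intro finite_imageI finite_PiE assms finite)
qed

lemma finite_int_box: "finite (int_box M)"
  using finite_vec_PiE[of "\<lambda>_. {-M..M}"] by (simp add: int_box_def abs_le_iff minus_le_iff conj_commute)

lemma finite_positions: "finite (positions L j)"
  using finite_vec_PiE[of "\<lambda>_. {0..<2 ^ (j + L) :: int}"] by (simp add: positions_def)

text \<open>\<open>torus_measure\<close> lives on the closed cube, whose integer translates overlap
  on faces. The half-open cube tiles the space exactly and differs from it only by a null
  set.\<close>

definition half_open_cube :: "(real^'d) set" where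
  "half_open_cube = {x. \<forall>a. 0 \<le> x $ a \<and> x $ a < 1}"

lemma half_open_cube_measurable [measurable]: "half_open_cube \<in> sets borel"
  unfolding half_open_cube_def by measurable

lemma AE_cube: "AE x in lborel. indicator (cbox 0 1) x = (indicator half_open_cube x :: real)"
proof -
  have "cbox 0 1 - box 0 1 \<in> null_sets (lborel :: (real^'d) measure)"
  proof -
    have "negligible (cbox 0 1 - box 0 1 :: (real^'d) set)" by (rule negligible_frontier_interval)
    then have "emeasure lebesgue (cbox 0 1 - box 0 1 :: (real^'d) set) = 0"
      by (simp add: negligible_iff_null_sets null_setsD1)
    then show ?thesis by (intro null_setsI) auto
  qed
  then have "AE x in lborel. x \<notin> cbox 0 1 - box (0 :: real^'d) 1" by (rule AE_not_in)
  then show ?thesis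
  proof eventually_elim
    case (elim x)
    show ?case
    proof (cases "x \<in> cbox 0 1")
      case True
      then have "x \<in> box 0 1" using elim by simp
      then have "x \<in> half_open_cube" by (auto simp: half_open_cube_def mem_box_cart less_imp_le)
      then show ?thesis using True by simp
    next
      case False
      then have "x \<notin> half_open_cube" by (force simp: half_open_cube_def mem_box_cart less_imp_le)
      then show ?thesis using False by simp
    qed
  qed
qed

lemma torus_integral:
  fixes f :: "real^'d \<Rightarrow> real"
  assumes "f \<in> borel_measurable borel"
  shows "(\<integral>x. f x \<partial>torus_measure) = (\<integral>x. indicator half_open_cube x * f x \<partial>lborel)"
proof -
  have "(\<integral>x. f x \<partial>torus_measure) = (\<integral>x. indicator (cbox 0 1) x *\<^sub>R f x \<partial>lborel)"
    unfolding torus_measure_def by (rule integral_restrict_space) simp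
  also have "\<dots> = (\<integral>x. indicator half_open_cube x * f x \<partial>lborel)"
  proof (rule integral_cong_AE)
    show "(\<lambda>x. indicator (cbox 0 1) x *\<^sub>R f x) \<in> borel_measurable lborel"
      "(\<lambda>x. indicator half_open_cube x * f x) \<in> borel_measurable lborel"
      using assms by simp_all
    show "AE x in lborel. indicator (cbox 0 1) x *\<^sub>R f x = indicator half_open_cube x * f x"
      using AE_cube by eventually_elim simp
  qed
  finally show ?thesis .
qed

lemma prob_space_torus: "prob_space (torus_measure :: (real^'d) measure)"
proof
  have "emeasure torus_measure (space (torus_measure :: (real^'d) measure)) = emeasure lborel (cbox 0 1 :: (real^'d) set)"
    unfolding torus_measure_def by (simp add: emeasure_restrict_space space_restrict_space)
  also have "\<dots> = 1"
  proof -
    have "(\<Prod>b\<in>(Basis :: (real^'d) set). (1 - 0) \<bullet> b) = 1"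
      unfolding Basis_vec_real by (subst prod.reindex) (auto simp: inj_axis_1 inner_axis)
    then show ?thesis
      by (subst emeasure_lborel_cbox) (auto simp: Basis_vec_real inner_axis)
  qed
  finally show "emeasure torus_measure (space (torus_measure :: (real^'d) measure)) = 1" .
qed

lemma torus_measurable [measurable_dest]:
  "f \<in> borel_measurable borel \<Longrightarrow> f \<in> borel_measurable torus_measure"
  unfolding torus_measure_def by (intro measurable_restrict_space1) simp

lemma integral_shift_vec:
  fixes h :: "real^'d \<Rightarrow> real"
  assumes "h \<in> borel_measurable borel"
  shows "(\<integral>x. h (x + c) \<partial>lborel) = (\<integral>x. h x \<partial>lborel)"
proof -
  have "(\<integral>x. h x \<partial>lborel) = (\<integral>x. h x \<partial>distr lborel borel ((+) c))" by (simp add: lborel_distr_plus)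
  also have "\<dots> = (\<integral>x. h (c + x) \<partial>lborel)" by (rule integral_distr) (use assms in auto)
  finally show ?thesis by (simp add: add.commute)
qed

text \<open>Exactly one integer translate of the half-open cube contains a given point.\<close>

lemma torus_unfold:
  fixes h :: "real^'d \<Rightarrow> real"
  assumes h: "integrable lborel h" and supp: "\<And>x a. r \<le> \<bar>x $ a\<bar> \<Longrightarrow> h x = 0"
  shows "(\<integral>x. (\<Sum>\<^sub>\<infinity>k. h (x - int_vec k)) \<partial>torus_measure) = (\<integral>x. h x \<partial>lborel)"
proof -
  have [measurable]: "h \<in> borel_measurable borel" using borel_measurable_integrable[OF h] by simp
  \<comment> \<open>Large enough for two purposes: every translate of h that reaches the closed unit
    cube has its index in the box, and so does the rounded position of every point where h is
    nonzero.\<close>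
  define M where "M = \<lceil>\<bar>r\<bar> + 2\<rceil>"
  have M: "\<bar>r\<bar> + 2 \<le> of_int M" by (simp add: M_def)
  let ?Q = "half_open_cube :: (real^'d) set"
  have inM: "k \<in> int_box M" if "h (x - int_vec k) \<noteq> 0" "x \<in> cbox 0 1" for x k
    unfolding int_box_def
  proof (safe)
    fix a
    have "\<bar>(x - int_vec k) $ a\<bar> < r" using that(1) supp[of "x - int_vec k" a] by (meson not_le)
    then have "\<bar>x $ a - of_int (k $ a)\<bar> < r" by simp
    moreover have "0 \<le> x $ a" "x $ a \<le> 1" using that(2) by (auto simp: mem_box_cart)
    ultimately have "\<bar>of_int (k $ a) :: real\<bar> \<le> of_int M" using M by linarith
    then show "\<bar>k $ a\<bar> \<le> M" by linarith
  qed
  have fin: "(\<Sum>\<^sub>\<infinity>k. h (x - int_vec k)) = (\<Sum>k\<in>int_box M. h (x - int_vec k))" if "x \<in> cbox 0 1" for x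
  proof -
    have "(\<Sum>\<^sub>\<infinity>k. h (x - int_vec k)) = (\<Sum>\<^sub>\<infinity>k\<in>int_box M. h (x - int_vec k))"
      by (rule infsum_cong_neutral) (use inM that in auto)
    then show ?thesis by (simp add: infsum_finite finite_int_box)
  qed
  have ih: "integrable lborel (\<lambda>x. indicator ?Q (x + int_vec k) * h x)" for k
    by (intro integrable_real_mult_indicator[unfolded mult.commute[of "h _"]] Bochner_Integration.integrable_bound[OF h])
       (auto simp: indicator_def)
  have "(\<integral>x. (\<Sum>\<^sub>\<infinity>k. h (x - int_vec k)) \<partial>torus_measure) = (\<integral>x. (\<Sum>k\<in>int_box M. h (x - int_vec k)) \<partial>torus_measure)"
    by (intro Bochner_Integration.integral_cong refl fin) (simp add: torus_measure_def space_restrict_space)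
  also have "\<dots> = (\<integral>x. (\<Sum>k\<in>int_box M. indicator ?Q x * h (x - int_vec k)) \<partial>lborel)"
    by (subst torus_integral) (auto simp: sum_distrib_left)
  also have "\<dots> = (\<Sum>k\<in>int_box M. \<integral>x. indicator ?Q x * h (x - int_vec k) \<partial>lborel)"
  proof (rule Bochner_Integration.integral_sum)
    fix k :: "int^'d"
    have "integrable (distr lborel borel ((+) (int_vec k))) (\<lambda>x. indicator ?Q x * h (x - int_vec k))"
      by (subst integrable_distr_eq) (use ih[of k] in \<open>auto simp: add.commute\<close>)
    then show "integrable lborel (\<lambda>x. indicator ?Q x * h (x - int_vec k))" by (simp add: lborel_distr_plus)
  qed
  also have "\<dots> = (\<Sum>k\<in>int_box M. \<integral>x. indicator ?Q (x + int_vec k) * h x \<partial>lborel)"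
  proof (intro sum.cong refl)
    fix k :: "int^'d"
    show "(\<integral>x. indicator ?Q x * h (x - int_vec k) \<partial>lborel) = (\<integral>x. indicator ?Q (x + int_vec k) * h x \<partial>lborel)"
      using integral_shift_vec[of "\<lambda>x. indicator ?Q x * h (x - int_vec k)" "int_vec k"] by simp
  qed
  also have "\<dots> = (\<integral>x. (\<Sum>k\<in>int_box M. indicator ?Q (x + int_vec k) * h x) \<partial>lborel)"
    by (rule Bochner_Integration.integral_sum[symmetric]) (rule ih)
  also have "\<dots> = (\<integral>x. h x \<partial>lborel)"
  proof (intro Bochner_Integration.integral_cong refl)
    fix x :: "real^'d"
    show "(\<Sum>k\<in>int_box M. indicator ?Q (x + int_vec k) * h x) = h x"
    proof (cases "h x = 0")
      case False
      define k0 :: "int^'d" where "k0 = (\<chi> a. - \<lfloor>x $ a\<rfloor>)"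
      have iff: "x + int_vec k \<in> ?Q \<longleftrightarrow> k = k0" for k
      proof -
        have "0 \<le> x $ a + of_int (k $ a) \<and> x $ a + of_int (k $ a) < 1 \<longleftrightarrow> k $ a = - \<lfloor>x $ a\<rfloor>" for a
          by linarith
        then show ?thesis by (simp add: half_open_cube_def vec_eq_iff k0_def)
      qed
      have "k0 \<in> int_box M" unfolding int_box_def
      proof safe
        fix a
        have "\<bar>x $ a\<bar> < r" using supp[of x a] False by (meson not_le)
        then show "\<bar>k0 $ a\<bar> \<le> M" using M unfolding k0_def by (simp add: abs_le_iff) linarith
      qed
      then have "(\<Sum>k\<in>int_box M. indicator ?Q (x + int_vec k) * h x) = (\<Sum>k\<in>int_box M. if k = k0 then h x else 0)"
        by (intro sum.cong refl) (auto simp: indicator_def iff)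
      then show ?thesis using \<open>k0 \<in> int_box M\<close> by (simp add: finite_int_box)
    qed simp
  qed
  finally show ?thesis .
qed

section \<open>Test functions\<close>

lemma iterated_partial_Nil [simp]: "iterated_partial [] f = f"
  by (simp add: iterated_partial_def)

lemma iterated_partial_Cons [simp]: "iterated_partial (i # is) f = partial_deriv i (iterated_partial is f)"
  by (simp add: iterated_partial_def)

lemma test_periodic: "\<phi> \<in> test_functions \<Longrightarrow> periodic \<phi>"
  and test_differentiable: "\<phi> \<in> test_functions \<Longrightarrow> iterated_partial is \<phi> differentiable (at x)"
  by (simp_all add: test_functions_def)

lemma test_continuous: "\<phi> \<in> test_functions \<Longrightarrow> continuous_on S (iterated_partial is \<phi>)"
  by (auto intro!: continuous_at_imp_continuous_on differentiable_imp_continuous_within test_differentiable)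

lemma test_continuous': "\<phi> \<in> test_functions \<Longrightarrow> continuous_on S \<phi>"
  using test_continuous[of \<phi> S "[]"] by simp

lemma periodic_partial_deriv: "periodic f \<Longrightarrow> periodic (partial_deriv i f)"
proof -
  assume f: "periodic f"
  have "f (x + axis a 1 + t *\<^sub>R axis i 1) = f (x + t *\<^sub>R axis i 1)" for x a t
    using f unfolding periodic_def by (metis add.assoc add.commute)
  then show ?thesis by (simp add: periodic_def partial_deriv_def)
qed

lemma periodic_iterated_partial: "\<phi> \<in> test_functions \<Longrightarrow> periodic (iterated_partial is \<phi>)"
  by (induction "is") (auto intro: periodic_partial_deriv test_periodic)

lemma periodic_representative:
  fixes x :: "real^'d"
  obtains y where "y \<in> cbox 0 1" "\<And>f. periodic f \<Longrightarrow> f x = f y"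
proof
  let ?k = "\<chi> a. \<lfloor>x $ a\<rfloor>"
  show "x - int_vec ?k \<in> cbox 0 1"
    by (auto simp: mem_box_cart) linarith
  show "f x = f (x - int_vec ?k)" if "periodic f" for f
    using periodic_int_vec[OF that, of "x - int_vec ?k" ?k] by simp
qed

lemma periodic_bounded:
  fixes f :: "real^'d \<Rightarrow> real"
  assumes "continuous_on UNIV f" "periodic f"
  shows "bdd_above (range (\<lambda>x. \<bar>f x\<bar>))"
proof -
  have "bounded (f ` cbox 0 1)"
    by (intro compact_imp_bounded compact_continuous_image continuous_on_subset[OF assms(1)]) auto
  then obtain B where B: "\<forall>x\<in>cbox 0 1. \<bar>f x\<bar> \<le> B" unfolding bounded_iff by auto
  have "\<bar>f x\<bar> \<le> B" for x
    by (rule periodic_representative[of x]) (use B assms(2) in metis)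
  then show ?thesis by (intro bdd_aboveI[of _ B]) auto
qed

lemma finite_derivs: "finite {is :: 'd::finite list. length is \<le> N}"
  using finite_lists_length_le[of "UNIV :: 'd set" N] by simp

lemma test_seminorm_ge:
  assumes "\<phi> \<in> test_functions" "length is \<le> N"
  shows "\<bar>iterated_partial is \<phi> x\<bar> \<le> test_seminorm N \<phi>"
proof -
  have b: "bdd_above (range (\<lambda>x. \<bar>iterated_partial is \<phi> x\<bar>))" for "is"
    by (intro periodic_bounded test_continuous periodic_iterated_partial assms)
  have "0 \<le> (SUP x. \<bar>iterated_partial is \<phi> x\<bar>)" for "is"
    by (rule cSUP_upper2[OF b, of undefined]) auto
  then have "(SUP x. \<bar>iterated_partial is \<phi> x\<bar>) \<le> test_seminorm N \<phi>"
    unfolding test_seminorm_def using assms(2)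
    by (intro member_le_sum[of "is" _ "\<lambda>is. SUP x. \<bar>iterated_partial is \<phi> x\<bar>"]) (auto simp: finite_derivs)
  moreover have "\<bar>iterated_partial is \<phi> x\<bar> \<le> (SUP x. \<bar>iterated_partial is \<phi> x\<bar>)"
    by (rule cSUP_upper[OF _ b]) auto
  ultimately show ?thesis by linarith
qed

lemma test_seminorm_nonneg: "\<phi> \<in> test_functions \<Longrightarrow> 0 \<le> test_seminorm N \<phi>"
  by (rule order_trans[OF abs_ge_zero test_seminorm_ge[of \<phi> "[]" N undefined]]) auto

lemma test_seminorm_le:
  fixes \<phi> :: "real^'d \<Rightarrow> real"
  assumes "\<And>is x. length is \<le> N \<Longrightarrow> \<bar>iterated_partial is \<phi> x\<bar> \<le> B"
  shows "test_seminorm N \<phi> \<le> real (card {is :: 'd list. length is \<le> N}) * B"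
  unfolding test_seminorm_def
  by (rule sum_bounded_above) (auto intro!: cSUP_least assms)

lemma test_seminorm_mono:
  assumes "\<phi> \<in> test_functions" "N \<le> M"
  shows "test_seminorm N \<phi> \<le> test_seminorm M \<phi>"
  unfolding test_seminorm_def
proof (rule sum_mono2)
  fix "is" :: "'a list"
  have b: "bdd_above (range (\<lambda>x. \<bar>iterated_partial is \<phi> x\<bar>))"
    by (intro periodic_bounded test_continuous periodic_iterated_partial assms)
  show "0 \<le> (SUP x. \<bar>iterated_partial is \<phi> x\<bar>)"
    by (rule cSUP_upper2[OF b, of undefined]) auto
qed (use assms(2) finite_derivs in auto)

lemma line_derivative:
  assumes "f differentiable (at (x + t *\<^sub>R axis i 1))"
  shows "((\<lambda>t. f (x + t *\<^sub>R axis i 1)) has_real_derivative partial_deriv i f (x + t *\<^sub>R axis i 1)) (at t)"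
proof -
  let ?h = "\<lambda>s. f (x + s *\<^sub>R axis i 1)"
  have "(\<lambda>s. f (x + t *\<^sub>R axis i 1 + s *\<^sub>R axis i 1)) differentiable (at 0)"
    by (rule differentiable_compose[of f "\<lambda>s. x + t *\<^sub>R axis i 1 + s *\<^sub>R axis i 1"])
       (use assms in \<open>auto intro!: derivative_intros\<close>)
  then have "((\<lambda>s. f (x + t *\<^sub>R axis i 1 + s *\<^sub>R axis i 1)) has_real_derivative partial_deriv i f (x + t *\<^sub>R axis i 1)) (at 0)"
    unfolding partial_deriv_def by (simp add: DERIV_deriv_iff_real_differentiable)
  moreover have "(\<lambda>s. f (x + t *\<^sub>R axis i 1 + s *\<^sub>R axis i 1)) = (\<lambda>s. ?h (s + t))"
    by (simp add: algebra_simps)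
  ultimately show ?thesis using DERIV_shift[of ?h _ 0 t] by simp
qed

lemma partial_deriv_eqI:
  assumes "((\<lambda>t. f (x + t *\<^sub>R axis i 1)) has_real_derivative D) (at 0)"
  shows "partial_deriv i f x = D"
  unfolding partial_deriv_def using assms by (rule DERIV_imp_deriv)

lemma partial_deriv_lin:
  assumes "f differentiable (at x)" "g differentiable (at x)"
  shows "partial_deriv i (\<lambda>x. f x + c * g x) x = partial_deriv i f x + c * partial_deriv i g x"
proof (rule partial_deriv_eqI)
  show "((\<lambda>t. f (x + t *\<^sub>R axis i 1) + c * g (x + t *\<^sub>R axis i 1)) has_real_derivative partial_deriv i f x + c * partial_deriv i g x) (at 0)"
    using line_derivative[of f x 0 i] line_derivative[of g x 0 i] assms
    by (auto intro!: derivative_eq_intros)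
qed

lemma iterated_partial_lin:
  assumes "\<phi> \<in> test_functions" "\<eta> \<in> test_functions"
  shows "iterated_partial is (\<lambda>x. \<phi> x + c * \<eta> x) = (\<lambda>x. iterated_partial is \<phi> x + c * iterated_partial is \<eta> x)"
proof (induction "is")
  case (Cons i "is")
  then show ?case by (simp add: partial_deriv_lin test_differentiable assms)
qed simp

lemma test_lin:
  assumes "\<phi> \<in> test_functions" "\<eta> \<in> test_functions"
  shows "(\<lambda>x. \<phi> x + c * \<eta> x) \<in> test_functions"
  using assms unfolding test_functions_def
  by (auto simp: periodic_def iterated_partial_lin[OF assms] intro!: derivative_intros)

lemma partial_deriv_const: "partial_deriv i (\<lambda>x. c) = (\<lambda>x. 0)"
  by (auto simp: fun_eq_iff intro!: partial_deriv_eqI)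

text \<open>Exhibits test functions without computing iterated derivatives, which never leave a
  class closed under \<open>partial_deriv\<close>.\<close>

lemma test_closed_class:
  assumes "\<And>f. f \<in> A \<Longrightarrow> periodic f" "\<And>f x. f \<in> A \<Longrightarrow> f differentiable (at x)"
    and "\<And>f i. f \<in> A \<Longrightarrow> partial_deriv i f \<in> A"
  shows "A \<subseteq> test_functions"
proof
  fix f assume f: "f \<in> A"
  have "iterated_partial is f \<in> A" for "is"
    by (induction "is") (auto intro: f assms)
  then show "f \<in> test_functions" using assms f by (auto simp: test_functions_def)
qed

lemma test_zero: "(\<lambda>x. 0) \<in> test_functions"
proof -
  have "{\<lambda>x. 0} \<subseteq> test_functions"
    by (rule test_closed_class) (auto simp: periodic_def partial_deriv_const)
  then show ?thesis by simp
qed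

lemma test_scale: "\<phi> \<in> test_functions \<Longrightarrow> (\<lambda>x. c * \<phi> x) \<in> test_functions"
  using test_lin[OF test_zero, of \<phi> c] by simp

lemma test_diff: "\<phi> \<in> test_functions \<Longrightarrow> \<eta> \<in> test_functions \<Longrightarrow> (\<lambda>x. \<phi> x - \<eta> x) \<in> test_functions"
  using test_lin[of \<phi> \<eta> "-1"] by simp

lemma test_sum:
  "(\<And>i. i \<in> I \<Longrightarrow> \<phi> i \<in> test_functions) \<Longrightarrow> (\<lambda>x. \<Sum>i\<in>I. c i * \<phi> i x) \<in> test_functions"
proof (induction I rule: infinite_finite_induct)
  case (insert i I)
  then show ?case using test_lin[of "\<lambda>x. \<Sum>i\<in>I. c i * \<phi> i x" "\<phi> i" "c i"] by (simp add: add.commute)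
qed (auto intro: test_zero)

text \<open>On coordinate vectors the derivative takes the values of the partial derivatives, so its
  operator norm is at most the sum of d of them, each controlled by the seminorm of the next
  order.\<close>

lemma test_lipschitz:
  fixes \<phi> :: "real^'d \<Rightarrow> real"
  assumes t: "\<phi> \<in> test_functions" and "length is \<le> N"
  shows "\<bar>iterated_partial is \<phi> x - iterated_partial is \<phi> y\<bar> \<le> real CARD('d) * test_seminorm (Suc N) \<phi> * norm (x - y)"
proof -
  let ?f = "iterated_partial is \<phi>"
  have "\<exists>f'. \<forall>x. (?f has_derivative f' x) (at x)"
    using test_differentiable[OF t] unfolding differentiable_def by metis
  then obtain f' where f': "\<And>x. (?f has_derivative f' x) (at x)" by blast
  have ax: "f' z (axis i 1) = partial_deriv i ?f z" for z i
  proof -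
    have "((\<lambda>t. ?f (z + t *\<^sub>R axis i 1)) has_derivative (\<lambda>t. f' z (t *\<^sub>R axis i 1))) (at 0)"
      by (rule has_derivative_compose[of "\<lambda>t. z + t *\<^sub>R axis i 1" "\<lambda>t. t *\<^sub>R axis i 1" 0 UNIV ?f])
         (use f'[of z] in \<open>auto intro!: derivative_eq_intros\<close>)
    then have "((\<lambda>t. ?f (z + t *\<^sub>R axis i 1)) has_real_derivative f' z (axis i 1)) (at 0)"
      unfolding has_field_derivative_def
      using linear_scale[OF has_derivative_linear[OF f'[of z]]] by (simp add: mult.commute[of _ "f' _ _"] mult_commute_abs)
    then show ?thesis by (rule partial_deriv_eqI[symmetric])
  qed
  have on: "onorm (f' z) \<le> real CARD('d) * test_seminorm (Suc N) \<phi>" for z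
  proof (rule onorm_le)
    fix h :: "real^'d"
    have "h = (\<Sum>i\<in>UNIV. (h $ i) *\<^sub>R axis i 1)"
      by (simp add: vec_eq_iff axis_def if_distrib cong: if_cong)
    then have "f' z h = (\<Sum>i\<in>UNIV. (h $ i) *\<^sub>R f' z (axis i 1))"
      by (metis (no_types, lifting) linear_sum[OF has_derivative_linear[OF f'[of z]]] linear_scale[OF has_derivative_linear[OF f'[of z]]] sum.cong)
    then have "norm (f' z h) \<le> (\<Sum>i\<in>UNIV. \<bar>h $ i\<bar> * \<bar>partial_deriv i ?f z\<bar>)"
      by (simp add: ax) (rule order_trans[OF sum_abs], simp add: abs_mult)
    also have "\<dots> \<le> (\<Sum>i\<in>(UNIV::'d set). norm h * test_seminorm (Suc N) \<phi>)"
    proof (intro sum_mono mult_mono)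
      fix i
      show "\<bar>h $ i\<bar> \<le> norm h" by (rule component_le_norm_cart)
      show "\<bar>partial_deriv i ?f z\<bar> \<le> test_seminorm (Suc N) \<phi>"
        using test_seminorm_ge[OF t, of "i # is" "Suc N" z] assms(2) by simp
    qed auto
    finally show "norm (f' z h) \<le> real CARD('d) * test_seminorm (Suc N) \<phi> * norm h" by (simp add: ac_simps)
  qed
  have "norm (?f x - ?f y) \<le> real CARD('d) * test_seminorm (Suc N) \<phi> * norm (x - y)"
    by (rule differentiable_bound[of UNIV ?f f']) (auto simp: f' on)
  then show ?thesis by simp
qed

subsection \<open>Separability\<close>

text \<open>A test function is determined, up to a small error in the seminorm of order \<open>N\<close>, by the
  rounded values of its derivatives on a fine grid and a bound for the seminorm of order \<open>N + 1\<close>.\<close>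

lemma test_separable:
  "\<exists>D. countable D \<and> D \<subseteq> (test_functions :: (real^'d \<Rightarrow> real) set) \<and>
     (\<forall>\<phi>\<in>test_functions. \<forall>N. \<forall>\<epsilon>>0. \<exists>\<eta>\<in>D. test_seminorm N (\<lambda>x. \<phi> x - \<eta> x) < \<epsilon>)"
proof -
  define I :: "nat \<Rightarrow> nat \<Rightarrow> ('d list \<times> (int^'d)) set"
    where "I n N = {is. length is \<le> N} \<times> int_box (int n)" for n N
  \<comment> \<open>Integer parts of n times the values on a grid of spacing 1/n. The index set is
    finite, so there are only countably many codes, and D takes one function from each nonempty
    class with given n, N, code and seminorm bound.\<close>
  define code :: "nat \<Rightarrow> nat \<Rightarrow> (real^'d \<Rightarrow> real) \<Rightarrow> 'd list \<times> (int^'d) \<Rightarrow> int"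
    where "code n N \<phi> = (\<lambda>(is, k)\<in>I n N. \<lfloor>real n * iterated_partial is \<phi> ((1 / real n) *\<^sub>R int_vec k)\<rfloor>)" for n N \<phi>
  define P where "P n N b c \<phi> \<longleftrightarrow> \<phi> \<in> test_functions \<and> test_seminorm (Suc N) \<phi> \<le> real b \<and> code n N \<phi> = c" for n N b c \<phi>
  define pick where "pick n N b c = (SOME \<phi>. P n N b c \<phi>)" for n N b c
  define D where "D = (\<Union>n. \<Union>N. \<Union>b. pick n N b ` {c \<in> Pi\<^sub>E (I n N) (\<lambda>_. UNIV). \<exists>\<phi>. P n N b c \<phi>})"
  have finI: "finite (I n N)" for n N by (simp add: I_def finite_derivs finite_int_box)
  have "countable D" unfolding D_def
    by (intro countable_UN countable_image countable_Collect countable_PiE finI) auto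
  moreover have pick: "P n N b c (pick n N b c)" if "P n N b c \<phi>" for n N b c \<phi>
    unfolding pick_def using that by (rule someI[of "P n N b c"])
  then have "D \<subseteq> test_functions" by (auto simp: D_def P_def)
  moreover have "\<exists>\<eta>\<in>D. test_seminorm N (\<lambda>x. \<phi> x - \<eta> x) < \<epsilon>" if t: "\<phi> \<in> test_functions" and e: "\<epsilon> > 0" for \<phi> N \<epsilon>
  proof -
    obtain b :: nat where b: "test_seminorm (Suc N) \<phi> \<le> real b" using real_arch_simple by blast
    let ?d = "real CARD('d)" and ?c = "real (card {is :: 'd list. length is \<le> N})"
    \<comment> \<open>K/n will be the total error: each derivative contributes two Lipschitz errors
      over a distance of at most d/n and one rounding error 1/n, and the seminorm sums over all
      derivatives of order at most N.\<close>
    define K where "K = ?c * (2 * ?d * real b * ?d + 1)"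
    obtain n :: nat where n: "real n > max 1 (K / \<epsilon>)" using reals_Archimedean2 by blast
    then have n0: "real n > 0" "n > 0" by auto
    define \<eta> where "\<eta> = pick n N b (code n N \<phi>)"
    have "P n N b (code n N \<phi>) \<phi>" using t b by (simp add: P_def)
    moreover from pick[OF this] have \<eta>: "\<eta> \<in> test_functions" "test_seminorm (Suc N) \<eta> \<le> real b" "code n N \<eta> = code n N \<phi>"
      by (auto simp: \<eta>_def P_def)
    moreover have "code n N \<phi> \<in> Pi\<^sub>E (I n N) (\<lambda>_. UNIV)" by (simp add: code_def)
    ultimately have "\<eta> \<in> D" unfolding D_def \<eta>_def by blast
    have close: "\<bar>iterated_partial is (\<lambda>x. \<phi> x - \<eta> x) x\<bar> \<le> (2 * ?d * real b * ?d + 1) / real n" if l: "length is \<le> N" for "is" x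
    proof -
      have lin: "iterated_partial is (\<lambda>x. \<phi> x - \<eta> x) = (\<lambda>x. iterated_partial is \<phi> x - iterated_partial is \<eta> x)"
        using iterated_partial_lin[OF t \<eta>(1), of "is" "-1"] by simp
      let ?f = "iterated_partial is \<phi>" and ?g = "iterated_partial is \<eta>"
      obtain y where y: "y \<in> cbox 0 1" "?f x = ?f y" "?g x = ?g y"
        using periodic_representative[of x] periodic_iterated_partial[OF t] periodic_iterated_partial[OF \<eta>(1)] by metis
      define k :: "int^'d" where "k = (\<chi> a. \<lfloor>real n * y $ a\<rfloor>)"
      define z where "z = (1 / real n) *\<^sub>R int_vec k"
      have "k \<in> int_box (int n)" unfolding int_box_def
      proof safe
        fix a
        have "0 \<le> y $ a" "y $ a \<le> 1" using y by (auto simp: mem_box_cart)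
        then have "0 \<le> real n * y $ a" "real n * y $ a \<le> real n" using n0 by (auto simp: mult_left_le)
        then show "\<bar>k $ a\<bar> \<le> int n" unfolding k_def by simp linarith
      qed
      then have "(is, k) \<in> I n N" using l by (simp add: I_def)
      then have "\<lfloor>real n * ?f z\<rfloor> = \<lfloor>real n * ?g z\<rfloor>"
        using fun_cong[OF \<eta>(3), of "(is, k)"] by (simp add: code_def z_def)
      then have "\<bar>real n * ?f z - real n * ?g z\<bar> \<le> 1" by linarith
      then have "real n * \<bar>?f z - ?g z\<bar> \<le> 1" by (simp add: abs_mult flip: right_diff_distrib)
      then have fg: "\<bar>?f z - ?g z\<bar> \<le> 1 / real n" using n0 by (simp add: field_simps)
      have "\<bar>(y - z) $ a\<bar> \<le> 1 / real n" for a
      proof -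
        have "\<bar>real n * y $ a - of_int (k $ a)\<bar> \<le> 1" unfolding k_def by simp linarith
        moreover have "(y - z) $ a = (real n * y $ a - of_int (k $ a)) / real n"
          using n0 by (simp add: z_def field_simps)
        ultimately show ?thesis using n0 by (simp add: divide_right_mono)
      qed
      then have "norm (y - z) \<le> (\<Sum>a\<in>(UNIV :: 'd set). 1 / real n)"
        by (intro order_trans[OF norm_le_l1_cart] sum_mono) auto
      then have yz: "norm (y - z) \<le> ?d / real n" by simp
      have lip: "\<bar>iterated_partial is h y - iterated_partial is h z\<bar> \<le> ?d * real b * (?d / real n)"
        if "h \<in> test_functions" "test_seminorm (Suc N) h \<le> real b" for h
      proof -
        have "\<bar>iterated_partial is h y - iterated_partial is h z\<bar> \<le> ?d * test_seminorm (Suc N) h * norm (y - z)"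
          by (rule test_lipschitz[OF that(1) l])
        also have "\<dots> \<le> ?d * real b * (?d / real n)"
          by (intro mult_mono mult_left_mono that yz mult_nonneg_nonneg test_seminorm_nonneg) auto
        finally show ?thesis .
      qed
      have "\<bar>?f y - ?g y\<bar> \<le> ?d * real b * (?d / real n) + ?d * real b * (?d / real n) + 1 / real n"
      proof -
        have tri: "\<bar>p - q\<bar> \<le> A + A + B" if "\<bar>p - p'\<bar> \<le> A" "\<bar>q - q'\<bar> \<le> A" "\<bar>p' - q'\<bar> \<le> B" for p q p' q' A B :: real
          using that by linarith
        show ?thesis by (rule tri[OF lip[OF t b] lip[OF \<eta>(1,2)] fg])
      qed
      also have "\<dots> = (2 * ?d * real b * ?d + 1) / real n" by (simp add: add_divide_distrib)
      finally show ?thesis using y by (simp add: lin)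
    qed
    have "test_seminorm N (\<lambda>x. \<phi> x - \<eta> x) \<le> ?c * ((2 * ?d * real b * ?d + 1) / real n)"
      by (rule test_seminorm_le) (rule close)
    also have "\<dots> = K / real n" by (simp add: K_def)
    also have "\<dots> < \<epsilon>" using n n0 e by (simp add: field_simps)
    finally show ?thesis using \<open>\<eta> \<in> D\<close> by blast
  qed
  ultimately show ?thesis by (intro exI[of _ D]) auto
qed

subsection \<open>Uniform density\<close>

inductive_set trig :: "(real^'d \<Rightarrow> real) set" where
  const: "(\<lambda>x. c) \<in> trig"
| cos: "(\<lambda>x. cos (2 * pi * x $ i)) \<in> trig"
| sin: "(\<lambda>x. sin (2 * pi * x $ i)) \<in> trig"
| add: "f \<in> trig \<Longrightarrow> g \<in> trig \<Longrightarrow> (\<lambda>x. f x + g x) \<in> trig"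
| mult: "f \<in> trig \<Longrightarrow> g \<in> trig \<Longrightarrow> (\<lambda>x. f x * g x) \<in> trig"

lemma trig_differentiable: "f \<in> trig \<Longrightarrow> f differentiable (at x)"
proof (induction rule: trig.induct)
  case (cos i)
  have "((\<lambda>x. cos (2 * pi * x $ i)) has_derivative (\<lambda>h. - sin (2 * pi * x $ i) * (2 * pi * h $ i))) (at x)"
    by (auto intro!: derivative_eq_intros bounded_linear.has_derivative[OF bounded_linear_vec_nth])
  then show ?case by (auto simp: differentiable_def)
next
  case (sin i)
  have "((\<lambda>x. sin (2 * pi * x $ i)) has_derivative (\<lambda>h. cos (2 * pi * x $ i) * (2 * pi * h $ i))) (at x)"
    by (auto intro!: derivative_eq_intros bounded_linear.has_derivative[OF bounded_linear_vec_nth])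
  then show ?case by (auto simp: differentiable_def)
qed (auto intro!: derivative_intros)

lemma trig_partial: "f \<in> trig \<Longrightarrow> partial_deriv j f \<in> trig"
proof (induction rule: trig.induct)
  case (const c)
  then show ?case by (simp add: partial_deriv_const trig.const)
next
  case (cos i)
  have "partial_deriv j (\<lambda>x. cos (2 * pi * x $ i)) = (\<lambda>x. (if i = j then - 2 * pi else 0) * sin (2 * pi * x $ i))"
    by (rule ext, rule partial_deriv_eqI) (auto intro!: derivative_eq_intros simp: axis_def)
  then show ?case by (simp only: trig.mult trig.const trig.sin)
next
  case (sin i)
  have "partial_deriv j (\<lambda>x. sin (2 * pi * x $ i)) = (\<lambda>x. (if i = j then 2 * pi else 0) * cos (2 * pi * x $ i))"
    by (rule ext, rule partial_deriv_eqI) (auto intro!: derivative_eq_intros simp: axis_def)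
  then show ?case by (simp only: trig.mult trig.const trig.cos)
next
  case (add f g)
  have "partial_deriv j (\<lambda>x. f x + g x) = (\<lambda>x. partial_deriv j f x + partial_deriv j g x)"
    using partial_deriv_lin[OF trig_differentiable[OF add(1)] trig_differentiable[OF add(2)], of j 1] by auto
  then show ?case using add by (simp add: trig.add)
next
  case (mult f g)
  have "partial_deriv j (\<lambda>x. f x * g x) = (\<lambda>x. partial_deriv j f x * g x + f x * partial_deriv j g x)"
  proof (rule ext, rule partial_deriv_eqI)
    fix x
    show "((\<lambda>t. f (x + t *\<^sub>R axis j 1) * g (x + t *\<^sub>R axis j 1)) has_real_derivative partial_deriv j f x * g x + f x * partial_deriv j g x) (at 0)"
      using line_derivative[of f x 0 j] line_derivative[of g x 0 j] trig_differentiable mult(1,2)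
      by (auto intro!: derivative_eq_intros)
  qed
  then show ?case using mult by (simp add: trig.add trig.mult)
qed

lemma trig_periodic: "f \<in> trig \<Longrightarrow> periodic f"
proof (induction rule: trig.induct)
  case (cos i)
  have "cos (2 * pi * (x $ i + axis j 1 $ i)) = cos (2 * pi * x $ i)" for x :: "real^'a" and j
    by (simp add: axis_def distrib_left)
  then show ?case by (simp add: periodic_def)
next
  case (sin i)
  have "sin (2 * pi * (x $ i + axis j 1 $ i)) = sin (2 * pi * x $ i)" for x :: "real^'a" and j
    by (simp add: axis_def distrib_left)
  then show ?case by (simp add: periodic_def)
qed (auto simp: periodic_def)

lemma trig_test: "trig \<subseteq> test_functions"
  by (intro test_closed_class trig_periodic trig_differentiable trig_partial)

text \<open>Stone-Weierstrass on the image of the torus under \<open>x \<mapsto> (e\<^sup>2\<^sup>\<pi>\<^sup>i\<^sup>x)\<close>: polynomials pull back to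
  trigonometric polynomials, and a periodic function factors through this quotient map.\<close>

lemma test_uniformly_dense:
  fixes f :: "real^'d \<Rightarrow> real"
  assumes f: "continuous_on UNIV f" "periodic f" and e: "\<epsilon> > 0"
  shows "\<exists>\<phi>\<in>test_functions. \<forall>x. \<bar>f x - \<phi> x\<bar> < \<epsilon>"
proof -
  define E :: "real^'d \<Rightarrow> complex^'d" where "E x = (\<chi> a. cis (2 * pi * x $ a))" for x
  let ?S = "E ` cbox 0 1"
  have Ec: "continuous_on A E" for A
    unfolding E_def by (intro continuous_intros)
  have cS: "compact ?S" by (intro compact_continuous_image Ec compact_cbox)
  have fE: "f x = f y" if "E x = E y" for x y
  proof -
    have "\<exists>n::int. x $ a = y $ a + of_int n" for a
    proof -
      have c: "cis (2 * pi * x $ a) = cis (2 * pi * y $ a)" using that by (simp add: E_def vec_eq_iff)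
      then have "cos (2 * pi * x $ a) = cos (2 * pi * y $ a) \<and> sin (2 * pi * x $ a) = sin (2 * pi * y $ a)"
        by (simp add: complex_eq_iff)
      then obtain n :: int where "2 * pi * x $ a = 2 * pi * y $ a + 2 * pi * of_int n"
        using sin_cos_eq_iff by metis
      then have "2 * pi * x $ a = 2 * pi * (y $ a + of_int n)" by (simp add: distrib_left)
      then show ?thesis by auto
    qed
    then obtain n where "\<And>a. x $ a = y $ a + of_int (n a)" by metis
    then have "x = y + int_vec (\<chi> a. n a)" by (simp add: vec_eq_iff)
    then show ?thesis using periodic_int_vec[OF f(2)] by simp
  qed
  \<comment> \<open>By \<open>fE\<close> the value does not depend on which preimage is
    selected.\<close>
  define F where "F z = f (SOME x. x \<in> cbox 0 1 \<and> E x = z)" for z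
  have FE: "F (E x) = f x" if "x \<in> cbox 0 1" for x
  proof -
    have "\<exists>y. y \<in> cbox 0 1 \<and> E y = E x" using that by blast
    from someI_ex[OF this] show ?thesis unfolding F_def by (intro fE) simp
  qed
  \<comment> \<open>The preimage of a closed set under F is the image under E of a compact set,
    hence closed.\<close>
  have "continuous_on ?S F"
  proof (subst continuous_on_closed_vimage[OF compact_imp_closed[OF cS]], safe)
    fix B :: "real set" assume "closed B"
    then have "closed (f -` B)" by (rule closed_vimage) (rule f(1))
    then have "compact (cbox 0 1 \<inter> f -` B)" by (intro compact_Int_closed) auto
    then have "compact (E ` (cbox 0 1 \<inter> f -` B))" by (intro compact_continuous_image Ec)
    moreover have "E ` (cbox 0 1 \<inter> f -` B) = F -` B \<inter> ?S" by (auto simp: FE)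
    ultimately show "closed (F -` B \<inter> ?S)" by (simp add: compact_imp_closed)
  qed
  from Stone_Weierstrass_real_polynomial_function[OF cS this e]
  obtain g where g: "real_polynomial_function g" "\<And>z. z \<in> ?S \<Longrightarrow> \<bar>F z - g z\<bar> < \<epsilon>" by blast
  have trig_sum: "(\<lambda>x. \<Sum>a\<in>A. h a x) \<in> trig" if "\<And>a. a \<in> A \<Longrightarrow> h a \<in> trig" for A :: "'d set" and h :: "'d \<Rightarrow> real^'d \<Rightarrow> real"
    using finite[of A] that by (induction A rule: finite_induct) (auto intro: trig.const trig.add)
  from g(1) have "(\<lambda>x. g (E x)) \<in> trig"
  proof (induction g rule: real_polynomial_function.induct)
    case (linear g)
    interpret bounded_linear g by fact
    \<comment> \<open>A real linear form on complex vectors is determined by its values on the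
      vectors \<open>axis a 1\<close> and \<open>axis a \<i>\<close>.\<close>
    have "g (E x) = (\<Sum>a\<in>UNIV. g (axis a 1) * cos (2 * pi * x $ a) + g (axis a \<i>) * sin (2 * pi * x $ a))" for x
    proof -
      have "E x = (\<Sum>a\<in>UNIV. cos (2 * pi * x $ a) *\<^sub>R axis a 1 + sin (2 * pi * x $ a) *\<^sub>R axis a \<i>)"
        by (simp add: vec_eq_iff E_def axis_def if_distrib sum.distrib complex_eq_iff cong: if_cong)
      then show ?thesis by (simp add: sum add scale mult.commute)
    qed
    then show ?case by (simp only:) (intro trig_sum trig.add trig.mult trig.const trig.cos trig.sin)
  qed (auto intro: trig.intros)
  then have t: "(\<lambda>x. g (E x)) \<in> test_functions" using trig_test by blast
  have "\<bar>f x - g (E x)\<bar> < \<epsilon>" for x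
  proof (rule periodic_representative[of x])
    fix y :: "real^'d" assume y: "y \<in> cbox 0 1" "\<And>f. periodic f \<Longrightarrow> f x = f y"
    have "\<bar>f y - g (E y)\<bar> < \<epsilon>" using g(2)[of "E y"] FE y(1) by force
    then show ?thesis using y(2)[OF f(2)] y(2)[OF test_periodic[OF t]] by simp
  qed
  then show ?thesis by (intro bexI[OF _ t]) simp
qed

section \<open>Stable random variables\<close>

text \<open>Reduces moments to values of the characteristic function. If 2^k \<le> \<bar>x\<bar> <
  2^(k+1), then x/2^k has modulus between 1 and 2, where 1 - cos is at least 1 - cos 1; so the term
  of index k alone dominates, with C paying for 1 - cos 1 and for the factor 2^r between the dyadic
  bounds. The summand 1 covers \<bar>x\<bar> \<le> 1.\<close>

lemma abs_powr_le_cos_series: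
  fixes x r :: real
  assumes "0 < r"
  defines "C \<equiv> 2 powr r / (1 - cos 1)"
  shows "ennreal (\<bar>x\<bar> powr r) \<le> 1 + (\<Sum>k. ennreal (C * 2 powr (real k * r) * (1 - cos (x / 2 ^ k))))"
proof (cases "\<bar>x\<bar> \<le> 1")
  case True
  then have "\<bar>x\<bar> powr r \<le> 1" using assms by (intro powr_le1) auto
  then have "ennreal (\<bar>x\<bar> powr r) \<le> 1" by (simp add: ennreal_le_1)
  then show ?thesis by (rule order_trans) simp
next
  case False
  have c1: "cos 1 < (1 :: real)" using cos_monotone_0_pi[of 0 1] pi_gt3 by simp
  then have C: "0 < C" by (simp add: C_def)
  obtain k :: nat where k: "2 ^ k \<le> \<bar>x\<bar>" "\<bar>x\<bar> < 2 ^ Suc k"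
  proof -
    have "\<exists>n. \<bar>x\<bar> < 2 ^ n" using real_arch_pow[of 2 "\<bar>x\<bar>"] by simp
    define n where "n = (LEAST n. \<bar>x\<bar> < 2 ^ n)"
    have n: "\<bar>x\<bar> < 2 ^ n" unfolding n_def using \<open>\<exists>n. \<bar>x\<bar> < 2 ^ n\<close> by (rule LeastI_ex)
    have "n \<noteq> 0" using n False by (intro notI) simp
    then obtain k where "n = Suc k" by (cases n) auto
    moreover have "\<not> \<bar>x\<bar> < 2 ^ k" using not_less_Least[of k "\<lambda>n. \<bar>x\<bar> < 2 ^ n"] \<open>n = Suc k\<close> by (simp add: n_def)
    ultimately show ?thesis using that[of k] n by auto
  qed
  have y: "1 \<le> \<bar>x\<bar> / 2 ^ k" "\<bar>x\<bar> / 2 ^ k \<le> 2" using k by (simp_all add: field_simps)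
  have "cos (x / 2 ^ k) = cos (\<bar>x\<bar> / 2 ^ k)" by (cases "x \<ge> 0") (simp_all add: minus_divide_left[symmetric])
  also have "\<dots> \<le> cos 1" using y pi_gt3 by (intro cos_monotone_0_pi_le) auto
  finally have "1 - cos 1 \<le> 1 - cos (x / 2 ^ k)" by simp
  have "\<bar>x\<bar> powr r \<le> (2 ^ Suc k) powr r" using k assms by (intro powr_mono2) auto
  also have "\<dots> = 2 powr (real (Suc k) * r)" by (simp add: powr_powr[symmetric] powr_realpow[symmetric] powr_add powr_mult)
  also have "\<dots> = C * 2 powr (real k * r) * (1 - cos 1)"
    using c1 by (simp add: C_def distrib_right powr_add)
  also have "\<dots> \<le> C * 2 powr (real k * r) * (1 - cos (x / 2 ^ k))"
    using C \<open>1 - cos 1 \<le> _\<close> by (intro mult_left_mono) auto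
  finally have "ennreal (\<bar>x\<bar> powr r) \<le> ennreal (C * 2 powr (real k * r) * (1 - cos (x / 2 ^ k)))"
    by (rule ennreal_leI)
  also have "\<dots> \<le> (\<Sum>k. ennreal (C * 2 powr (real k * r) * (1 - cos (x / 2 ^ k))))"
    using sum_le_suminf[of "\<lambda>k. ennreal (C * 2 powr (real k * r) * (1 - cos (x / 2 ^ k)))" "{k}"] by simp
  finally show ?thesis by (simp add: add_increasing)
qed

text \<open>For c > 0 the law is symmetric stable with scale c^(1/\<alpha>); c = 0 is the degenerate
  law at 0, which occurs for test functions of norm 0.\<close>

definition has_stable_char where
  "has_stable_char P X c \<alpha> \<longleftrightarrow> prob_space P \<and> X \<in> borel_measurable P \<and>
     (\<forall>t::real. (\<integral>\<omega>. exp (\<i> * complex_of_real (t * X \<omega>)) \<partial>P) = complex_of_real (exp (- c * \<bar>t\<bar> powr \<alpha>)))"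

text \<open>The expectation of 1 - cos(X/2^k) is 1 - exp(-c 2^(-k\<alpha>)) \<le> 2^(-k\<alpha>), so
  the series of \<open>abs_powr_le_cos_series\<close> becomes geometric with ratio 2^(r-\<alpha>) <
  1. The bound is uniform over c in [0,1], and general scales follow by homogeneity.\<close>

lemma stable_moment_below:
  assumes "0 < r" "r < \<alpha>"
  shows "\<exists>K\<ge>0. \<forall>P X c. has_stable_char P X c \<alpha> \<longrightarrow> 0 \<le> c \<longrightarrow> c \<le> 1 \<longrightarrow>
    (\<integral>\<^sup>+\<omega>. ennreal (\<bar>X \<omega>\<bar> powr r) \<partial>P) \<le> ennreal K"
proof -
  define C where "C = 2 powr r / (1 - cos (1::real))"
  have "cos 1 < (1 :: real)" using cos_monotone_0_pi[of 0 1] pi_gt3 by simp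
  then have C: "0 < C" by (simp add: C_def)
  define q where "q = 2 powr (r - \<alpha>)"
  have q: "0 < q" "q < 1" using assms by (auto simp: q_def powr_less_one)
  show ?thesis
  proof (intro exI[of _ "1 + C * (1 / (1 - q))"] conjI allI impI)
    show "0 \<le> 1 + C * (1 / (1 - q))" using C q by simp
    fix P X c assume X: "has_stable_char P X c \<alpha>" and c: "0 \<le> c" "c \<le> 1"
    interpret prob_space P using X by (simp add: has_stable_char_def)
    have [measurable]: "X \<in> borel_measurable P" using X by (simp add: has_stable_char_def)
    have cosint: "(\<integral>\<omega>. cos (t * X \<omega>) \<partial>P) = exp (- c * \<bar>t\<bar> powr \<alpha>)" for t
    proof -
      have "integrable P (\<lambda>\<omega>. exp (\<i> * complex_of_real (t * X \<omega>)))"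
        by (rule integrable_const_bound[of _ 1]) auto
      then have "(\<integral>\<omega>. Re (exp (\<i> * complex_of_real (t * X \<omega>))) \<partial>P) = Re (\<integral>\<omega>. exp (\<i> * complex_of_real (t * X \<omega>)) \<partial>P)"
        by (rule integral_Re)
      also have "\<dots> = exp (- c * \<bar>t\<bar> powr \<alpha>)" using X by (simp add: has_stable_char_def)
      finally show ?thesis by (simp add: Re_exp)
    qed
    have trm: "(\<integral>\<^sup>+\<omega>. ennreal (C * 2 powr (real k * r) * (1 - cos (X \<omega> / 2 ^ k))) \<partial>P) \<le> ennreal (C * q ^ k)" for k
    proof -
      have i: "integrable P (\<lambda>\<omega>. cos (X \<omega> / 2 ^ k))"
        by (rule integrable_const_bound[of _ 1]) auto
      have "(\<integral>\<^sup>+\<omega>. ennreal (C * 2 powr (real k * r) * (1 - cos (X \<omega> / 2 ^ k))) \<partial>P) =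
        ennreal (\<integral>\<omega>. C * 2 powr (real k * r) * (1 - cos (X \<omega> / 2 ^ k)) \<partial>P)"
        using i C by (intro nn_integral_eq_integral) auto
      also have "(\<integral>\<omega>. C * 2 powr (real k * r) * (1 - cos (X \<omega> / 2 ^ k)) \<partial>P) =
         C * 2 powr (real k * r) * (1 - exp (- c * \<bar>1 / 2 ^ k\<bar> powr \<alpha>))"
        using i cosint[of "1 / 2 ^ k"] by (simp add: prob_space)
      also have "\<dots> \<le> C * 2 powr (real k * r) * \<bar>1 / 2 ^ k\<bar> powr \<alpha>"
      proof (intro mult_left_mono)
        let ?y = "\<bar>1 / 2 ^ k :: real\<bar> powr \<alpha>"
        have "1 + (- c * ?y) \<le> exp (- c * ?y)" by (rule exp_ge_add_one_self)
        moreover have "c * ?y \<le> 1 * ?y" using c by (intro mult_right_mono) auto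
        ultimately show "1 - exp (- c * ?y) \<le> ?y" unfolding mult_1 mult_minus_left by linarith
      qed (use C in auto)
      also have "\<dots> = C * q ^ k"
      proof -
        have "\<bar>1 / 2 ^ k :: real\<bar> powr \<alpha> = 2 powr (- real k * \<alpha>)"
        proof -
          have "\<bar>1 / 2 ^ k :: real\<bar> = 2 powr (- real k)"
            by (simp add: powr_minus powr_realpow divide_inverse)
          then show ?thesis by (simp only: powr_powr)
        qed
        moreover have "q ^ k = 2 powr (real k * (r - \<alpha>))"
          unfolding q_def by (simp add: powr_realpow[symmetric] powr_powr mult.commute)
        ultimately show ?thesis by (simp add: right_diff_distrib powr_add[symmetric])
      qed
      finally show ?thesis by (simp add: ennreal_leI)
    qed
    have "(\<integral>\<^sup>+\<omega>. ennreal (\<bar>X \<omega>\<bar> powr r) \<partial>P) \<le> (\<integral>\<^sup>+\<omega>. 1 + (\<Sum>k. ennreal (C * 2 powr (real k * r) * (1 - cos (X \<omega> / 2 ^ k)))) \<partial>P)"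
      unfolding C_def by (intro nn_integral_mono abs_powr_le_cos_series assms)
    also have "\<dots> = 1 + (\<Sum>k. \<integral>\<^sup>+\<omega>. ennreal (C * 2 powr (real k * r) * (1 - cos (X \<omega> / 2 ^ k))) \<partial>P)"
      by (subst nn_integral_add) (auto simp: nn_integral_suminf emeasure_space_1)
    also have "\<dots> \<le> 1 + (\<Sum>k. ennreal (C * q ^ k))"
      by (intro add_left_mono suminf_le trm) auto
    also have "(\<Sum>k. ennreal (C * q ^ k)) = ennreal (\<Sum>k. C * q ^ k)"
      by (rule suminf_ennreal2) (use C q in \<open>auto intro!: summable_mult summable_geometric\<close>)
    also have "(\<Sum>k. C * q ^ k) = C * (1 / (1 - q))"
      using q by (simp add: suminf_mult summable_geometric suminf_geometric)
    also have "1 + ennreal (C * (1 / (1 - q))) = ennreal (1 + C * (1 / (1 - q)))"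
      using C q by (subst ennreal_plus) auto
    finally show "(\<integral>\<^sup>+\<omega>. ennreal (\<bar>X \<omega>\<bar> powr r) \<partial>P) \<le> ennreal (1 + C * (1 / (1 - q)))" .
  qed
qed

text \<open>The cosine series stops at r < 2, so here the law itself is identified: by uniqueness of
  characteristic functions X is a multiple of a standard normal variable, all of whose even moments
  are finite.\<close>

lemma gaussian_moment:
  assumes "0 < r"
  shows "\<exists>K\<ge>0. \<forall>P X c. has_stable_char P X c 2 \<longrightarrow> 0 \<le> c \<longrightarrow> c \<le> 1 \<longrightarrow>
    (\<integral>\<^sup>+\<omega>. ennreal (\<bar>X \<omega>\<bar> powr r) \<partial>P) \<le> ennreal K"
proof -
  define k where "k = nat \<lceil>r\<rceil>"
  have k: "r \<le> real (2 * k)" "k > 0" using assms by (auto simp: k_def) linarith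
  define M where "M = (LINT x|std_normal_distribution. \<bar>x\<bar> ^ (2 * k))"
  have M: "0 \<le> M" unfolding M_def by simp
  have pw: "\<bar>x\<bar> powr r \<le> 1 + \<bar>x\<bar> ^ (2 * k)" for x :: real
  proof (cases "\<bar>x\<bar> \<le> 1")
    case True
    then have "\<bar>x\<bar> powr r \<le> 1" using assms by (intro powr_le1) auto
    then show ?thesis by (simp add: add_increasing2)
  next
    case False
    then have "\<bar>x\<bar> powr r \<le> \<bar>x\<bar> powr real (2 * k)" using k by (intro powr_mono) auto
    also have "\<dots> = \<bar>x\<bar> ^ (2 * k)" using False by (subst powr_realpow) auto
    finally show ?thesis by simp
  qed
  show ?thesis
  proof (intro exI[of _ "1 + 2 ^ k * M"] conjI allI impI)
    show "0 \<le> 1 + 2 ^ k * M" using M by simp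
    fix P X c assume X: "has_stable_char P X c 2" and c: "0 \<le> c" "c \<le> 1"
    interpret prob_space P using X by (simp add: has_stable_char_def)
    have [measurable]: "X \<in> borel_measurable P" using X by (simp add: has_stable_char_def)
    have ch: "(\<integral>\<omega>. exp (\<i> * complex_of_real (t * X \<omega>)) \<partial>P) = complex_of_real (exp (- c * t\<^sup>2))" for t
    proof -
      have "\<bar>t\<bar> powr 2 = t\<^sup>2" by (simp add: powr_numeral)
      then show ?thesis using X unfolding has_stable_char_def by metis
    qed
    have rd: "real_distribution (distr P borel Y)" if [measurable]: "Y \<in> borel_measurable P" for Y
      by (rule real_distribution_distr) simp
    show "(\<integral>\<^sup>+\<omega>. ennreal (\<bar>X \<omega>\<bar> powr r) \<partial>P) \<le> ennreal (1 + 2 ^ k * M)"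
    \<comment> \<open>The degenerate law cannot be normalized and is identified with the point mass
      at 0.\<close>
    proof (cases "c = 0")
      case True
      have "char (distr P borel X) = char (return borel 0)"
        using ch True by (auto simp: fun_eq_iff char_def integral_distr integral_return)
      moreover have "real_distribution (return borel (0::real))"
        by (simp add: real_distribution_def real_distribution_axioms_def prob_space_return)
      ultimately have d: "distr P borel X = return borel 0"
        by (intro Levy_uniqueness rd) auto
      have "(\<integral>\<^sup>+\<omega>. ennreal (\<bar>X \<omega>\<bar> powr r) \<partial>P) = (\<integral>\<^sup>+x. ennreal (\<bar>x\<bar> powr r) \<partial>distr P borel X)"
        by (subst nn_integral_distr) auto
      also have "\<dots> = 0" unfolding d by (subst nn_integral_return) auto
      finally show ?thesis by simp
    next
      case False
      \<comment> \<open>The function exp(-c t^2) belongs to the centred normal law of variance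
        2c.\<close>
      define Y where "Y \<omega> = X \<omega> / sqrt (2 * c)" for \<omega>
      have [measurable]: "Y \<in> borel_measurable P" by (simp add: Y_def[abs_def])
      have "char (distr P borel Y) = char std_normal_distribution"
      proof (rule ext)
        fix t :: real
        have "char (distr P borel Y) t = (\<integral>\<omega>. exp (\<i> * complex_of_real (t / sqrt (2 * c) * X \<omega>)) \<partial>P)"
          unfolding char_def by (subst integral_distr) (auto simp: Y_def)
        also have "\<dots> = complex_of_real (exp (- (t^2) / 2))"
          unfolding ch using c False by (simp add: power_divide)
        finally show "char (distr P borel Y) t = char std_normal_distribution t"
          by (simp add: char_std_normal_distribution)
      qed
      then have d: "distr P borel Y = std_normal_distribution"
        by (intro Levy_uniqueness rd real_dist_normal_dist) auto
      have "(\<integral>\<^sup>+\<omega>. ennreal (\<bar>Y \<omega>\<bar> ^ (2 * k)) \<partial>P) = (\<integral>\<^sup>+x. ennreal (\<bar>x\<bar> ^ (2 * k)) \<partial>distr P borel Y)"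
        by (subst nn_integral_distr) auto
      also have "\<dots> = ennreal M"
        unfolding d M_def
      proof (rule nn_integral_eq_integral)
        show "integrable std_normal_distribution (\<lambda>x. \<bar>x\<bar> ^ (2 * k))"
          using integrable_std_normal_distribution_moment[of "2 * k"] by (simp add: power_even_abs)
      qed simp
      finally have Ym: "(\<integral>\<^sup>+\<omega>. ennreal (\<bar>Y \<omega>\<bar> ^ (2 * k)) \<partial>P) = ennreal M" .
      have Xk: "\<bar>X \<omega>\<bar> ^ (2 * k) \<le> 2 ^ k * \<bar>Y \<omega>\<bar> ^ (2 * k)" for \<omega>
      proof -
        have "\<bar>X \<omega>\<bar> = sqrt (2 * c) * \<bar>Y \<omega>\<bar>" using c False by (simp add: Y_def abs_mult)
        then have "\<bar>X \<omega>\<bar> ^ (2 * k) = (2 * c) ^ k * \<bar>Y \<omega>\<bar> ^ (2 * k)"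
          using c by (simp add: power_mult_distrib power_mult)
        also have "\<dots> \<le> 2 ^ k * \<bar>Y \<omega>\<bar> ^ (2 * k)"
          using c by (intro mult_right_mono power_mono) auto
        finally show ?thesis .
      qed
      have "(\<integral>\<^sup>+\<omega>. ennreal (\<bar>X \<omega>\<bar> powr r) \<partial>P) \<le> (\<integral>\<^sup>+\<omega>. 1 + ennreal (2 ^ k) * ennreal (\<bar>Y \<omega>\<bar> ^ (2 * k)) \<partial>P)"
      proof (intro nn_integral_mono)
        fix \<omega>
        have "\<bar>X \<omega>\<bar> powr r \<le> 1 + 2 ^ k * \<bar>Y \<omega>\<bar> ^ (2 * k)" using pw[of "X \<omega>"] Xk[of \<omega>] by linarith
        then have "ennreal (\<bar>X \<omega>\<bar> powr r) \<le> ennreal (1 + 2 ^ k * \<bar>Y \<omega>\<bar> ^ (2 * k))" by (rule ennreal_leI)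
        then show "ennreal (\<bar>X \<omega>\<bar> powr r) \<le> 1 + ennreal (2 ^ k) * ennreal (\<bar>Y \<omega>\<bar> ^ (2 * k))"
          by (simp add: ennreal_plus ennreal_mult)
      qed
      also have "\<dots> = 1 + ennreal (2 ^ k) * ennreal M"
        by (subst nn_integral_add) (auto simp: nn_integral_cmult Ym emeasure_space_1)
      also have "\<dots> = ennreal (1 + 2 ^ k * M)"
        using M by (simp add: ennreal_plus ennreal_mult)
      finally show ?thesis .
    qed
  qed
qed

text \<open>Takes the place of Borel-Cantelli: the sum of the f n has finite expectation, hence is
  finite almost surely and bounds each term. Applied to quantities carrying an exponential weight,
  it yields exponential decay or a growth bound.\<close>

lemma AE_bounded_if_sum_finite:
  fixes f :: "nat \<Rightarrow> 'a \<Rightarrow> real"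
  assumes [measurable]: "\<And>n. f n \<in> borel_measurable M"
    and fin: "\<And>n. (\<integral>\<^sup>+\<omega>. ennreal (f n \<omega>) \<partial>M) \<le> ennreal (b n)" and b: "summable b" "\<And>n. 0 \<le> b n"
  shows "AE \<omega> in M. \<exists>C\<ge>0. \<forall>n. f n \<omega> \<le> C"
proof -
  have "(\<integral>\<^sup>+\<omega>. (\<Sum>n. ennreal (f n \<omega>)) \<partial>M) = (\<Sum>n. \<integral>\<^sup>+\<omega>. ennreal (f n \<omega>) \<partial>M)"
    by (rule nn_integral_suminf) simp
  also have "\<dots> \<le> (\<Sum>n. ennreal (b n))" by (intro suminf_le fin) auto
  also have "\<dots> = ennreal (\<Sum>n. b n)" using b by (intro suminf_ennreal2) auto
  also have "\<dots> < \<infinity>" by simp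
  finally have "AE \<omega> in M. (\<Sum>n. ennreal (f n \<omega>)) \<noteq> \<infinity>"
    by (intro nn_integral_PInf_AE) auto
  then show ?thesis
  proof eventually_elim
    case (elim \<omega>)
    show ?case
    proof (intro exI[of _ "enn2real (\<Sum>n. ennreal (f n \<omega>))"] conjI allI)
      fix n
      have "ennreal (f n \<omega>) \<le> (\<Sum>n. ennreal (f n \<omega>))"
        using sum_le_suminf[of "\<lambda>n. ennreal (f n \<omega>)" "{n}"] by simp
      also have "\<dots> = ennreal (enn2real (\<Sum>n. ennreal (f n \<omega>)))" using elim by (simp add: top.not_eq_extremum)
      finally show "f n \<omega> \<le> enn2real (\<Sum>n. ennreal (f n \<omega>))"
        by (simp only: ennreal_le_iff[OF enn2real_nonneg])
    qed simp
  qed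
qed

section \<open>Moments of the noise\<close>
lemma torus_integrable_bounded:
  fixes f :: "real^'d \<Rightarrow> real"
  assumes "f \<in> borel_measurable borel" "\<And>x. \<bar>f x\<bar> \<le> B"
  shows "integrable torus_measure f"
proof -
  interpret prob_space "torus_measure :: (real^'d) measure" by (rule prob_space_torus)
  show ?thesis by (rule integrable_const_bound[of _ B]) (use assms torus_measurable in auto)
qed

lemma torus_integral_le:
  fixes f :: "real^'d \<Rightarrow> real"
  assumes "f \<in> borel_measurable borel" "\<And>x. 0 \<le> f x" "\<And>x. f x \<le> B"
  shows "(\<integral>x. f x \<partial>torus_measure) \<le> B"
proof -
  interpret prob_space "torus_measure :: (real^'d) measure" by (rule prob_space_torus)
  have "\<bar>f x\<bar> \<le> B" for x using assms(2,3)[of x] by simp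
  then have "(\<integral>x. f x \<partial>torus_measure) \<le> (\<integral>x. B \<partial>(torus_measure :: (real^'d) measure))"
    by (intro integral_mono torus_integrable_bounded[OF assms(1)] assms(3)) auto
  then show ?thesis by (simp add: prob_space)
qed

locale noise =
  fixes \<alpha> \<gamma> :: real and P :: "'a measure" and w :: "'a \<Rightarrow> (real^'d \<Rightarrow> real) \<Rightarrow> real"
  assumes noise: "sas_white_noise \<alpha> \<gamma> P w"
begin

lemma \<alpha>: "0 < \<alpha>" "\<alpha> \<le> 2" and \<gamma>: "0 < \<gamma>"
  using noise by (auto simp: sas_white_noise_def)

sublocale prob_space P
  using noise by (simp add: sas_white_noise_def generalized_periodic_process_def)

lemma w_measurable: "w \<in> measurable P cylindrical_algebra"
  using noise by (simp add: sas_white_noise_def generalized_periodic_process_def)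

lemma space_cylindrical: "space (cylindrical_algebra :: ((real^'d \<Rightarrow> real) \<Rightarrow> real) measure) = periodic_distributions"
  unfolding cylindrical_algebra_def by (rule space_measure_of) auto

lemma w_dist: "\<omega> \<in> space P \<Longrightarrow> w \<omega> \<in> periodic_distributions"
  using measurable_space[OF w_measurable] by (simp add: space_cylindrical)

lemma w_lin:
  assumes "\<omega> \<in> space P" "\<phi> \<in> test_functions" "\<eta> \<in> test_functions"
  shows "w \<omega> (\<lambda>x. \<phi> x + c * \<eta> x) = w \<omega> \<phi> + c * w \<omega> \<eta>"
proof -
  have "\<forall>\<phi>\<in>test_functions. \<forall>\<eta>\<in>test_functions. w \<omega> (\<lambda>x. \<phi> x + \<eta> x) = w \<omega> \<phi> + w \<omega> \<eta>"
    using w_dist[OF assms(1)] by (simp add: periodic_distributions_def)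
  from this[rule_format, OF assms(2) test_scale[OF assms(3), of c]]
  have "w \<omega> (\<lambda>x. \<phi> x + c * \<eta> x) = w \<omega> \<phi> + w \<omega> (\<lambda>x. c * \<eta> x)" .
  also have "w \<omega> (\<lambda>x. c * \<eta> x) = c * w \<omega> \<eta>"
    using w_dist[OF assms(1)] assms(3) unfolding periodic_distributions_def by blast
  finally show ?thesis by simp
qed

lemma w_scale:
  assumes "\<omega> \<in> space P" "\<eta> \<in> test_functions"
  shows "w \<omega> (\<lambda>x. c * \<eta> x) = c * w \<omega> \<eta>"
  using w_dist[OF assms(1)] assms(2) unfolding periodic_distributions_def by blast

lemma w_diff:
  assumes "\<omega> \<in> space P" "\<phi> \<in> test_functions" "\<eta> \<in> test_functions"
  shows "w \<omega> (\<lambda>x. \<phi> x - \<eta> x) = w \<omega> \<phi> - w \<omega> \<eta>"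
  using w_lin[OF assms, of "-1"] by simp

lemma w_sum:
  assumes "\<omega> \<in> space P" "\<And>i. i \<in> I \<Longrightarrow> \<phi> i \<in> test_functions"
  shows "w \<omega> (\<lambda>x. \<Sum>i\<in>I. c i * \<phi> i x) = (\<Sum>i\<in>I. c i * w \<omega> (\<phi> i))"
  using assms(2)
proof (induction I rule: infinite_finite_induct)
  case (insert i I)
  then show ?case
    using w_lin[OF assms(1), of "\<lambda>x. \<Sum>i\<in>I. c i * \<phi> i x" "\<phi> i" "c i"] test_sum[of I \<phi> c]
    by (simp add: add.commute)
qed (use w_scale[OF assms(1) test_zero, of 0] in auto)

lemma w_meas [measurable]:
  assumes "\<phi> \<in> test_functions"
  shows "(\<lambda>\<omega>. w \<omega> \<phi>) \<in> borel_measurable P"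
proof -
  have "(\<lambda>u. u \<phi>) \<in> borel_measurable cylindrical_algebra"
  proof (rule measurableI)
    fix A :: "real set" assume A: "A \<in> sets borel"
    let ?B = "{f \<in> space (\<Pi>\<^sub>M i\<in>{..<1::nat}. (borel :: real measure)). f 0 \<in> A}"
    have B: "?B \<in> sets (\<Pi>\<^sub>M i\<in>{..<1::nat}. borel)" using A by measurable
    have "(\<lambda>u. u \<phi>) -` A \<inter> periodic_distributions = {u \<in> periodic_distributions. (\<lambda>i\<in>{..<1::nat}. u ((\<lambda>_. \<phi>) i)) \<in> ?B}"
      by (auto simp: space_PiM PiE_def)
    moreover have "\<dots> \<in> sets cylindrical_algebra"
      unfolding cylindrical_algebra_def
    proof (subst sets_measure_of)
      show "{u \<in> periodic_distributions. (\<lambda>i\<in>{..<1::nat}. u ((\<lambda>_. \<phi>) i)) \<in> ?B} \<in> sigma_sets periodic_distributions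
        {{u \<in> periodic_distributions. (\<lambda>i\<in>{..<N}. u (\<phi> i)) \<in> B} | (N::nat) \<phi> B.
        (\<forall>i<N. \<phi> i \<in> test_functions) \<and> B \<in> sets (\<Pi>\<^sub>M i\<in>{..<N}. (borel :: real measure))}"
        by (intro sigma_sets.Basic CollectI exI[of _ "1::nat"] exI[of _ "\<lambda>_. \<phi>"] exI[of _ ?B] conjI refl allI impI B assms)
    qed auto
    ultimately show "(\<lambda>u. u \<phi>) -` A \<inter> space cylindrical_algebra \<in> sets cylindrical_algebra"
      by (simp only: space_cylindrical)
  qed simp
  then show ?thesis by (rule measurable_compose[OF w_measurable])
qed

lemma w_char:
  assumes "\<phi> \<in> test_functions"
  shows "(\<integral>\<omega>. exp (\<i> * complex_of_real (t * w \<omega> \<phi>)) \<partial>P) =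
    complex_of_real (exp (- (\<gamma> powr \<alpha>) * (\<bar>t\<bar> powr \<alpha> * (\<integral>x. \<bar>\<phi> x\<bar> powr \<alpha> \<partial>torus_measure))))"
proof -
  have "(\<integral>\<omega>. exp (\<i> * complex_of_real (t * w \<omega> \<phi>)) \<partial>P) = characteristic_functional P w (\<lambda>x. t * \<phi> x)"
    unfolding characteristic_functional_def
    by (intro Bochner_Integration.integral_cong refl) (simp add: w_scale assms)
  also have "\<dots> = complex_of_real (exp (- (\<gamma> powr \<alpha>) * (\<integral>x. \<bar>t * \<phi> x\<bar> powr \<alpha> \<partial>torus_measure)))"
    using noise test_scale[OF assms, of t] unfolding sas_white_noise_def by blast
  also have "(\<integral>x. \<bar>t * \<phi> x\<bar> powr \<alpha> \<partial>torus_measure) = \<bar>t\<bar> powr \<alpha> * (\<integral>x. \<bar>\<phi> x\<bar> powr \<alpha> \<partial>torus_measure)"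
    by (simp add: abs_mult powr_mult)
  finally show ?thesis .
qed

definition moment_const where
  "moment_const r = (SOME K. 0 \<le> K \<and> (\<forall>\<phi>\<in>test_functions. \<forall>\<sigma>>0.
    (\<integral>x. \<bar>\<phi> x\<bar> powr \<alpha> \<partial>torus_measure) \<le> \<sigma> powr \<alpha> \<longrightarrow>
    (\<integral>\<^sup>+\<omega>. ennreal (\<bar>w \<omega> \<phi>\<bar> powr r) \<partial>P) \<le> ennreal (K * \<sigma> powr r)))"

text \<open>Dividing \<open>w \<omega> \<phi>\<close> by \<gamma> \<sigma> brings the parameter c
  into [0,1], where the moment bounds are uniform. Letting \<sigma> be any positive upper bound of
  the norm avoids division by a norm that may be 0.\<close>

lemma moment_ex:
  assumes "0 < r" "r < \<alpha> \<or> \<alpha> = 2"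
  shows "\<exists>K. 0 \<le> K \<and> (\<forall>\<phi>\<in>test_functions. \<forall>\<sigma>>0.
    (\<integral>x. \<bar>\<phi> x\<bar> powr \<alpha> \<partial>torus_measure) \<le> \<sigma> powr \<alpha> \<longrightarrow>
    (\<integral>\<^sup>+\<omega>. ennreal (\<bar>w \<omega> \<phi>\<bar> powr r) \<partial>P) \<le> ennreal (K * \<sigma> powr r))"
proof -
  have "\<exists>K\<ge>0. \<forall>(P :: 'a measure) X c. has_stable_char P X c \<alpha> \<longrightarrow> 0 \<le> c \<longrightarrow> c \<le> 1 \<longrightarrow>
    (\<integral>\<^sup>+\<omega>. ennreal (\<bar>X \<omega>\<bar> powr r) \<partial>P) \<le> ennreal K"
    using stable_moment_below[of r \<alpha>] gaussian_moment[of r] assms by blast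
  then obtain K where K: "0 \<le> K" "\<And>X c. has_stable_char P X c \<alpha> \<Longrightarrow> 0 \<le> c \<Longrightarrow> c \<le> 1 \<Longrightarrow>
    (\<integral>\<^sup>+\<omega>. ennreal (\<bar>X \<omega>\<bar> powr r) \<partial>P) \<le> ennreal K" by blast
  show ?thesis
  proof (intro exI[of _ "K * \<gamma> powr r"] conjI ballI allI impI)
    show "0 \<le> K * \<gamma> powr r" using K by simp
    fix \<phi> :: "real^'d \<Rightarrow> real" and \<sigma> :: real
    assume \<phi>: "\<phi> \<in> test_functions" and \<sigma>: "\<sigma> > 0" and le: "(\<integral>x. \<bar>\<phi> x\<bar> powr \<alpha> \<partial>torus_measure) \<le> \<sigma> powr \<alpha>"
    let ?I = "\<integral>x. \<bar>\<phi> x\<bar> powr \<alpha> \<partial>torus_measure"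
    define X where "X \<omega> = 1 / (\<gamma> * \<sigma>) * w \<omega> \<phi>" for \<omega>
    have [measurable]: "X \<in> borel_measurable P" unfolding X_def[abs_def] using w_meas[OF \<phi>] by simp
    have "has_stable_char P X (?I / \<sigma> powr \<alpha>) \<alpha>"
      unfolding has_stable_char_def
    proof (intro conjI allI)
      fix t :: real
      have "(\<integral>\<omega>. exp (\<i> * complex_of_real (t * X \<omega>)) \<partial>P) = (\<integral>\<omega>. exp (\<i> * complex_of_real (t / (\<gamma> * \<sigma>) * w \<omega> \<phi>)) \<partial>P)"
        by (simp add: X_def)
      also have "\<dots> = complex_of_real (exp (- (\<gamma> powr \<alpha>) * (\<bar>t / (\<gamma> * \<sigma>)\<bar> powr \<alpha> * ?I)))"
        by (rule w_char[OF \<phi>])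
      also have "- (\<gamma> powr \<alpha>) * (\<bar>t / (\<gamma> * \<sigma>)\<bar> powr \<alpha> * ?I) = - (?I / \<sigma> powr \<alpha>) * \<bar>t\<bar> powr \<alpha>"
        using \<gamma> \<sigma> by (simp add: abs_mult powr_divide powr_mult)
      finally show "(\<integral>\<omega>. exp (\<i> * complex_of_real (t * X \<omega>)) \<partial>P) = complex_of_real (exp (- (?I / \<sigma> powr \<alpha>) * \<bar>t\<bar> powr \<alpha>))" .
    qed (auto intro: prob_space_axioms)
    then have EX: "(\<integral>\<^sup>+\<omega>. ennreal (\<bar>X \<omega>\<bar> powr r) \<partial>P) \<le> ennreal K"
      by (rule K(2)) (use le \<sigma> in auto)
    have "(\<integral>\<^sup>+\<omega>. ennreal (\<bar>w \<omega> \<phi>\<bar> powr r) \<partial>P) = (\<integral>\<^sup>+\<omega>. ennreal ((\<gamma> * \<sigma>) powr r) * ennreal (\<bar>X \<omega>\<bar> powr r) \<partial>P)"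
    proof (intro nn_integral_cong)
      fix \<omega>
      have "\<bar>w \<omega> \<phi>\<bar> = (\<gamma> * \<sigma>) * \<bar>X \<omega>\<bar>" using \<gamma> \<sigma> by (simp add: X_def abs_mult)
      then show "ennreal (\<bar>w \<omega> \<phi>\<bar> powr r) = ennreal ((\<gamma> * \<sigma>) powr r) * ennreal (\<bar>X \<omega>\<bar> powr r)"
        using \<gamma> \<sigma> by (simp add: powr_mult ennreal_mult')
    qed
    also have "\<dots> = ennreal ((\<gamma> * \<sigma>) powr r) * (\<integral>\<^sup>+\<omega>. ennreal (\<bar>X \<omega>\<bar> powr r) \<partial>P)"
      by (rule nn_integral_cmult) measurable
    also have "\<dots> \<le> ennreal ((\<gamma> * \<sigma>) powr r) * ennreal K" by (intro mult_left_mono EX) auto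
    also have "\<dots> = ennreal (K * \<gamma> powr r * \<sigma> powr r)"
      using K \<gamma> \<sigma> by (simp add: ennreal_mult'[symmetric] powr_mult ac_simps)
    finally show "(\<integral>\<^sup>+\<omega>. ennreal (\<bar>w \<omega> \<phi>\<bar> powr r) \<partial>P) \<le> ennreal (K * \<gamma> powr r * \<sigma> powr r)" .
  qed
qed

lemma moment:
  assumes "0 < r" "r < \<alpha> \<or> \<alpha> = 2"
  shows "0 \<le> moment_const r"
    and "\<phi> \<in> test_functions \<Longrightarrow> \<sigma> > 0 \<Longrightarrow> (\<integral>x. \<bar>\<phi> x\<bar> powr \<alpha> \<partial>torus_measure) \<le> \<sigma> powr \<alpha> \<Longrightarrow>
      (\<integral>\<^sup>+\<omega>. ennreal (\<bar>w \<omega> \<phi>\<bar> powr r) \<partial>P) \<le> ennreal (moment_const r * \<sigma> powr r)"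
  using someI_ex[OF moment_ex[OF assms], folded moment_const_def] by blast+

text \<open>Extends the moment bound to uniform limits of test functions. By dominated convergence
  the norms of \<open>h n\<close> tend to the norm of g, so the strict inequality for \<sigma> holds
  for almost all n with \<open>h n\<close> in place of g; Fatou then passes the bound to Y.\<close>

lemma limit_moment:
  assumes r: "0 < r" "r < \<alpha> \<or> \<alpha> = 2"
    and h: "\<And>n. h n \<in> test_functions" "g \<in> borel_measurable borel" "\<And>x. \<bar>g x\<bar> \<le> B" "\<And>n x. \<bar>h n x - g x\<bar> \<le> C / 2 ^ n"
    and Y: "AE \<omega> in P. (\<lambda>n. w \<omega> (h n)) \<longlonglongrightarrow> Y \<omega>"
    and \<sigma>: "\<sigma> > 0" "(\<integral>x. \<bar>g x\<bar> powr \<alpha> \<partial>torus_measure) < \<sigma> powr \<alpha>"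
  shows "(\<integral>\<^sup>+\<omega>. ennreal (\<bar>Y \<omega>\<bar> powr r) \<partial>P) \<le> ennreal (moment_const r * \<sigma> powr r)"
proof -
  interpret T: prob_space "torus_measure :: (real^'d) measure" by (rule prob_space_torus)
  note [measurable] = torus_measurable[OF h(2)]
  have [measurable]: "h n \<in> borel_measurable torus_measure" for n
    by (intro torus_measurable borel_measurable_continuous_onI test_continuous' h)
  have C: "0 \<le> C" using order_trans[OF abs_ge_zero h(4)[of 0 undefined]] by simp
  have lim: "(\<lambda>n. h n x) \<longlonglongrightarrow> g x" for x
  proof -
    have "(\<lambda>n. C / 2 ^ n) \<longlonglongrightarrow> 0" using LIMSEQ_divide_realpow_zero[of 2 C] by simp
    then have "(\<lambda>n. h n x - g x) \<longlonglongrightarrow> 0"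
      by (rule Lim_null_comparison[rotated]) (use h(4) in auto)
    then show ?thesis by (simp add: LIM_zero_iff)
  qed
  have "(\<lambda>n. \<integral>x. \<bar>h n x\<bar> powr \<alpha> \<partial>torus_measure) \<longlonglongrightarrow> (\<integral>x. \<bar>g x\<bar> powr \<alpha> \<partial>torus_measure)"
  proof (rule integral_dominated_convergence[where w="\<lambda>_. (B + C) powr \<alpha>"])
    show "AE x in torus_measure. (\<lambda>n. \<bar>h n x\<bar> powr \<alpha>) \<longlonglongrightarrow> \<bar>g x\<bar> powr \<alpha>"
      using \<alpha> by (auto intro!: tendsto_powr' tendsto_rabs lim)
    show "AE x in torus_measure. norm (\<bar>h n x\<bar> powr \<alpha>) \<le> (B + C) powr \<alpha>" for n
    proof (rule AE_I2)
      fix x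
      have "C / 2 ^ n \<le> C / 1" using C by (intro divide_left_mono) auto
      then have "\<bar>h n x\<bar> \<le> B + C" using h(3)[of x] h(4)[of n x] by linarith
      then show "norm (\<bar>h n x\<bar> powr \<alpha>) \<le> (B + C) powr \<alpha>" using \<alpha> by (auto intro!: powr_mono2)
    qed
  qed auto
  then have "eventually (\<lambda>n. (\<integral>x. \<bar>h n x\<bar> powr \<alpha> \<partial>torus_measure) < \<sigma> powr \<alpha>) sequentially"
    using \<sigma>(2) by (rule order_tendstoD)
  then have ev: "eventually (\<lambda>n. (\<integral>\<^sup>+\<omega>. ennreal (\<bar>w \<omega> (h n)\<bar> powr r) \<partial>P) \<le> ennreal (moment_const r * \<sigma> powr r)) sequentially"
    by eventually_elim (intro moment r h \<sigma> less_imp_le)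
  have [measurable]: "(\<lambda>\<omega>. w \<omega> (h n)) \<in> borel_measurable P" for n by (intro w_meas h)
  have "(\<integral>\<^sup>+\<omega>. ennreal (\<bar>Y \<omega>\<bar> powr r) \<partial>P) = (\<integral>\<^sup>+\<omega>. liminf (\<lambda>n. ennreal (\<bar>w \<omega> (h n)\<bar> powr r)) \<partial>P)"
  proof (rule nn_integral_cong_AE, use Y in eventually_elim)
    fix \<omega> assume "(\<lambda>n. w \<omega> (h n)) \<longlonglongrightarrow> Y \<omega>"
    then have "(\<lambda>n. ennreal (\<bar>w \<omega> (h n)\<bar> powr r)) \<longlonglongrightarrow> ennreal (\<bar>Y \<omega>\<bar> powr r)"
      using r by (auto intro!: tendsto_ennrealI tendsto_powr' tendsto_rabs)
    then show "ennreal (\<bar>Y \<omega>\<bar> powr r) = liminf (\<lambda>n. ennreal (\<bar>w \<omega> (h n)\<bar> powr r))"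
      by (rule lim_imp_Liminf[symmetric, rotated]) simp
  qed
  also have "\<dots> \<le> liminf (\<lambda>n. \<integral>\<^sup>+\<omega>. ennreal (\<bar>w \<omega> (h n)\<bar> powr r) \<partial>P)"
    by (rule nn_integral_liminf) measurable
  also have "\<dots> \<le> ennreal (moment_const r * \<sigma> powr r)"
  proof -
    have "liminf (\<lambda>n. \<integral>\<^sup>+\<omega>. ennreal (\<bar>w \<omega> (h n)\<bar> powr r) \<partial>P) \<le> liminf (\<lambda>n. ennreal (moment_const r * \<sigma> powr r))"
      by (rule Liminf_mono) (rule ev)
    then show ?thesis by (simp add: Liminf_const)
  qed
  finally show ?thesis .
qed

text \<open>Consecutive differences are uniformly at most 2/2^n, so their moments of order r =
  \<alpha>/2, a choice below \<alpha>, decay like 2^(-nr). Hence the increments of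
  \<open>w \<omega> (h n)\<close> are almost surely of order 2^(-n/2), and their series
  converges.\<close>

lemma AE_convergent:
  assumes h: "\<And>n. h n \<in> test_functions" "\<And>n x. \<bar>h n x - g x\<bar> \<le> 1 / 2 ^ n"
  shows "AE \<omega> in P. convergent (\<lambda>n. w \<omega> (h n))"
proof -
  define r where "r = \<alpha> / 2"
  have r: "0 < r" "r < \<alpha>" using \<alpha> by (auto simp: r_def)
  define d where "d n x = h (Suc n) x - h n x" for n x
  have d: "d n \<in> test_functions" for n unfolding d_def[abs_def] by (intro test_diff h)
  have d_le: "\<bar>d n x\<bar> \<le> 2 / 2 ^ n" for n x
  proof -
    have "1 / 2 ^ Suc n \<le> (1 / 2 ^ n :: real)" by (simp add: field_simps)
    then show ?thesis using h(2)[of "Suc n" x] h(2)[of n x] unfolding d_def by linarith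
  qed
  have [measurable]: "(\<lambda>\<omega>. w \<omega> (d n)) \<in> borel_measurable P" for n by (intro w_meas d)
  let ?K = "moment_const r"
  have K: "0 \<le> ?K" using moment(1) r by blast
  define q where "q = 2 powr (- r / 2)"
  have q: "0 < q" "q < 1" using r by (auto simp: q_def powr_less_one)
  \<comment> \<open>Half of the decay 2^(-nr) is spent on the weight, the other half makes the
    bounds summable.\<close>
  have E: "(\<integral>\<^sup>+\<omega>. ennreal (2 powr (real n * r / 2) * \<bar>w \<omega> (d n)\<bar> powr r) \<partial>P) \<le> ennreal (?K * 2 powr r * q ^ n)" for n
  proof -
    have "(\<integral>x. \<bar>d n x\<bar> powr \<alpha> \<partial>torus_measure) \<le> (2 / 2 ^ n) powr \<alpha>"
    proof (rule torus_integral_le)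
      have [measurable]: "d n \<in> borel_measurable borel"
        by (intro borel_measurable_continuous_onI test_continuous' d)
      show "(\<lambda>x. \<bar>d n x\<bar> powr \<alpha>) \<in> borel_measurable borel" by measurable
      show "\<bar>d n x\<bar> powr \<alpha> \<le> (2 / 2 ^ n) powr \<alpha>" for x using \<alpha> d_le[of n x] by (intro powr_mono2) auto
    qed simp
    then have m: "(\<integral>\<^sup>+\<omega>. ennreal (\<bar>w \<omega> (d n)\<bar> powr r) \<partial>P) \<le> ennreal (?K * (2 / 2 ^ n) powr r)"
      by (intro moment d) (use r in auto)
    have "(\<integral>\<^sup>+\<omega>. ennreal (2 powr (real n * r / 2) * \<bar>w \<omega> (d n)\<bar> powr r) \<partial>P)
      = ennreal (2 powr (real n * r / 2)) * (\<integral>\<^sup>+\<omega>. ennreal (\<bar>w \<omega> (d n)\<bar> powr r) \<partial>P)"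
      by (simp add: ennreal_mult' nn_integral_cmult)
    also have "\<dots> \<le> ennreal (2 powr (real n * r / 2)) * ennreal (?K * (2 / 2 ^ n) powr r)"
      by (intro mult_left_mono m) auto
    also have "\<dots> = ennreal (2 powr (real n * r / 2) * (?K * (2 / 2 ^ n) powr r))"
      by (simp add: ennreal_mult')
    also have "2 powr (real n * r / 2) * (?K * (2 / 2 ^ n) powr r) = ?K * 2 powr r * q ^ n"
    proof -
      have "(2 / 2 ^ n :: real) = 2 powr (1 - real n)" by (simp add: powr_diff powr_realpow)
      then have "(2 / 2 ^ n :: real) powr r = 2 powr (r - real n * r)"
        by (simp only: powr_powr left_diff_distrib mult_1)
      moreover have "q ^ n = 2 powr (- (real n * r / 2))"
        unfolding q_def by (simp add: powr_realpow[symmetric] powr_powr mult.commute)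
      ultimately show ?thesis by (simp add: powr_add[symmetric] mult.left_commute[of _ ?K] mult.commute[of r])
    qed
    finally show ?thesis .
  qed
  have "AE \<omega> in P. \<exists>C\<ge>0. \<forall>n. 2 powr (real n * r / 2) * \<bar>w \<omega> (d n)\<bar> powr r \<le> C"
    by (rule AE_bounded_if_sum_finite[OF _ E]) (use q K in \<open>auto intro!: summable_mult summable_geometric\<close>)
  then show ?thesis
    using AE_space
  proof eventually_elim
    case (elim \<omega>)
    then obtain C where C: "C \<ge> 0" "\<And>n. 2 powr (real n * r / 2) * \<bar>w \<omega> (d n)\<bar> powr r \<le> C" by blast
    have bd: "\<bar>w \<omega> (d n)\<bar> \<le> C powr (1 / r) * (2 powr (- 1 / 2)) ^ n" for n
    proof -
      have "\<bar>w \<omega> (d n)\<bar> powr r \<le> C * 2 powr (- (real n * r / 2))"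
        using C(2)[of n] by (simp add: powr_minus field_simps)
      then have "(\<bar>w \<omega> (d n)\<bar> powr r) powr (1 / r) \<le> (C * 2 powr (- (real n * r / 2))) powr (1 / r)"
        using r by (intro powr_mono2) auto
      also have "\<dots> = C powr (1 / r) * 2 powr (- (real n / 2))"
        using r C by (simp add: powr_mult powr_powr)
      also have "2 powr (- (real n / 2)) = (2 powr (- 1 / 2) :: real) ^ n"
        by (simp add: powr_realpow[symmetric] powr_powr)
      finally show ?thesis using r by (simp add: powr_powr)
    qed
    have "summable (\<lambda>n. C powr (1 / r) * (2 powr (- 1 / 2)) ^ n)"
      by (intro summable_mult summable_geometric) (simp add: powr_less_one)
    then have "summable (\<lambda>n. w \<omega> (d n))"
      by (rule summable_comparison_test'[where N=0]) (use bd in auto)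
    then have "convergent (\<lambda>n. \<Sum>k<n. w \<omega> (d k))" by (simp add: summable_iff_convergent)
    moreover have "(\<Sum>k<n. w \<omega> (d k)) = w \<omega> (h n) - w \<omega> (h 0)" for n
    proof -
      have "w \<omega> (d k) = w \<omega> (h (Suc k)) - w \<omega> (h k)" for k
        unfolding d_def[abs_def] using elim(2) by (intro w_diff h)
      then show ?thesis using sum_lessThan_telescope[of "\<lambda>k. w \<omega> (h k)" n] by simp
    qed
    ultimately show ?case by (simp add: convergent_diff_const_right_iff)
  qed
qed

end

section \<open>Wavelets on the torus\<close>

context wavelets begin

text \<open>Here \<open>G m\<close> is the derivative of order m. Substituting y = a t - b and
  expanding \<open>G 0\<close> about b/a, the vanishing moments remove the Taylor polynomial of
  degree below u; the remainder is at most S (R/a)^u on the support, and the substitution supplies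
  one more factor 1/a.\<close>

lemma mother_decay:
  assumes DERIV: "\<And>m t. ((G m) has_real_derivative G (Suc m) t) (at t)"
    and S: "\<And>t. \<bar>G u t\<bar> \<le> S" and a: "0 < a"
  shows "\<bar>\<integral>t. \<psi> Mother (a * t - b) * G 0 t \<partial>lborel\<bar> \<le> S * R ^ u * absint / a ^ Suc u"
proof -
  have S0: "0 \<le> S" using S[of 0] by linarith
  have Gc: "continuous_on UNIV (G m)" for m
    using DERIV by (auto intro!: continuous_at_imp_continuous_on DERIV_isCont)
  define c where "c = b / a"
  define T where "T y = (\<Sum>m<u. G m c / fact m * (y / a) ^ m)" for y
  define r where "r y = G 0 (c + y / a) - T y" for y
  have Tc: "continuous_on UNIV T" unfolding T_def using a by (intro continuous_intros) auto
  have G0c: "continuous_on UNIV (\<lambda>y. G 0 (c + y / a))"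
    by (rule continuous_on_compose2[OF Gc]) (use a in \<open>auto intro!: continuous_intros\<close>)
  have rc: "continuous_on UNIV r" unfolding r_def by (intro continuous_intros Tc G0c)
  have im: "integrable lborel (\<lambda>y. f y * \<psi> Mother y)" if "continuous_on UNIV f" for f
    using integrable_mult'[OF that, of Mother 0] by simp
  have r_le: "\<bar>r y\<bar> \<le> S * (\<bar>y\<bar> / a) ^ u" for y
  proof -
    have "\<exists>t. \<bar>t\<bar> \<le> \<bar>y / a\<bar> \<and> G 0 (c + y / a) = (\<Sum>m<u. G m (c + 0) / fact m * (y / a) ^ m) + G u (c + t) / fact u * (y / a) ^ u"
    proof (rule Maclaurin_all_le[of "\<lambda>m h. G m (c + h)" "\<lambda>h. G 0 (c + h)"])
      show "\<forall>m x. ((\<lambda>h. G m (c + h)) has_real_derivative G (Suc m) (c + x)) (at x)"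
      proof (intro allI)
        fix m x
        have "((\<lambda>h. G m (h + c)) has_real_derivative G (Suc m) (x + c)) (at x)"
          by (rule DERIV_shift[THEN iffD1]) (rule DERIV)
        then show "((\<lambda>h. G m (c + h)) has_real_derivative G (Suc m) (c + x)) (at x)"
          by (simp only: add.commute)
      qed
    qed simp
    then obtain t where "G 0 (c + y / a) = (\<Sum>m<u. G m (c + 0) / fact m * (y / a) ^ m) + G u (c + t) / fact u * (y / a) ^ u"
      by blast
    then have "r y = G u (c + t) / fact u * (y / a) ^ u" by (simp add: r_def T_def)
    then have "\<bar>r y\<bar> = \<bar>G u (c + t)\<bar> / fact u * (\<bar>y\<bar> / a) ^ u"
      using a by (simp add: abs_mult power_abs)
    also have "\<dots> \<le> S / 1 * (\<bar>y\<bar> / a) ^ u"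
      using a S0 by (intro mult_right_mono frac_le S) (auto simp: fact_ge_1)
    finally show ?thesis by simp
  qed
  have eq: "(\<integral>t. \<psi> Mother (a * t - b) * G 0 t \<partial>lborel) = (\<integral>y. G 0 (c + y / a) * \<psi> Mother y \<partial>lborel) / a"
    using integral_dilate[OF a, of "\<lambda>y. G 0 (c + y / a) * \<psi> Mother y" "-b"] a
    by (simp add: c_def diff_divide_distrib mult.commute)
  have "(\<integral>y. T y * \<psi> Mother y \<partial>lborel) = 0"
  proof -
    have "(\<integral>y. T y * \<psi> Mother y \<partial>lborel) = (\<integral>y. (\<Sum>m<u. G m c / fact m / a ^ m * (y ^ m * \<psi> Mother y)) \<partial>lborel)"
      unfolding T_def sum_distrib_right by (simp add: power_divide mult.assoc)
    also have "\<dots> = (\<Sum>m<u. G m c / fact m / a ^ m * (\<integral>y. y ^ m * \<psi> Mother y \<partial>lborel))"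
      by (subst Bochner_Integration.integral_sum) (auto intro!: integrable_mult_right im continuous_intros)
    also have "\<dots> = 0" by (intro sum.neutral) (simp add: mother_moment)
    finally show ?thesis .
  qed
  moreover have "(\<integral>y. G 0 (c + y / a) * \<psi> Mother y \<partial>lborel) = (\<integral>y. T y * \<psi> Mother y + r y * \<psi> Mother y \<partial>lborel)"
    by (simp add: r_def algebra_simps)
  ultimately have "(\<integral>y. G 0 (c + y / a) * \<psi> Mother y \<partial>lborel) = (\<integral>y. r y * \<psi> Mother y \<partial>lborel)"
    using im[OF Tc] im[OF rc] by simp
  also have "\<bar>\<dots>\<bar> \<le> (\<integral>y. S * (R / a) ^ u * \<bar>\<psi> Mother y\<bar> \<partial>lborel)"
  proof (rule order_trans[OF integral_abs_bound integral_mono])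
    fix y
    show "\<bar>r y * \<psi> Mother y\<bar> \<le> S * (R / a) ^ u * \<bar>\<psi> Mother y\<bar>"
    proof (cases "\<bar>y\<bar> \<le> R")
      case True
      have "\<bar>r y\<bar> \<le> S * (\<bar>y\<bar> / a) ^ u" by (rule r_le)
      also have "\<dots> \<le> S * (R / a) ^ u"
        using True a S0 by (intro mult_left_mono power_mono divide_right_mono) auto
      finally show ?thesis unfolding abs_mult by (intro mult_right_mono) auto
    next
      case False
      then show ?thesis using supp[of y Mother] by simp
    qed
  qed (auto intro!: integrable_abs im rc integrable_mult_right int_psi)
  also have "\<dots> = S * (R / a) ^ u * (\<integral>y. \<bar>\<psi> Mother y\<bar> \<partial>lborel)" by simp
  also have "\<dots> \<le> S * (R / a) ^ u * absint"
    using S0 R_ge a by (intro mult_left_mono absint) auto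
  finally have "\<bar>\<integral>y. G 0 (c + y / a) * \<psi> Mother y \<partial>lborel\<bar> / a \<le> S * (R / a) ^ u * absint / a"
    using a by (intro divide_right_mono) auto
  then show ?thesis unfolding eq using a by (simp add: power_divide mult.commute[of a])
qed

end

subsection \<open>Periodization\<close>

lemma periodization_finite:
  fixes h :: "real^'d \<Rightarrow> real"
  assumes supp: "\<And>x a. r \<le> \<bar>x $ a\<bar> \<Longrightarrow> h x = 0" and x: "\<And>a. \<bar>x $ a\<bar> \<le> b" and M: "b + r \<le> of_int M"
  shows "(\<Sum>\<^sub>\<infinity>k. h (x - int_vec k)) = (\<Sum>k\<in>int_box M. h (x - int_vec k))"
proof -
  have "(\<Sum>\<^sub>\<infinity>k. h (x - int_vec k)) = (\<Sum>\<^sub>\<infinity>k\<in>int_box M. h (x - int_vec k))"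
  proof (rule infsum_cong_neutral)
    fix k :: "int^'d" assume "k \<in> UNIV - int_box M"
    then obtain a where a: "M < \<bar>k $ a\<bar>" by (auto simp: int_box_def not_le)
    then have "(of_int M :: real) < of_int \<bar>k $ a\<bar>" by linarith
    then have "r \<le> \<bar>(x - int_vec k) $ a\<bar>" using x[of a] M by simp
    then show "h (x - int_vec k) = 0" by (rule supp)
  qed auto
  then show ?thesis by (simp add: infsum_finite finite_int_box)
qed

text \<open>On a unit ball the same finite set of translates suffices for all points.\<close>

lemma periodization_continuous:
  fixes h :: "real^'d \<Rightarrow> real"
  assumes h: "continuous_on UNIV h" and supp: "\<And>x a. r \<le> \<bar>x $ a\<bar> \<Longrightarrow> h x = 0"
  shows "continuous_on UNIV (\<lambda>x. \<Sum>\<^sub>\<infinity>k. h (x - int_vec k))"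
proof (rule continuous_at_imp_continuous_on, rule ballI)
  fix z :: "real^'d"
  define M where "M = \<lceil>norm z + 1 + r\<rceil>"
  have "continuous_on (ball z 1) (\<lambda>x. \<Sum>k\<in>int_box M. h (x - int_vec k))"
    by (intro continuous_intros continuous_on_compose2[OF h]) auto
  moreover have "(\<Sum>\<^sub>\<infinity>k. h (x - int_vec k)) = (\<Sum>k\<in>int_box M. h (x - int_vec k))" if "x \<in> ball z 1" for x
  proof (rule periodization_finite[OF supp])
    show "\<bar>x $ a\<bar> \<le> norm z + 1" for a
    proof -
      have "norm x \<le> norm z + norm (x - z)" using norm_triangle_ineq[of z "x - z"] by simp
      then show ?thesis using component_le_norm_cart[of x a] that by (simp add: dist_norm norm_minus_commute)
    qed
    show "norm z + 1 + r \<le> of_int M" by (simp add: M_def)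
  qed
  ultimately have "continuous_on (ball z 1) (\<lambda>x. \<Sum>\<^sub>\<infinity>k. h (x - int_vec k))"
    by (subst continuous_on_cong[OF refl]) auto
  then show "isCont (\<lambda>x. \<Sum>\<^sub>\<infinity>k. h (x - int_vec k)) z"
    by (simp add: continuous_on_eq_continuous_at)
qed

lemma int_vec_axis: "axis i 1 = int_vec (axis i 1)"
  by (simp add: vec_eq_iff axis_def)

lemma int_vec_add: "int_vec (k + l) = int_vec k + int_vec l"
  by (simp add: vec_eq_iff)

lemma periodization_periodic: "periodic (\<lambda>x. \<Sum>\<^sub>\<infinity>k. h (x - int_vec k))"
proof -
  have "(\<Sum>\<^sub>\<infinity>k. h (x + axis i 1 - int_vec k)) = (\<Sum>\<^sub>\<infinity>k. h (x - int_vec k))" for x i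
  proof -
    have "(\<Sum>\<^sub>\<infinity>k. h (x + axis i 1 - int_vec (k + axis i 1))) = (\<Sum>\<^sub>\<infinity>k. h (x + axis i 1 - int_vec k))"
      by (rule infsum_reindex_bij_betw) (rule bij_plus_right)
    then show ?thesis by (simp add: int_vec_add int_vec_axis[symmetric])
  qed
  then show ?thesis by (simp add: periodic_def)
qed

lemma prod_sum_vec:
  fixes f :: "'d::finite \<Rightarrow> 'b \<Rightarrow> real"
  assumes "\<And>a. finite (A a)"
  shows "(\<Sum>n\<in>{n :: 'b^'d. \<forall>a. n $ a \<in> A a}. \<Prod>a\<in>UNIV. f a (n $ a)) = (\<Prod>a\<in>UNIV. \<Sum>k\<in>A a. f a k)"
proof -
  have "(\<Prod>a\<in>UNIV. \<Sum>k\<in>A a. f a k) = (\<Sum>g\<in>Pi\<^sub>E UNIV A. \<Prod>a\<in>UNIV. f a (g a))"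
    by (rule prod_sum_PiE) (use assms in auto)
  also have "\<dots> = (\<Sum>n\<in>{n :: 'b^'d. \<forall>a. n $ a \<in> A a}. \<Prod>a\<in>UNIV. f a (n $ a))"
    by (rule sum.reindex_bij_witness[of _ vec_nth vec_lambda]) auto
  finally show ?thesis ..
qed

lemma finite_genders: "finite (genders j :: ('d::finite \<Rightarrow> gender) set)"
proof -
  have "finite (Pi\<^sub>E (UNIV :: 'd set) (\<lambda>_. UNIV :: gender set))" by (intro finite_PiE) auto
  then have "finite (UNIV :: ('d \<Rightarrow> gender) set)" by (simp add: PiE_UNIV_domain)
  then show ?thesis by (rule finite_subset[rotated]) simp
qed

lemma prod_sum_genders:
  fixes f :: "'d::finite \<Rightarrow> gender \<Rightarrow> real"
  shows "(\<Sum>G\<in>UNIV. \<Prod>a\<in>UNIV. f a (G a)) = (\<Prod>a\<in>UNIV. \<Sum>g\<in>UNIV. f a g)"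
  using prod_sum_PiE[of UNIV "\<lambda>_. UNIV" f] by (simp add: PiE_UNIV_domain)

subsection \<open>Periodic wavelets\<close>

locale torus_wavelets = wavelets +
  fixes L :: nat
  assumes fits: "fits_torus L \<psi>"
begin

text \<open>One coordinate factor of a wavelet; the normalization 2^((j+L)d/2) is split evenly over
  the d coordinates, so that each factor keeps its L2 norm.\<close>

definition atom :: "nat \<Rightarrow> gender \<Rightarrow> int \<Rightarrow> real \<Rightarrow> real" where
  "atom j g k t = 2 powr (real (j + L) / 2) * \<psi> g (2 ^ (j + L) * t - of_int k)"

lemma atom_cont [continuous_intros]: "continuous_on S f \<Longrightarrow> continuous_on S (\<lambda>x. atom j g k (f x))"
  unfolding atom_def by (intro continuous_intros)

lemma atom_integrable: "integrable lborel (atom j g k)"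
  using integrable_mult[of "\<lambda>_. 2 powr (real (j + L) / 2)" "2 ^ (j + L)" g "of_int k"]
  by (simp add: atom_def[abs_def])

lemma sqrt_scale: "2 powr (real s / 2) * 2 powr (real s / 2) = (2::real) ^ s"
  by (simp add: powr_realpow flip: powr_add)

lemma sqrt_scale_minus: "2 powr (- real s / 2) = 2 powr (real s / 2) / (2::real) ^ s"
  by (simp add: powr_realpow[symmetric] flip: powr_diff)

lemma atom_abs_integral: "(\<integral>t. \<bar>atom j g k t\<bar> \<partial>lborel) \<le> 2 powr (- real (j + L) / 2) * absint"
proof -
  have "(\<integral>t. \<bar>atom j g k t\<bar> \<partial>lborel) = 2 powr (real (j + L) / 2) * (\<integral>t. \<bar>\<psi> g (2 ^ (j + L) * t + (- of_int k))\<bar> \<partial>lborel)"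
    by (simp add: atom_def abs_mult)
  also have "\<dots> = 2 powr (real (j + L) / 2) * ((\<integral>t. \<bar>\<psi> g t\<bar> \<partial>lborel) / 2 ^ (j + L))"
    by (subst integral_dilate[of _ "\<lambda>t. \<bar>\<psi> g t\<bar>"]) auto
  also have "\<dots> = 2 powr (- real (j + L) / 2) * (\<integral>t. \<bar>\<psi> g t\<bar> \<partial>lborel)"
    by (simp only: sqrt_scale_minus times_divide_eq_left times_divide_eq_right)
  also have "\<dots> \<le> 2 powr (- real (j + L) / 2) * absint" by (intro mult_left_mono absint) auto
  finally show ?thesis .
qed

lemma wavelet_prod:
  "wavelet L \<psi> j G m x = (\<Prod>a\<in>(UNIV::'d::finite set). atom j (G a) (m $ a) (x $ a))"
proof -
  have "(2 powr (real (j + L) / 2)) ^ CARD('d) = (2 :: real) powr (real (j + L) * real CARD('d) / 2)"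
    by (simp add: powr_realpow[symmetric] powr_powr)
  then show ?thesis by (simp add: wavelet_def atom_def prod.distrib)
qed

lemma wavelet_continuous: "continuous_on UNIV (wavelet L \<psi> j G m :: real^'d \<Rightarrow> real)"
  unfolding wavelet_prod[abs_def] by (intro continuous_intros)

text \<open>A crude radius independent of j, as dilation by 2^(j+L) \<ge> 1 only shrinks the
  support. It serves to make periodizations finite sums.\<close>

lemma wavelet_support:
  fixes x :: "real^'d"
  assumes "R + (\<Sum>b\<in>UNIV. real_of_int \<bar>m $ b\<bar>) \<le> \<bar>x $ a\<bar>"
  shows "wavelet L \<psi> j G m x = 0"
proof -
  have "real_of_int \<bar>m $ a\<bar> \<le> (\<Sum>b\<in>UNIV. real_of_int \<bar>m $ b\<bar>)"
    by (rule member_le_sum) auto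
  then have "R + \<bar>of_int (m $ a)\<bar> \<le> \<bar>x $ a\<bar>" using assms by simp
  moreover have "1 * \<bar>x $ a\<bar> \<le> 2 ^ (j + L) * \<bar>x $ a\<bar>" by (intro mult_right_mono) auto
  moreover have "2 ^ (j + L) * \<bar>x $ a\<bar> = \<bar>2 ^ (j + L) * x $ a\<bar>" by (simp add: abs_mult)
  ultimately have "R \<le> \<bar>2 ^ (j + L) * x $ a - of_int (m $ a)\<bar>" by linarith
  then have "atom j (G a) (m $ a) (x $ a) = 0" by (simp add: atom_def supp)
  then show ?thesis unfolding wavelet_prod by (intro prod_zero) auto
qed

lemma wavelet_integrable:
  fixes \<phi> :: "real^'d \<Rightarrow> real"
  assumes "continuous_on UNIV \<phi>"
  shows "integrable lborel (\<lambda>x. wavelet L \<psi> j G m x * \<phi> x)"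
proof (rule integrable_continuous_compact_support)
  let ?r = "R + (\<Sum>b\<in>UNIV. real_of_int \<bar>m $ b\<bar>)"
  show "continuous_on UNIV (\<lambda>x. wavelet L \<psi> j G m x * \<phi> x)"
    by (intro continuous_intros wavelet_continuous assms)
  show "compact (cbox (\<chi> a. - ?r) (\<chi> a. ?r))" by (rule compact_cbox)
  fix x :: "real^'d" assume "x \<notin> cbox (\<chi> a. - ?r) (\<chi> a. ?r)"
  then obtain a where "\<not> (- ?r \<le> x $ a \<and> x $ a \<le> ?r)" by (auto simp: mem_box_cart)
  then have "?r \<le> \<bar>x $ a\<bar>" by linarith
  then show "wavelet L \<psi> j G m x * \<phi> x = 0" by (simp add: wavelet_support)
qed

lemma periodic_wavelet_eq: "periodic_wavelet L \<psi> j G m x = (\<Sum>\<^sub>\<infinity>k. wavelet L \<psi> j G m (x - int_vec k))"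
  by (simp add: periodic_wavelet_def int_vec_def)

lemma periodic_wavelet_continuous: "continuous_on UNIV (periodic_wavelet L \<psi> j G m :: real^'d \<Rightarrow> real)"
  unfolding periodic_wavelet_eq[abs_def]
  by (rule periodization_continuous[OF wavelet_continuous wavelet_support])

lemma periodic_wavelet_periodic: "periodic (periodic_wavelet L \<psi> j G m :: real^'d \<Rightarrow> real)"
  unfolding periodic_wavelet_eq[abs_def] by (rule periodization_periodic)

definition coef :: "nat \<Rightarrow> ('d::finite \<Rightarrow> gender) \<Rightarrow> int^'d \<Rightarrow> (real^'d \<Rightarrow> real) \<Rightarrow> real" where
  "coef j G m \<phi> = (\<integral>x. periodic_wavelet L \<psi> j G m x * \<phi> x \<partial>torus_measure)"

text \<open>As \<phi> is periodic, multiplying the periodized wavelet by it is the same as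
  periodizing the product, and \<open>torus_unfold\<close> applies.\<close>

lemma coef_eq:
  fixes \<phi> :: "real^'d \<Rightarrow> real"
  assumes \<phi>: "continuous_on UNIV \<phi>" "periodic \<phi>"
  shows "coef j G m \<phi> = (\<integral>x. wavelet L \<psi> j G m x * \<phi> x \<partial>lborel)"
proof -
  have "\<phi> (x - int_vec k) = \<phi> x" for x k
    using periodic_int_vec[OF \<phi>(2), of "x - int_vec k" k] by simp
  then have "periodic_wavelet L \<psi> j G m x * \<phi> x = (\<Sum>\<^sub>\<infinity>k. wavelet L \<psi> j G m (x - int_vec k) * \<phi> (x - int_vec k))" for x
    by (simp add: periodic_wavelet_eq infsum_cmult_left')
  then have "coef j G m \<phi> = (\<integral>x. (\<Sum>\<^sub>\<infinity>k. wavelet L \<psi> j G m (x - int_vec k) * \<phi> (x - int_vec k)) \<partial>torus_measure)"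
    by (simp add: coef_def)
  also have "\<dots> = (\<integral>x. wavelet L \<psi> j G m x * \<phi> x \<partial>lborel)"
    by (rule torus_unfold[OF wavelet_integrable[OF \<phi>(1)], where r="R + (\<Sum>b\<in>UNIV. real_of_int \<bar>m $ b\<bar>)"])
       (simp add: wavelet_support)
  finally show ?thesis .
qed

text \<open>With s = j + L, a mother coordinate, integrated first, contributes 2^(-s/2-su) by the
  vanishing moments, and each of the other d - 1 coordinates contributes 2^(-s/2) through its L1
  norm.\<close>

lemma coef_decay:
  fixes \<phi> :: "real^'d \<Rightarrow> real"
  assumes \<phi>: "\<phi> \<in> test_functions" and G: "G \<in> genders j"
  shows "\<bar>coef j G m \<phi>\<bar> \<le> absint ^ CARD('d) * R ^ u * 2 ^ (L * u) *
    2 powr (- (real (j + L) * real CARD('d) / 2) - real (j + L) * real u) * test_seminorm u \<phi>"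
proof -
  let ?s = "real (j + L)" and ?d = "CARD('d)" and ?S = "test_seminorm u \<phi>"
  have c: "coef j G m \<phi> = (\<integral>x. (\<Prod>b\<in>UNIV. atom j (G b) (m $ b) (x $ b)) * \<phi> x \<partial>lborel)"
    by (simp add: coef_eq test_continuous' test_periodic \<phi> wavelet_prod)
  have i: "integrable lborel (\<lambda>x. (\<Prod>b\<in>UNIV. atom j (G b) (m $ b) (x $ b)) * \<phi> x)"
    using wavelet_integrable[OF test_continuous'[OF \<phi>], of j G m] by (simp add: wavelet_prod)
  have S0: "0 \<le> ?S" by (rule test_seminorm_nonneg[OF \<phi>])
  have pw: "(2 powr (- ?s / 2)) ^ n = (2::real) powr (- ?s * real n / 2)" for n
    by (simp add: powr_realpow[symmetric] powr_powr)
  show ?thesis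
  proof (cases "\<exists>a. G a = Mother")
    case True
    then obtain a where a: "G a = Mother" by blast
    \<comment> \<open>The bound of \<open>mother_decay\<close> for the restriction of \<phi> to the
      line through x in direction a, times the normalization of the atom.\<close>
    define E where "E = 2 powr (?s / 2) * (?S * R ^ u * absint / (2 ^ (j + L)) ^ Suc u)"
    have "\<bar>\<integral>x. (\<Prod>b\<in>UNIV. atom j (G b) (m $ b) (x $ b)) * \<phi> x \<partial>lborel\<bar>
      \<le> E * (\<Prod>b\<in>UNIV - {a}. \<integral>t. \<bar>atom j (G b) (m $ b) t\<bar> \<partial>lborel)"
    proof (rule integral_coordinate_bound[OF atom_integrable i])
      fix x :: "real^'d"
      define F where "F k t = iterated_partial (replicate k a) \<phi> (x + (t - x $ a) *\<^sub>R axis a 1)" for k t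
      have "\<bar>\<integral>t. \<psi> Mother (2 ^ (j + L) * t - of_int (m $ a)) * F 0 t \<partial>lborel\<bar> \<le> ?S * R ^ u * absint / (2 ^ (j + L)) ^ Suc u"
      proof (rule mother_decay)
        show "(F k has_real_derivative F (Suc k) t) (at t)" for k t
        proof -
          let ?z = "x - (x $ a) *\<^sub>R axis a 1"
          have "((\<lambda>t. iterated_partial (replicate k a) \<phi> (?z + t *\<^sub>R axis a 1)) has_real_derivative
            partial_deriv a (iterated_partial (replicate k a) \<phi>) (?z + t *\<^sub>R axis a 1)) (at t)"
            by (rule line_derivative) (rule test_differentiable[OF \<phi>])
          then show ?thesis by (simp add: F_def[abs_def] algebra_simps)
        qed
        show "\<bar>F u t\<bar> \<le> ?S" for t unfolding F_def by (rule test_seminorm_ge[OF \<phi>]) simp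
      qed simp
      then have "2 powr (?s / 2) * \<bar>\<integral>t. \<psi> Mother (2 ^ (j + L) * t - of_int (m $ a)) * F 0 t \<partial>lborel\<bar> \<le> E"
        unfolding E_def by (intro mult_left_mono) auto
      then show "\<bar>\<integral>t. atom j (G a) (m $ a) t * \<phi> (x + (t - x $ a) *\<^sub>R axis a 1) \<partial>lborel\<bar> \<le> E"
        by (simp add: atom_def a F_def abs_mult mult.assoc)
    qed
    also have "\<dots> \<le> E * (\<Prod>b\<in>UNIV - {a}. 2 powr (- ?s / 2) * absint)"
      by (intro mult_left_mono prod_mono conjI atom_abs_integral)
         (use S0 R_ge absint_nonneg in \<open>auto simp: E_def\<close>)
    also have "\<dots> = absint * absint ^ (?d - 1) * R ^ u * (2 powr (?s / 2) / (2 ^ (j + L)) ^ Suc u * (2 powr (- ?s / 2)) ^ (?d - 1)) * ?S"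
      by (simp add: E_def power_mult_distrib)
    also have "absint * absint ^ (?d - 1) = absint ^ ?d"
      by (metis One_nat_def Suc_pred power_Suc zero_less_card_finite)
    also have "2 powr (?s / 2) / (2 ^ (j + L)) ^ Suc u * (2 powr (- ?s / 2)) ^ (?d - 1) = 2 powr (- (?s * real ?d / 2) - ?s * real u)"
    proof -
      have "((2::real) ^ (j + L)) ^ Suc u = 2 powr (?s * real (Suc u))"
        by (simp only: power_mult[symmetric] of_nat_mult[symmetric]) (rule powr_realpow[symmetric], simp)
      moreover have "real (?d - 1) = real ?d - 1" by (simp add: of_nat_diff Suc_le_eq)
      moreover have "?s / 2 - ?s * real (Suc u) + - ?s * (real ?d - 1) / 2 = - (?s * real ?d / 2) - ?s * real u"
        by (simp add: field_simps)
      ultimately show ?thesis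
        unfolding pw by (simp only: powr_diff[symmetric] powr_add[symmetric])
    qed
    also have "absint ^ ?d * R ^ u * 2 powr (- (?s * real ?d / 2) - ?s * real u) * ?S
      \<le> absint ^ ?d * R ^ u * 2 ^ (L * u) * 2 powr (- (?s * real ?d / 2) - ?s * real u) * ?S"
    proof -
      have "1 * (absint ^ ?d * R ^ u * 2 powr (- (?s * real ?d / 2) - ?s * real u) * ?S)
        \<le> 2 ^ (L * u) * (absint ^ ?d * R ^ u * 2 powr (- (?s * real ?d / 2) - ?s * real u) * ?S)"
        using S0 R_ge absint_nonneg by (intro mult_right_mono) auto
      then show ?thesis by (simp add: ac_simps)
    qed
    finally show ?thesis by (simp only: c)
  next
    case False
    \<comment> \<open>Only level 0 has a wavelet without mother factor; there the factor 2^(Lu) of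
      the bound compensates for the absent decay 2^(-su).\<close>
    then have j: "j = 0" using G by (auto simp: genders_def split: if_splits)
    have ia: "integrable lborel (\<lambda>x. \<Prod>b\<in>UNIV. \<bar>atom j (G b) (m $ b) ((x :: real^'d) $ b)\<bar>)"
      by (intro integrable_product_vec integrable_abs atom_integrable)
    have "\<bar>\<integral>x. (\<Prod>b\<in>UNIV. atom j (G b) (m $ b) (x $ b)) * \<phi> x \<partial>lborel\<bar>
      \<le> (\<integral>x. (\<Prod>b\<in>UNIV. \<bar>atom j (G b) (m $ b) (x $ b)\<bar>) * ?S \<partial>lborel)"
    proof (rule order_trans[OF integral_abs_bound integral_mono])
      fix x :: "real^'d"
      show "\<bar>(\<Prod>b\<in>UNIV. atom j (G b) (m $ b) (x $ b)) * \<phi> x\<bar> \<le> (\<Prod>b\<in>UNIV. \<bar>atom j (G b) (m $ b) (x $ b)\<bar>) * ?S"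
        unfolding abs_mult abs_prod using test_seminorm_ge[OF \<phi>, of "[]" u x]
        by (intro mult_left_mono prod_nonneg) auto
    qed (use i ia in \<open>auto intro!: integrable_abs\<close>)
    also have "\<dots> = (\<Prod>b\<in>UNIV. \<integral>t. \<bar>atom j (G b) (m $ b) t\<bar> \<partial>lborel) * ?S"
      using integral_product_vec[of "\<lambda>b t. \<bar>atom j (G b) (m $ b) t\<bar>"] by (simp add: integrable_abs atom_integrable)
    also have "\<dots> \<le> (\<Prod>b\<in>(UNIV :: 'd set). 2 powr (- ?s / 2) * absint) * ?S"
      by (intro mult_right_mono prod_mono conjI atom_abs_integral S0) auto
    also have "\<dots> = absint ^ ?d * 2 powr (- ?s * real ?d / 2) * ?S"
      by (simp only: prod_constant power_mult_distrib pw mult.commute[of "absint ^ _"])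
    also have "\<dots> \<le> R ^ u * (absint ^ ?d * 2 powr (- ?s * real ?d / 2) * ?S)"
    proof -
      have "1 \<le> R ^ u" using R_ge by simp
      then have "1 * (absint ^ ?d * 2 powr (- ?s * real ?d / 2) * ?S) \<le> R ^ u * (absint ^ ?d * 2 powr (- ?s * real ?d / 2) * ?S)"
        using S0 absint_nonneg by (intro mult_right_mono) auto
      then show ?thesis by simp
    qed
    also have "\<dots> = absint ^ ?d * R ^ u * 2 ^ (L * u) * 2 powr (- (?s * real ?d / 2) - ?s * real u) * ?S"
    proof -
      have "2 powr (- ?s * real ?d / 2) = (2 ^ (L * u) :: real) * 2 powr (- (?s * real ?d / 2) - ?s * real u)"
        using j by (simp add: powr_diff powr_realpow[symmetric])
      then show ?thesis by (simp only: ac_simps)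
    qed
    finally show ?thesis by (simp only: c)
  qed
qed


subsection \<open>The size of the wavelets in \<open>L\<^sub>\<alpha>\<close>\<close>

text \<open>The set where \<open>\<psi> g\<close> is nonzero is open and therefore lies in the
  interior of the period. The strict inequalities are what keeps integer translates
  disjoint.\<close>

lemma father_support:
  obtains a where "\<And>x. \<psi> g (2 ^ L * x) \<noteq> 0 \<Longrightarrow> a < x \<and> x < a + 1"
proof -
  obtain a where a: "\<And>x. \<psi> g (2 ^ L * x) \<noteq> 0 \<Longrightarrow> a \<le> x \<and> x \<le> a + 1"
    using fits unfolding fits_torus_def by blast
  let ?U = "{x. \<psi> g (2 ^ L * x) \<noteq> 0}"
  have "open ?U" by (intro open_Collect_neq continuous_intros)
  moreover have "?U \<subseteq> {a..a + 1}" using a by auto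
  ultimately have "?U \<subseteq> interior {a..a + 1}" by (intro interior_maximal)
  then have "?U \<subseteq> {a<..<a + 1}" by simp
  then have "\<psi> g (2 ^ L * x) \<noteq> 0 \<Longrightarrow> a < x \<and> x < a + 1" for x by auto
  then show ?thesis by (rule that)
qed

text \<open>Scale 0 fits into one period, and higher levels have smaller supports while the
  translates stay at integer distances.\<close>

lemma wavelet_translates_disjoint:
  fixes x :: "real^'d"
  assumes k: "wavelet L \<psi> j G m (x - int_vec k) \<noteq> 0" and l: "wavelet L \<psi> j G m (x - int_vec l) \<noteq> 0"
  shows "k = l"
proof -
  have "k $ b = l $ b" for b
  proof -
    obtain a where a: "\<And>x. \<psi> (G b) (2 ^ L * x) \<noteq> 0 \<Longrightarrow> a < x \<and> x < a + 1"
      using father_support[of "G b"] by blast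
    \<comment> \<open>The argument of \<open>\<psi>\<close> divided by 2^L:
      \<open>father_support\<close> confines it to an open interval of length 1, whereas passing
      from k to l moves it by an integer multiple of 2^j.\<close>
    define y where "y i = 2 ^ j * (x $ b - of_int (i $ b)) - of_int (m $ b) / 2 ^ L" for i :: "int^'d"
    have "a < y i \<and> y i < a + 1" if "wavelet L \<psi> j G m (x - int_vec i) \<noteq> 0" for i
    proof (rule a)
      have "atom j (G b) (m $ b) ((x - int_vec i) $ b) \<noteq> 0"
        using that unfolding wavelet_prod by (subst (asm) prod_zero_iff) auto
      moreover have "2 ^ L * y i = 2 ^ (j + L) * ((x - int_vec i) $ b) - of_int (m $ b)"
        by (simp add: y_def power_add field_simps)
      ultimately show "\<psi> (G b) (2 ^ L * y i) \<noteq> 0" by (simp add: atom_def)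
    qed
    from this[OF k] this[OF l] have "\<bar>y l - y k\<bar> < 1" by linarith
    moreover have "y l - y k = 2 ^ j * of_int (k $ b - l $ b)" by (simp add: y_def algebra_simps)
    ultimately have lt: "2 ^ j * \<bar>of_int (k $ b - l $ b) :: real\<bar> < 1" by (simp add: abs_mult del: of_int_diff)
    have "1 * \<bar>of_int (k $ b - l $ b) :: real\<bar> \<le> 2 ^ j * \<bar>of_int (k $ b - l $ b)\<bar>" by (intro mult_right_mono) auto
    from order_le_less_trans[OF this lt] have "\<bar>of_int (k $ b - l $ b) :: real\<bar> < 1" by simp
    then show ?thesis by linarith
  qed
  then show ?thesis by (simp add: vec_eq_iff)
qed

definition pow_int :: "real \<Rightarrow> real" where
  "pow_int \<alpha> = (\<Sum>g\<in>UNIV. \<integral>t. \<bar>\<psi> g t\<bar> powr \<alpha> \<partial>lborel)"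

lemma cont_powr: "0 < \<alpha> \<Longrightarrow> continuous_on S f \<Longrightarrow> continuous_on S (\<lambda>x. \<bar>f x\<bar> powr \<alpha>)" for f :: "'b::topological_space \<Rightarrow> real"
  by (intro continuous_on_powr' continuous_intros) auto

lemma atom_powr_integrable:
  assumes "0 < \<alpha>"
  shows "integrable lborel (\<lambda>t. \<bar>atom j g k t\<bar> powr \<alpha>)"
proof (rule integrable_continuous_compact_support[where S="{(of_int k-R)/2^(j+L)..(of_int k+R)/2^(j+L)}"])
  show "continuous_on UNIV (\<lambda>t. \<bar>atom j g k t\<bar> powr \<alpha>)"
    by (intro cont_powr assms continuous_intros)
  fix t assume "t \<notin> {(of_int k - R) / 2 ^ (j + L)..(of_int k + R) / 2 ^ (j + L)}"
  then show "\<bar>atom j g k t\<bar> powr \<alpha> = 0" unfolding atom_def by (subst outside) auto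
qed simp

text \<open>At each point at most one translate is nonzero, so the power \<alpha> of the
  periodization is the periodization of the power, also for \<alpha> < 1. Unfolding gives a product
  over the coordinates; in each, the normalization contributes 2^(s\<alpha>/2) and the dilation
  2^-s, where s = j + L.\<close>

lemma wavelet_Lalpha:
  assumes \<alpha>: "0 < \<alpha>"
  shows "(\<integral>x. \<bar>periodic_wavelet L \<psi> j G m (x :: real^'d)\<bar> powr \<alpha> \<partial>torus_measure)
    \<le> (2 powr (real (j + L) * (\<alpha> / 2 - 1)) * pow_int \<alpha>) ^ CARD('d)"
proof -
  let ?W = "wavelet L \<psi> j G m :: real^'d \<Rightarrow> real" and ?s = "real (j + L)"
  have eq: "\<bar>periodic_wavelet L \<psi> j G m x\<bar> powr \<alpha> = (\<Sum>\<^sub>\<infinity>k. \<bar>?W (x - int_vec k)\<bar> powr \<alpha>)" for x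
  proof (cases "\<exists>k. ?W (x - int_vec k) \<noteq> 0")
    case True
    then obtain l where l: "?W (x - int_vec l) \<noteq> 0" by blast
    have z: "?W (x - int_vec k) = 0" if "k \<noteq> l" for k
      using wavelet_translates_disjoint[OF _ l, of k] that by blast
    have "(\<Sum>\<^sub>\<infinity>k. ?W (x - int_vec k)) = (\<Sum>\<^sub>\<infinity>k\<in>{l}. ?W (x - int_vec k))"
      by (rule infsum_cong_neutral) (auto simp: z)
    moreover have "(\<Sum>\<^sub>\<infinity>k. \<bar>?W (x - int_vec k)\<bar> powr \<alpha>) = (\<Sum>\<^sub>\<infinity>k\<in>{l}. \<bar>?W (x - int_vec k)\<bar> powr \<alpha>)"
      by (rule infsum_cong_neutral) (auto simp: z)
    ultimately show ?thesis by (simp add: periodic_wavelet_eq)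
  qed (simp add: periodic_wavelet_eq)
  have W: "\<bar>?W x\<bar> powr \<alpha> = (\<Prod>a\<in>UNIV. \<bar>atom j (G a) (m $ a) (x $ a)\<bar> powr \<alpha>)" for x
    by (simp add: wavelet_prod abs_prod prod_powr_distrib)
  have i: "integrable lborel (\<lambda>x. \<bar>?W x\<bar> powr \<alpha>)"
    unfolding W by (intro integrable_product_vec atom_powr_integrable \<alpha>)
  have a: "(\<integral>t. \<bar>atom j g k t\<bar> powr \<alpha> \<partial>lborel) \<le> 2 powr (?s * (\<alpha> / 2 - 1)) * pow_int \<alpha>" for g k
  proof -
    have "(\<integral>t. \<bar>atom j g k t\<bar> powr \<alpha> \<partial>lborel) =
       (\<integral>t. (2 powr (?s / 2)) powr \<alpha> * \<bar>\<psi> g (2 ^ (j + L) * t + (- of_int k))\<bar> powr \<alpha> \<partial>lborel)"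
      by (simp add: atom_def abs_mult powr_mult)
    also have "\<dots> = (2 powr (?s / 2)) powr \<alpha> * ((\<integral>t. \<bar>\<psi> g t\<bar> powr \<alpha> \<partial>lborel) / 2 ^ (j + L))"
      by (simp only: integral_mult_right_zero) (subst integral_dilate[of _ "\<lambda>t. \<bar>\<psi> g t\<bar> powr \<alpha>"], auto)
    also have "\<dots> = 2 powr (?s * (\<alpha> / 2 - 1)) * (\<integral>t. \<bar>\<psi> g t\<bar> powr \<alpha> \<partial>lborel)"
    proof -
      have "?s / 2 * \<alpha> - ?s = ?s * (\<alpha> / 2 - 1)" by (simp add: field_simps)
      moreover have "(2 :: real) ^ (j + L) = 2 powr ?s" by (rule powr_realpow[symmetric]) simp
      ultimately have "(2 powr (?s / 2)) powr \<alpha> / 2 ^ (j + L) = (2 :: real) powr (?s * (\<alpha> / 2 - 1))"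
        by (simp only: powr_powr powr_diff[symmetric])
      then show ?thesis by (metis times_divide_eq_left times_divide_eq_right)
    qed
    also have "\<dots> \<le> 2 powr (?s * (\<alpha> / 2 - 1)) * pow_int \<alpha>"
      unfolding pow_int_def by (intro mult_left_mono member_le_sum) auto
    finally show ?thesis .
  qed
  have "(\<integral>x. \<bar>periodic_wavelet L \<psi> j G m x\<bar> powr \<alpha> \<partial>torus_measure) = (\<integral>x. \<bar>?W x\<bar> powr \<alpha> \<partial>lborel)"
    unfolding eq
    by (rule torus_unfold[OF i, where r="R + (\<Sum>b\<in>UNIV. real_of_int \<bar>m $ b\<bar>)"]) (simp add: wavelet_support)
  also have "\<dots> = (\<Prod>a\<in>UNIV. \<integral>t. \<bar>atom j (G a) (m $ a) t\<bar> powr \<alpha> \<partial>lborel)"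
    unfolding W using integral_product_vec[of "\<lambda>a t. \<bar>atom j (G a) (m $ a) t\<bar> powr \<alpha>"] by (simp add: atom_powr_integrable \<alpha>)
  also have "\<dots> \<le> (\<Prod>a\<in>(UNIV :: 'd set). 2 powr (?s * (\<alpha> / 2 - 1)) * pow_int \<alpha>)"
    by (intro prod_mono conjI a) auto
  finally show ?thesis by simp
qed

subsection \<open>Uniform convergence of the wavelet expansion\<close>

text \<open>The tensor product kernel of type G at scale s applied to \<phi>. For G constantly
  \<open>Father\<close> this is the projection onto the father space, otherwise onto one of the
  wavelet spaces.\<close>

definition level :: "nat \<Rightarrow> ('d::finite \<Rightarrow> gender) \<Rightarrow> (real^'d \<Rightarrow> real) \<Rightarrow> real^'d \<Rightarrow> real" where
  "level s G \<phi> x = (\<integral>y. (\<Prod>a\<in>UNIV. sker s (G a) (x $ a) (y $ a)) * \<phi> y \<partial>lborel)"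

lemma sker_prod_integrable:
  fixes x :: "real^'d" and \<phi> :: "real^'d \<Rightarrow> real"
  assumes "continuous_on UNIV \<phi>"
  shows "integrable lborel (\<lambda>y. (\<Prod>a\<in>UNIV. sker s (G a) (x $ a) (y $ a)) * \<phi> y)"
proof (rule integrable_continuous_compact_support)
  let ?l = "\<chi> a. x $ a - 2 * R / 2 ^ s" and ?u = "\<chi> a. x $ a + 2 * R / 2 ^ s"
  show "continuous_on UNIV (\<lambda>y. (\<Prod>a\<in>UNIV. sker s (G a) (x $ a) (y $ a)) * \<phi> y)"
    by (intro continuous_intros assms)
  show "compact (cbox ?l ?u)" by (rule compact_cbox)
  fix y assume "y \<notin> cbox ?l ?u"
  then obtain a where "\<not> (x $ a - 2 * R / 2 ^ s \<le> y $ a \<and> y $ a \<le> x $ a + 2 * R / 2 ^ s)"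
    by (auto simp: mem_box_cart)
  then have "2 * R / 2 ^ s < \<bar>y $ a - x $ a\<bar>" by linarith
  then have "sker s (G a) (x $ a) (y $ a) = 0" by (rule sker_outside)
  then have "(\<Prod>a\<in>UNIV. sker s (G a) (x $ a) (y $ a)) = 0" by (intro prod_zero) auto
  then show "(\<Prod>a\<in>UNIV. sker s (G a) (x $ a) (y $ a)) * \<phi> y = 0" by simp
qed

text \<open>On the whole space the kernel sums over all integer positions n, of which finitely many
  matter at x. Shifting n by N = 2^(j+L) shifts the wavelet by a lattice vector, which leaves its
  pairing with the periodic \<phi> unchanged. Hence all n in one residue class share the
  coefficient, and their values at x add up to the periodic wavelet.\<close>

lemma level_sum:
  fixes \<phi> :: "real^'d \<Rightarrow> real"
  assumes \<phi>: "continuous_on UNIV \<phi>" "periodic \<phi>"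
  shows "(\<Sum>m\<in>positions L j. coef j G m \<phi> * periodic_wavelet L \<psi> j G m x) = level (j + L) G \<phi> x"
proof -
  define N where "N = (2 :: int) ^ (j + L)"
  have N: "0 < N" by (simp add: N_def)
  let ?W = "\<lambda>m. wavelet L \<psi> j G m :: real^'d \<Rightarrow> real"
  define Z where "Z = {n :: int^'d. \<forall>a. n $ a \<in> {k. \<psi> (G a) (2 ^ (j + L) * x $ a - of_int k) \<noteq> 0}}"
  have finZ: "finite Z" unfolding Z_def by (intro finite_vec_PiE finite_shifts)
  have WZ: "?W n x = 0" if "n \<notin> Z" for n
  proof -
    obtain a where "atom j (G a) (n $ a) (x $ a) = 0" using \<open>n \<notin> Z\<close> by (auto simp: Z_def atom_def)
    then show ?thesis unfolding wavelet_prod by (intro prod_zero) auto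
  qed
  define sh where "sh m k = (\<chi> a. m $ a + N * k $ a)" for m k :: "int^'d"
  have W_sh: "?W m (y - int_vec k) = ?W (sh m k) y" for m k y
    by (simp add: wavelet_def sh_def N_def algebra_simps)
  define c where "c n = (\<integral>y. ?W n y * \<phi> y \<partial>lborel)" for n
  have c_sh: "c (sh m k) = c m" for m k
  proof -
    have "\<phi> (y - int_vec k) = \<phi> y" for y
      using periodic_int_vec[OF \<phi>(2), of "y - int_vec k" k] by simp
    then have "c (sh m k) = (\<integral>y. ?W m (y + (- int_vec k)) * \<phi> (y + (- int_vec k)) \<partial>lborel)"
      by (simp add: c_def W_sh)
    also have "\<dots> = c m" unfolding c_def
      by (rule integral_shift_vec[of "\<lambda>y. ?W m y * \<phi> y"])
         (intro borel_measurable_continuous_onI continuous_intros wavelet_continuous \<phi>)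
    finally show ?thesis .
  qed
  \<comment> \<open>Each n belongs to exactly one torus position, its residue modulo N in every
    coordinate.\<close>
  define md where "md n = (\<chi> a. n $ a mod N)" for n :: "int^'d"
  have md_sh: "sh (md n) (\<chi> a. n $ a div N) = n" for n
    by (simp add: sh_def md_def vec_eq_iff)
  have c_md: "c (md n) = c n" for n using c_sh[of "md n" "\<chi> a. n $ a div N"] md_sh by simp
  have per: "periodic_wavelet L \<psi> j G m x = (\<Sum>n | n \<in> Z \<and> md n = m. ?W n x)" if m: "m \<in> positions L j" for m
  proof -
    have mN: "0 \<le> m $ a" "m $ a < N" for a using m by (auto simp: positions_def N_def)
    have inj: "inj (sh m)" using N by (auto simp: inj_def sh_def vec_eq_iff)
    define K where "K = {k. sh m k \<in> Z}"
    have finK: "finite K" using finite_vimageI[OF finZ inj] by (simp add: K_def vimage_def)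
    have "periodic_wavelet L \<psi> j G m x = (\<Sum>\<^sub>\<infinity>k\<in>K. ?W (sh m k) x)"
      unfolding periodic_wavelet_eq W_sh by (rule infsum_cong_neutral) (auto simp: K_def WZ)
    also have "\<dots> = (\<Sum>k\<in>K. ?W (sh m k) x)" by (rule infsum_finite[OF finK])
    also have "\<dots> = (\<Sum>n\<in>sh m ` K. ?W n x)"
      by (simp add: sum.reindex inj_on_subset[OF inj])
    also have "sh m ` K = {n. n \<in> Z \<and> md n = m}"
    proof (safe)
      fix k assume "k \<in> K"
      then show "sh m k \<in> Z" by (simp add: K_def)
      show "md (sh m k) = m" using mN by (simp add: md_def sh_def vec_eq_iff)
    next
      fix n assume "n \<in> Z" "m = md n"
      then show "n \<in> sh (md n) ` K" using md_sh[of n] by (intro image_eqI[of _ _ "\<chi> a. n $ a div N"]) (auto simp: K_def)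
    qed
    finally show ?thesis .
  qed
  have "(\<Sum>m\<in>positions L j. coef j G m \<phi> * periodic_wavelet L \<psi> j G m x) =
     (\<Sum>m\<in>positions L j. \<Sum>n | n \<in> Z \<and> md n = m. c n * ?W n x)"
  proof (intro sum.cong refl)
    fix m :: "int^'d" assume m: "m \<in> positions L j"
    show "coef j G m \<phi> * periodic_wavelet L \<psi> j G m x = (\<Sum>n | n \<in> Z \<and> md n = m. c n * ?W n x)"
      using c_md by (auto simp: per[OF m] coef_eq[OF \<phi>] c_def[symmetric] sum_distrib_left intro!: sum.cong)
  qed
  also have "\<dots> = (\<Sum>n\<in>Z. c n * ?W n x)"
    by (rule sum.group[OF finZ finite_positions]) (use N in \<open>auto simp: md_def positions_def N_def\<close>)
  also have "\<dots> = (\<integral>y. (\<Sum>n\<in>Z. ?W n x * (?W n y * \<phi> y)) \<partial>lborel)"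
  proof (subst Bochner_Integration.integral_sum)
    show "integrable lborel (\<lambda>y. ?W n x * (?W n y * \<phi> y))" for n
      by (intro integrable_mult_right wavelet_integrable \<phi>)
  qed (simp only: c_def integral_mult_right_zero mult.commute[of "integral\<^sup>L _ _"])
  also have "\<dots> = level (j + L) G \<phi> x"
    unfolding level_def
  proof (intro Bochner_Integration.integral_cong refl)
    fix y
    have "(\<Sum>n\<in>Z. ?W n x * ?W n y) = (\<Sum>n\<in>Z. \<Prod>a\<in>UNIV. atom j (G a) (n $ a) (x $ a) * atom j (G a) (n $ a) (y $ a))"
      by (simp add: wavelet_prod prod.distrib)
    also have "\<dots> = (\<Prod>a\<in>UNIV. \<Sum>k | \<psi> (G a) (2 ^ (j + L) * x $ a - of_int k) \<noteq> 0. atom j (G a) k (x $ a) * atom j (G a) k (y $ a))"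
      unfolding Z_def by (rule prod_sum_vec) simp
    also have "\<dots> = (\<Prod>a\<in>UNIV. sker (j + L) (G a) (x $ a) (y $ a))"
    proof (intro prod.cong refl)
      fix a
      have "atom j (G a) k (x $ a) * atom j (G a) k (y $ a) =
        2 ^ (j + L) * (\<psi> (G a) (2 ^ (j + L) * x $ a - of_int k) * \<psi> (G a) (2 ^ (j + L) * y $ a - of_int k))" for k
        unfolding sqrt_scale[symmetric] atom_def by (simp only: ac_simps)
      then show "(\<Sum>k | \<psi> (G a) (2 ^ (j + L) * x $ a - of_int k) \<noteq> 0. atom j (G a) k (x $ a) * atom j (G a) k (y $ a)) = sker (j + L) (G a) (x $ a) (y $ a)"
        by (simp only: sker_def ker_def sum_distrib_left)
    qed
    finally show "(\<Sum>n\<in>Z. ?W n x * (?W n y * \<phi> y)) = (\<Prod>a\<in>UNIV. sker (j + L) (G a) (x $ a) (y $ a)) * \<phi> y"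
      by (simp only: sum_distrib_right[symmetric] mult.assoc[symmetric])
  qed
  finally show ?thesis .
qed

text \<open>Multiplying out the two-scale relation \<open>sker_Suc\<close> over the coordinates
  produces one summand for each choice of genders.\<close>

lemma level_sum_genders:
  fixes \<phi> :: "real^'d \<Rightarrow> real"
  assumes "continuous_on UNIV \<phi>"
  shows "(\<Sum>G\<in>UNIV. level s G \<phi> x) = level (Suc s) (\<lambda>_. Father) \<phi> x"
proof -
  have "finite (UNIV :: ('d \<Rightarrow> gender) set)" using finite_genders[of 0] by (simp add: genders_def)
  then have "(\<Sum>G\<in>UNIV. level s G \<phi> x) = (\<integral>y. (\<Sum>G\<in>UNIV. (\<Prod>a\<in>UNIV. sker s (G a) (x $ a) (y $ a)) * \<phi> y) \<partial>lborel)"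
    unfolding level_def
    by (intro Bochner_Integration.integral_sum[symmetric] sker_prod_integrable assms)
  also have "\<dots> = level (Suc s) (\<lambda>_. Father) \<phi> x"
    unfolding level_def by (simp add: sker_Suc sum_distrib_right[symmetric] prod_sum_genders[of "\<lambda>a g. sker s g (x $ a) (_ $ a)"])
  finally show ?thesis .
qed

text \<open>Telescopes, since the two-scale relation merges the wavelets of a level with the father space
  of the same level into the father space of the next one.\<close>

lemma partial_sum_level:
  fixes \<phi> :: "real^'d \<Rightarrow> real"
  assumes \<phi>: "continuous_on UNIV \<phi>" "periodic \<phi>"
  shows "(\<Sum>j<Suc J. \<Sum>G\<in>genders j. \<Sum>m\<in>positions L j. coef j G m \<phi> * periodic_wavelet L \<psi> j G m x)
    = level (Suc J + L) (\<lambda>_. Father) \<phi> x"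
  unfolding level_sum[OF \<phi>]
proof (induction J)
  case 0
  then show ?case by (simp add: genders_def level_sum_genders \<phi>)
next
  case (Suc J)
  have g: "genders (Suc J) = UNIV - {\<lambda>_ :: 'd. Father}"
    by (auto simp: genders_def fun_eq_iff) (metis gender.exhaust)
  have "(\<Sum>G\<in>genders (Suc J). level (Suc J + L) G \<phi> x) = (\<Sum>G\<in>UNIV. level (Suc J + L) G \<phi> x) - level (Suc J + L) (\<lambda>_. Father) \<phi> x"
    unfolding g using finite_genders[of 0, where 'd='d] by (subst sum_diff1) (auto simp: genders_def)
  then have "(\<Sum>G\<in>genders (Suc J). level (Suc J + L) G \<phi> x) = level (Suc (Suc J) + L) (\<lambda>_. Father) \<phi> x - level (Suc J + L) (\<lambda>_. Father) \<phi> x"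
    by (simp add: level_sum_genders \<phi>)
  then show ?case using Suc by simp
qed

text \<open>The kernel integrates to 1, so the error is an average of \<phi> y - \<phi> x over
  coordinate distances of at most 2R/2^s. The Lipschitz bound of \<phi> and the uniform L1 bound of
  the kernel give the rate.\<close>

lemma level_converges:
  fixes \<phi> :: "real^'d \<Rightarrow> real"
  assumes \<phi>: "\<phi> \<in> test_functions"
  shows "\<exists>E. \<forall>s x. \<bar>level s (\<lambda>_. Father) \<phi> x - \<phi> x\<bar> \<le> E / 2 ^ s"
proof -
  let ?d = "CARD('d)"
  define \<Lambda> where "\<Lambda> = real ?d * test_seminorm (Suc 0) \<phi>"
  have \<Lambda>: "0 \<le> \<Lambda>" by (simp add: \<Lambda>_def test_seminorm_nonneg[OF \<phi>])
  define C where "C = (2 * R + 1) * bound\<^sup>2 * (4 * R)"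
  have C: "0 \<le> C" using R_ge by (simp add: C_def)
  have lip: "\<bar>\<phi> y - \<phi> x\<bar> \<le> \<Lambda> * norm (y - x)" for x y
    using test_lipschitz[OF \<phi>, of "[]" 0 y x] by (simp add: \<Lambda>_def)
  have "\<bar>level s (\<lambda>_. Father) \<phi> x - \<phi> x\<bar> \<le> (\<Lambda> * (real ?d * (2 * R))) * C ^ ?d / 2 ^ s" for s x
  proof -
    let ?K = "\<lambda>y. \<Prod>a\<in>UNIV. sker s Father (x $ a) (y $ a)"
    define \<delta> where "\<delta> = \<Lambda> * (real ?d * (2 * R / 2 ^ s))"
    have iK: "integrable lborel ?K" by (intro integrable_product_vec sker_integrable)
    have iK\<phi>: "integrable lborel (\<lambda>y. ?K y * \<phi> y)"
      by (rule sker_prod_integrable) (rule test_continuous'[OF \<phi>])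
    have iA: "integrable lborel (\<lambda>y :: real^'d. \<Prod>a\<in>UNIV. \<bar>sker s Father (x $ a) (y $ a)\<bar>)"
      by (intro integrable_product_vec integrable_abs sker_integrable)
    have K1: "(\<integral>y. ?K y \<partial>lborel) = 1"
      by (simp add: integral_product_vec[OF sker_integrable] sker_integral)
    have "level s (\<lambda>_. Father) \<phi> x - \<phi> x = (\<integral>y. ?K y * \<phi> y \<partial>lborel) - (\<integral>y. ?K y \<partial>lborel) * \<phi> x"
      by (simp add: level_def K1)
    also have "\<dots> = (\<integral>y. ?K y * \<phi> y - ?K y * \<phi> x \<partial>lborel)"
      using iK iK\<phi> by simp
    also have "\<bar>\<dots>\<bar> \<le> (\<integral>y. (\<Prod>a\<in>UNIV. \<bar>sker s Father (x $ a) (y $ a)\<bar>) * \<delta> \<partial>lborel)"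
    proof (rule order_trans[OF integral_abs_bound integral_mono])
      show "integrable lborel (\<lambda>y. \<bar>?K y * \<phi> y - ?K y * \<phi> x\<bar>)"
        by (intro integrable_abs Bochner_Integration.integrable_diff iK\<phi> integrable_mult_left iK)
      show "integrable lborel (\<lambda>y :: real^'d. (\<Prod>a\<in>UNIV. \<bar>sker s Father (x $ a) (y $ a)\<bar>) * \<delta>)"
        by (intro integrable_mult_left iA)
      fix y :: "real^'d"
      show "\<bar>?K y * \<phi> y - ?K y * \<phi> x\<bar> \<le> (\<Prod>a\<in>UNIV. \<bar>sker s Father (x $ a) (y $ a)\<bar>) * \<delta>"
      proof (cases "?K y = 0")
        case False
        then have "\<bar>(y - x) $ a\<bar> \<le> 2 * R / 2 ^ s" for a
          using sker_outside[of s "y $ a" "x $ a" Father] by (auto simp: not_less[symmetric])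
        then have "norm (y - x) \<le> (\<Sum>a\<in>(UNIV :: 'd set). 2 * R / 2 ^ s)"
          by (intro order_trans[OF norm_le_l1_cart] sum_mono) auto
        then have "\<Lambda> * norm (y - x) \<le> \<delta>" unfolding \<delta>_def using \<Lambda> by (intro mult_left_mono) auto
        then have "\<bar>\<phi> y - \<phi> x\<bar> \<le> \<delta>" using lip[of y x] by linarith
        then have "\<bar>?K y\<bar> * \<bar>\<phi> y - \<phi> x\<bar> \<le> \<bar>?K y\<bar> * \<delta>" by (intro mult_left_mono) auto
        then show ?thesis by (simp only: abs_prod[symmetric] abs_mult[symmetric] right_diff_distrib[symmetric])
      next
        case True
        then have z: "(\<Prod>a\<in>UNIV. \<bar>sker s Father (x $ a) (y $ a)\<bar>) = 0" by (simp only: abs_prod[symmetric] abs_zero)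
        show ?thesis by (simp only: True z mult_zero_left diff_self abs_zero order_refl)
      qed
    qed
    also have "\<dots> = (\<Prod>a\<in>UNIV. \<integral>t. \<bar>sker s Father (x $ a) t\<bar> \<partial>lborel) * \<delta>"
      using integral_product_vec[of "\<lambda>a t. \<bar>sker s Father (x $ a) t\<bar>"] by (simp add: sker_integrable integrable_abs)
    also have "\<dots> \<le> (\<Prod>a\<in>(UNIV :: 'd set). C) * \<delta>"
      unfolding C_def using \<Lambda> R_ge by (intro mult_right_mono prod_mono conjI sker_abs_integral) (auto simp: \<delta>_def)
    also have "\<dots> = (\<Lambda> * (real ?d * (2 * R))) * C ^ ?d / 2 ^ s" by (simp add: \<delta>_def)
    finally show ?thesis .
  qed
  then show ?thesis by blast
qed

end

section \<open>Sequence spaces\<close>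

lemma enn2real_inverse_ennreal: "0 < P \<Longrightarrow> enn2real (1 / ennreal P) = 1 / P"
  by (metis divide_ennreal enn2real_ennreal ennreal_1 less_eq_real_def zero_le_divide_1_iff zero_le_one)

text \<open>The inclusion of l_r in l_P: no term exceeds D, so the power P of a term is at most its
  power r times D^(P-r).\<close>

lemma sum_powr_le:
  fixes a :: "'i \<Rightarrow> real"
  assumes "finite A" "\<And>i. i \<in> A \<Longrightarrow> 0 \<le> a i" "0 < r" "r \<le> P" "0 \<le> D"
    and le: "(\<Sum>i\<in>A. a i powr r) \<le> D powr r"
  shows "(\<Sum>i\<in>A. a i powr P) \<le> D powr P" "\<And>i. i \<in> A \<Longrightarrow> a i \<le> D"
proof -
  show *: "a i \<le> D" if "i \<in> A" for i
  proof -
    have "a i powr r \<le> (\<Sum>i\<in>A. a i powr r)" using assms that by (intro member_le_sum) auto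
    then have "a i powr r \<le> D powr r" using le by simp
    then show ?thesis using assms that by (meson not_less powr_less_mono2)
  qed
  have "(\<Sum>i\<in>A. a i powr P) \<le> (\<Sum>i\<in>A. a i powr r * D powr (P - r))"
  proof (intro sum_mono)
    fix i assume i: "i \<in> A"
    have "a i powr P = a i powr r * a i powr (P - r)" by (simp flip: powr_add)
    also have "\<dots> \<le> a i powr r * D powr (P - r)"
      using assms * i by (intro mult_left_mono powr_mono2) auto
    finally show "a i powr P \<le> a i powr r * D powr (P - r)" .
  qed
  also have "\<dots> = (\<Sum>i\<in>A. a i powr r) * D powr (P - r)" by (simp add: sum_distrib_right)
  also have "\<dots> \<le> D powr r * D powr (P - r)" using le by (intro mult_right_mono) auto
  finally show "(\<Sum>i\<in>A. a i powr P) \<le> D powr P" by (simp flip: powr_add)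
qed

lemma lp_norm_le:
  assumes "finite A" "A \<noteq> {}" "0 < r" "ennreal r \<le> p" "0 \<le> D"
    and le: "(\<Sum>i\<in>A. cmod (a i) powr r) \<le> D powr r"
  shows "lp_norm p A a \<le> D"
proof (cases p)
  case top
  then show ?thesis
    using assms sum_powr_le(2)[OF assms(1) _ assms(3) order_refl assms(5) le]
    by (auto simp: lp_norm_def infinity_ennreal_def intro!: cSUP_least)
next
  case (real P)
  then have P: "r \<le> P" "0 < P" using assms by auto
  have "(\<Sum>i\<in>A. cmod (a i) powr P) \<le> D powr P"
    by (rule sum_powr_le(1)[OF assms(1) _ assms(3) P(1) assms(5) le]) simp
  then have "(\<Sum>i\<in>A. cmod (a i) powr P) powr (1 / P) \<le> (D powr P) powr (1 / P)"
    using P by (intro powr_mono2) (auto intro!: sum_nonneg)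
  also have "\<dots> = D" using P assms by (simp add: powr_powr)
  finally show ?thesis using real P by (simp add: lp_norm_def enn2real_inverse_ennreal infinity_ennreal_def)
qed

text \<open>For \<open>r > 1\<close> this is Hoelder's inequality up to a factor 2, proved by splitting at a threshold \<open>\<delta>\<close>.\<close>

lemma sum_le_of_sum_powr:
  fixes a :: "'i \<Rightarrow> real"
  assumes "finite A" and a: "\<And>i. i \<in> A \<Longrightarrow> 0 \<le> a i" and "0 < r" "0 \<le> D"
    and n: "real (card A) \<le> n" "1 \<le> n" and le: "(\<Sum>i\<in>A. a i powr r) \<le> D powr r"
  shows "(\<Sum>i\<in>A. a i) \<le> 2 * D * n powr (max 0 (1 - 1 / r))"
proof (cases "r \<le> 1")
  case True
  have "(\<Sum>i\<in>A. a i powr 1) \<le> D powr 1"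
    by (rule sum_powr_le(1)[OF assms(1) a assms(3) True assms(4) le])
  moreover have "(\<Sum>i\<in>A. a i powr 1) = (\<Sum>i\<in>A. a i)" using a by (intro sum.cong) auto
  moreover have "max 0 (1 - 1 / r) = 0" using True assms(3) by (simp add: field_simps)
  ultimately show ?thesis using assms by simp
next
  case False
  show ?thesis
  proof (cases "D = 0")
    case True
    then have "a i = 0" if "i \<in> A" for i
      using sum_powr_le(2)[OF assms(1) a assms(3) order_refl assms(4) le that] a[OF that] by simp
    then show ?thesis using True by simp
  next
    case D: False
    \<comment> \<open>Balances the two parts: terms below \<delta> add up to at most n \<delta>, and
      larger ones to at most \<delta>^(1-r) D^r, which equals n \<delta>.\<close>
    define \<delta> where "\<delta> = D * n powr (- 1 / r)"
    have \<delta>: "0 < \<delta>" using D assms by (simp add: \<delta>_def)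
    have "a i \<le> \<delta> + \<delta> powr (1 - r) * a i powr r" if i: "i \<in> A" for i
    proof (cases "a i \<le> \<delta>")
      case True
      then show ?thesis by (simp add: add_increasing2)
    next
      case gt: False
      have "a i = a i powr r * a i powr (1 - r)" using gt \<delta> by (simp flip: powr_add)
      also have "\<dots> \<le> a i powr r * \<delta> powr (1 - r)"
        using gt \<delta> False by (intro mult_left_mono powr_mono2') auto
      finally show ?thesis using \<delta> by (simp add: mult.commute add_increasing)
    qed
    then have "(\<Sum>i\<in>A. a i) \<le> (\<Sum>i\<in>A. \<delta> + \<delta> powr (1 - r) * a i powr r)" by (intro sum_mono) auto
    also have "\<dots> = real (card A) * \<delta> + \<delta> powr (1 - r) * (\<Sum>i\<in>A. a i powr r)"
      by (simp add: sum.distrib sum_distrib_left)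
    also have "\<dots> \<le> n * \<delta> + \<delta> powr (1 - r) * D powr r"
      using n \<delta> le by (intro add_mono mult_right_mono mult_left_mono) auto
    also have "\<delta> powr (1 - r) * D powr r = n * \<delta>"
    proof -
      have "D powr r = (\<delta> * n powr (1 / r)) powr r"
        using n by (simp add: \<delta>_def powr_minus mult.assoc)
      also have "\<dots> = \<delta> powr r * n" using n assms(3) by (simp add: powr_mult powr_powr)
      finally have "\<delta> powr (1 - r) * D powr r = (\<delta> powr (1 - r) * \<delta> powr r) * n" by simp
      then show ?thesis using \<delta> by (simp flip: powr_add)
    qed
    also have "n * \<delta> + n * \<delta> = 2 * D * n powr (1 - 1 / r)"
      using n by (simp add: \<delta>_def powr_diff powr_minus field_simps)
    also have "1 - 1 / r = max 0 (1 - 1 / r)" using False by simp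
    finally show ?thesis .
  qed
qed

lemma card_genders_le: "card (genders j :: ('d::finite \<Rightarrow> gender) set) \<le> card (UNIV :: ('d \<Rightarrow> gender) set)"
  using finite_genders[of 0, where 'd='d] by (intro card_mono) (auto simp: genders_def)

lemma card_positions_le: "real (card (positions L j :: (int^'d) set)) \<le> 2 powr (real (j + L) * real CARD('d))"
proof -
  have "positions L j \<subseteq> vec_lambda ` Pi\<^sub>E (UNIV :: 'd set) (\<lambda>_. {0..<(2 :: int) ^ (j + L)})"
  proof
    fix m :: "int^'d" assume "m \<in> positions L j"
    then have "m = vec_lambda (vec_nth m)" "vec_nth m \<in> Pi\<^sub>E UNIV (\<lambda>_. {0..<2 ^ (j + L)})"
      by (auto simp: positions_def vec_nth_inverse)
    then show "m \<in> vec_lambda ` Pi\<^sub>E UNIV (\<lambda>_. {0..<2 ^ (j + L)})" by blast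
  qed
  moreover have fin: "finite (Pi\<^sub>E (UNIV :: 'd set) (\<lambda>_. {0..<(2 :: int) ^ (j + L)}))"
    by (intro finite_PiE) auto
  ultimately have "card (positions L j :: (int^'d) set) \<le> card (Pi\<^sub>E (UNIV :: 'd set) (\<lambda>_. {0..<(2 :: int) ^ (j + L)}))"
    by (meson card_image_le card_mono finite_imageI order_trans)
  also have "\<dots> = (2 ^ (j + L)) ^ CARD('d)" by (simp add: card_PiE nat_power_eq)
  finally have "real (card (positions L j :: (int^'d) set)) \<le> real ((2 ^ (j + L)) ^ CARD('d))" by linarith
  also have "\<dots> = 2 powr (real (j + L) * real CARD('d))"
    by (simp add: powr_realpow[symmetric] powr_powr)
  finally show ?thesis .
qed

lemma positions_nonempty: "positions L j \<noteq> {}"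
proof -
  have "(\<chi> a. 0) \<in> positions L j" by (simp add: positions_def)
  then show ?thesis by blast
qed

text \<open>The l_r bound controls the l_p norm on each level since r \<le> p. Against the Besov
  weight the growth rate \<beta> leaves a geometric sequence of ratio less than 1, which lies in l_q
  for every q.\<close>

lemma besov_seq_membership:
  fixes lam :: "nat \<Rightarrow> ('d::finite \<Rightarrow> gender) \<Rightarrow> int^'d \<Rightarrow> complex"
  assumes "0 < r" "ennreal r \<le> p" "0 < q" "0 \<le> C" "\<beta> + \<tau> - real CARD('d) * enn2real (1 / p) < 0"
    and le: "\<And>j G. G \<in> genders j \<Longrightarrow> (\<Sum>m\<in>positions L j. cmod (lam j G m) powr r) \<le> (C * 2 powr (real j * \<beta>)) powr r"
  shows "lam \<in> besov_seq L p q \<tau>"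
proof -
  define s where "s = \<tau> - real CARD('d) * enn2real (1 / p)"
  have s: "s + \<beta> < 0" using assms by (simp add: s_def)
  have lp: "lp_norm p (positions L j) (lam j G) \<le> C * 2 powr (real j * \<beta>)" if "G \<in> genders j" for j G
    by (rule lp_norm_le[OF finite_positions positions_nonempty assms(1,2)]) (use assms le that in auto)
  have lp0: "0 \<le> lp_norm p (positions L j) (lam j G)" for j G
  proof (cases "p = \<infinity>")
    case True
    have "bdd_above ((\<lambda>m. cmod (lam j G m)) ` positions L j)" by (intro bdd_above_finite finite_imageI finite_positions)
    moreover obtain m :: "int^'d" where "m \<in> positions L j" using positions_nonempty by blast
    ultimately have "cmod (lam j G m) \<le> (SUP m\<in>positions L j. cmod (lam j G m))" by (intro cSUP_upper)
    then show ?thesis using True by (simp add: lp_norm_def) (meson norm_ge_zero order_trans)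
  qed (simp add: lp_norm_def)
  have pw: "2 powr (real j * s) * (C * 2 powr (real j * \<beta>)) = C * (2 powr (s + \<beta>)) ^ j" for j
    by (simp add: powr_realpow[symmetric] powr_powr powr_add[symmetric] algebra_simps)
  have q1: "0 < 2 powr (s + \<beta>)" "2 powr (s + \<beta>) < 1" using s by (auto simp: powr_less_one)
  have "besov_seq_norm L p q \<tau> lam < \<infinity>"
  proof (cases "q = \<infinity>")
    case True
    have "(SUP j. SUP G\<in>genders j. ennreal (2 powr (real j * s) * lp_norm p (positions L j) (lam j G))) \<le> ennreal C"
    proof (intro SUP_least ennreal_leI)
      fix j :: nat and G :: "'d \<Rightarrow> gender" assume "G \<in> genders j"
      then have "2 powr (real j * s) * lp_norm p (positions L j) (lam j G) \<le> C * (2 powr (s + \<beta>)) ^ j"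
        unfolding pw[symmetric] by (intro mult_left_mono lp) auto
      also have "\<dots> \<le> C * 1" using q1 assms by (intro mult_left_mono power_le_one) auto
      finally show "2 powr (real j * s) * lp_norm p (positions L j) (lam j G) \<le> C" by simp
    qed
    then show ?thesis using True by (simp add: besov_seq_norm_def s_def[symmetric] Let_def le_less_trans)
  next
    case False
    define Q where "Q = enn2real q"
    have Q: "0 < Q" using False assms(3) by (auto simp: Q_def enn2real_positive_iff infinity_ennreal_def top.not_eq_extremum)
    define x where "x = (2 powr (s + \<beta>)) powr Q"
    have x: "0 < x" "x < 1" using q1 Q powr_less_mono2[of Q "2 powr (s + \<beta>)" 1] by (auto simp: x_def)
    let ?cg = "real (card (UNIV :: ('d \<Rightarrow> gender) set))"
    have trm: "2 powr (real j * s * Q) * (\<Sum>G\<in>genders j. lp_norm p (positions L j) (lam j G) powr Q) \<le> (?cg * C powr Q) * x ^ j" for j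
    proof -
      have "(\<Sum>G\<in>genders j. lp_norm p (positions L j) (lam j G) powr Q) \<le> real (card (genders j :: ('d \<Rightarrow> gender) set)) * (C * 2 powr (real j * \<beta>)) powr Q"
        by (rule sum_bounded_above) (use lp lp0 Q in \<open>auto intro!: powr_mono2\<close>)
      also have "\<dots> \<le> ?cg * (C * 2 powr (real j * \<beta>)) powr Q"
        using card_genders_le[of j, where 'd='d] by (intro mult_right_mono) auto
      finally have "2 powr (real j * s * Q) * (\<Sum>G\<in>genders j. lp_norm p (positions L j) (lam j G) powr Q)
         \<le> 2 powr (real j * s * Q) * (?cg * (C * 2 powr (real j * \<beta>)) powr Q)" by (intro mult_left_mono) auto
      also have "\<dots> = ?cg * (2 powr (real j * s) * (C * 2 powr (real j * \<beta>))) powr Q"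
        using assms(4) by (simp add: powr_mult powr_powr)
      also have "\<dots> = (?cg * C powr Q) * x ^ j"
        unfolding pw using assms(4) by (simp add: powr_mult x_def powr_powr powr_realpow[symmetric] ac_simps)
      finally show ?thesis .
    qed
    have "(\<Sum>j. ennreal (2 powr (real j * s * Q) * (\<Sum>G\<in>genders j. lp_norm p (positions L j) (lam j G) powr Q))) \<le> (\<Sum>j. ennreal ((?cg * C powr Q) * x ^ j))"
      by (intro suminf_le ennreal_leI trm) auto
    also have "\<dots> = ennreal (\<Sum>j. (?cg * C powr Q) * x ^ j)"
      by (rule suminf_ennreal2) (use x in \<open>auto intro!: summable_mult summable_geometric\<close>)
    also have "\<dots> < \<infinity>" by simp
    finally have "(\<Sum>j. ennreal (2 powr (real j * s * Q) * (\<Sum>G\<in>genders j. lp_norm p (positions L j) (lam j G) powr Q))) \<noteq> \<infinity>" by simp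
    then show ?thesis using False by (simp add: besov_seq_norm_def s_def[symmetric] Q_def[symmetric] Let_def ennreal_powr_def)
  qed
  then show ?thesis by (simp add: besov_seq_def)
qed

section \<open>The wavelet expansion of the noise\<close>

type_synonym 'd index = "nat \<times> ('d \<Rightarrow> gender) \<times> (int^'d)"

locale noise_wavelets = noise \<alpha> \<gamma> P w + torus_wavelets u \<psi> R L
  for \<alpha> \<gamma> :: real and P :: "'a measure" and w :: "'a \<Rightarrow> (real^'d \<Rightarrow> real) \<Rightarrow> real" and u \<psi> R L
begin

definition block :: "nat \<Rightarrow> (('d \<Rightarrow> gender) \<times> (int^'d)) set" where
  "block j = genders j \<times> positions L j"

definition idx :: "'d index set" where "idx = Sigma UNIV block"

definition idx_below :: "nat \<Rightarrow> 'd index set" where "idx_below J = Sigma {..<J} block"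

definition PW :: "'d index \<Rightarrow> real^'d \<Rightarrow> real" where
  "PW = (\<lambda>(j, G, m). periodic_wavelet L \<psi> j G m)"

definition co :: "'d index \<Rightarrow> (real^'d \<Rightarrow> real) \<Rightarrow> real" where
  "co = (\<lambda>(j, G, m). coef j G m)"

lemma finite_block: "finite (block j)"
  by (simp add: block_def finite_genders finite_positions)

lemma finite_idx_below: "finite (idx_below J)"
  by (simp add: idx_below_def finite_block)

lemma idx_below_subset: "idx_below J \<subseteq> idx"
  by (auto simp: idx_below_def idx_def)

lemma countable_idx: "countable idx"
  unfolding idx_def by (rule countable_SIGMA) (auto intro: countable_finite finite_block)

lemma sum_idx_below: "(\<Sum>i\<in>idx_below J. f i) = (\<Sum>j<J. \<Sum>x\<in>block j. f (j, x))"
  using sum.Sigma[of "{..<J}" block "\<lambda>j x. f (j, x)"] by (simp add: idx_below_def finite_block case_prod_eta)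

lemma sum_block: "(\<Sum>x\<in>block j. f x) = (\<Sum>G\<in>genders j. \<Sum>m\<in>positions L j. f (G, m))"
  by (simp add: block_def sum.cartesian_product case_prod_eta)

lemma card_block: "real (card (block j)) \<le> real (card (UNIV :: ('d \<Rightarrow> gender) set)) * 2 powr (real (j + L) * real CARD('d))"
  unfolding block_def card_cartesian_product of_nat_mult
  by (intro mult_mono of_nat_mono card_genders_le card_positions_le) auto

lemma PW_continuous: "continuous_on UNIV (PW i)" and PW_periodic: "periodic (PW i)"
  by (cases i; simp add: PW_def periodic_wavelet_continuous periodic_wavelet_periodic)+

definition approx :: "'d index \<Rightarrow> nat \<Rightarrow> real^'d \<Rightarrow> real" where
  "approx i n = (SOME \<phi>. \<phi> \<in> test_functions \<and> (\<forall>x. \<bar>PW i x - \<phi> x\<bar> < 1 / 2 ^ n))"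

lemma approx: "approx i n \<in> test_functions" "\<bar>approx i n x - PW i x\<bar> \<le> 1 / 2 ^ n"
proof -
  have "\<exists>\<phi>. \<phi> \<in> test_functions \<and> (\<forall>x. \<bar>PW i x - \<phi> x\<bar> < 1 / 2 ^ n)"
    using test_uniformly_dense[OF PW_continuous PW_periodic, of "1 / 2 ^ n" i] by auto
  from someI_ex[OF this, folded approx_def]
  show "approx i n \<in> test_functions" "\<bar>approx i n x - PW i x\<bar> \<le> 1 / 2 ^ n"
    by (auto simp: abs_minus_commute less_imp_le)
qed

text \<open>Stands for the pairing of the noise with the periodic wavelet of index i, which need not
  be a test function. Off a null set the limit exists; elsewhere \<open>lim\<close> returns some
  value, still measurably in \<omega>.\<close>

definition X :: "'d index \<Rightarrow> 'a \<Rightarrow> real" where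
  "X i \<omega> = lim (\<lambda>n. w \<omega> (approx i n))"

lemma X_measurable [measurable]: "X i \<in> borel_measurable P"
proof -
  have "(\<lambda>\<omega>. w \<omega> (approx i n)) \<in> borel_measurable P" for n by (intro w_meas approx)
  then show ?thesis unfolding X_def[abs_def] by (rule borel_measurable_lim_metric)
qed

lemma X_lim: "AE \<omega> in P. (\<lambda>n. w \<omega> (approx i n)) \<longlonglongrightarrow> X i \<omega>"
  using AE_convergent[of "approx i" "PW i", OF approx]
  by eventually_elim (simp add: X_def convergent_LIMSEQ_iff)

text \<open>Upper bound for the L_\<alpha> norm of the wavelets of level j, from
  \<open>wavelet_Lalpha\<close>. Adding 1 to \<open>pow_int \<alpha>\<close> makes it positive and
  strict, as \<open>limit_moment\<close> requires.\<close>

definition \<sigma> where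
  "\<sigma> j = 2 powr (real (j + L) * real CARD('d) * (1 / 2 - 1 / \<alpha>)) * ((pow_int \<alpha> + 1) ^ CARD('d)) powr (1 / \<alpha>)"

lemma pow_int_nonneg: "0 \<le> pow_int \<alpha>"
  unfolding pow_int_def by (intro sum_nonneg) auto

lemma \<sigma>: "0 < \<sigma> j" "(\<integral>x. \<bar>PW (j, G, m) x\<bar> powr \<alpha> \<partial>torus_measure) < \<sigma> j powr \<alpha>"
proof -
  let ?d = "CARD('d)" and ?s = "real (j + L)"
  show "0 < \<sigma> j" using pow_int_nonneg by (simp add: \<sigma>_def)
  have "(\<integral>x. \<bar>PW (j, G, m) x\<bar> powr \<alpha> \<partial>torus_measure) \<le> (2 powr (?s * (\<alpha> / 2 - 1)) * pow_int \<alpha>) ^ ?d"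
    using wavelet_Lalpha[OF \<alpha>(1)] by (simp add: PW_def)
  also have "\<dots> < (2 powr (?s * (\<alpha> / 2 - 1)) * (pow_int \<alpha> + 1)) ^ ?d"
    using pow_int_nonneg by (intro power_strict_mono mult_strict_left_mono) auto
  also have "\<dots> = \<sigma> j powr \<alpha>"
  proof -
    have "(2 powr (?s * (\<alpha> / 2 - 1))) ^ ?d = 2 powr (?s * real ?d * (1 / 2 - 1 / \<alpha>) * \<alpha>)"
    proof -
      have "(1 / 2 - 1 / \<alpha>) * \<alpha> = \<alpha> / 2 - 1" using \<alpha>(1) by (simp add: left_diff_distrib)
      then have "?s * real ?d * (1 / 2 - 1 / \<alpha>) * \<alpha> = ?s * (\<alpha> / 2 - 1) * real ?d"
        by (simp only: mult.assoc) (simp only: mult.commute)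
      then show ?thesis by (simp only: powr_realpow[symmetric] powr_powr powr_gt_zero zero_less_numeral simp_thms)
    qed
    then show ?thesis
      using \<alpha>(1) pow_int_nonneg by (simp add: \<sigma>_def powr_mult powr_powr power_mult_distrib)
  qed
  finally show "(\<integral>x. \<bar>PW (j, G, m) x\<bar> powr \<alpha> \<partial>torus_measure) < \<sigma> j powr \<alpha>" .
qed

lemma X_moment:
  assumes r: "0 < r" "r < \<alpha> \<or> \<alpha> = 2"
  shows "(\<integral>\<^sup>+\<omega>. ennreal (\<bar>X (j, x) \<omega>\<bar> powr r) \<partial>P) \<le> ennreal (moment_const r * \<sigma> j powr r)"
proof -
  obtain G m where x: "x = (G, m)" by (cases x)
  have "bdd_above (range (\<lambda>y. \<bar>PW (j, x) y\<bar>))" by (intro periodic_bounded PW_continuous PW_periodic)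
  then obtain B where B: "\<And>y. \<bar>PW (j, x) y\<bar> \<le> B" by (auto simp: bdd_above_def)
  show ?thesis
    by (rule limit_moment[OF r approx(1) _ B approx(2) X_lim \<sigma>(1)])
       (use \<sigma>(2) in \<open>auto simp: x intro: borel_measurable_continuous_onI PW_continuous\<close>)
qed

text \<open>With s = j + L, the expected r-th power of a coefficient in Besov normalization is of
  order 2^(sdr(1-1/\<alpha>)), and a level has of order 2^(sd) of them. The expected sum is thus of
  order 2^(sr\<rho>) with \<rho> = d(1/r+1-1/\<alpha>), and the weight 2^(-jr\<beta>) makes it
  summable for \<beta> > \<rho>.\<close>

lemma coefficient_growth:
  assumes r: "0 < r" "r < \<alpha> \<or> \<alpha> = 2" and \<beta>: "real CARD('d) * (1 / r + 1 - 1 / \<alpha>) < \<beta>"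
  shows "AE \<omega> in P. \<exists>C\<ge>0. \<forall>j. (\<Sum>x\<in>block j. \<bar>2 powr (real (j + L) * real CARD('d) / 2) * X (j, x) \<omega>\<bar> powr r) \<le> (C * 2 powr (real j * \<beta>)) powr r"
proof -
  let ?d = "real CARD('d)" and ?cg = "real (card (UNIV :: ('d \<Rightarrow> gender) set))"
  define B where "B = ((pow_int \<alpha> + 1) ^ CARD('d)) powr (1 / \<alpha>)"
  define \<rho> where "\<rho> = ?d * (1 / r + 1 - 1 / \<alpha>)"
  define A where "A = ?cg * moment_const r * B powr r * 2 powr (real L * (r * \<rho>))"
  define q where "q = 2 powr (r * (\<rho> - \<beta>))"
  have K: "0 \<le> moment_const r" by (rule moment(1)[OF r])
  have B: "0 \<le> B" by (simp add: B_def)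
  have q: "0 < q" "q < 1" using r(1) \<beta> by (auto simp: q_def \<rho>_def powr_less_one mult_pos_neg)
  define f where "f j \<omega> = 2 powr (- (real j * \<beta> * r)) * (\<Sum>x\<in>block j. \<bar>2 powr (real (j + L) * ?d / 2) * X (j, x) \<omega>\<bar> powr r)" for j \<omega>
  have "AE \<omega> in P. \<exists>C\<ge>0. \<forall>j. f j \<omega> \<le> C"
  proof (rule AE_bounded_if_sum_finite)
    show "f j \<in> borel_measurable P" for j unfolding f_def[abs_def] by measurable
    show "summable (\<lambda>j. A * q ^ j)" using q by (intro summable_mult summable_geometric) auto
    show "0 \<le> A * q ^ j" for j using q K by (simp add: A_def)
    fix j
    let ?s = "real (j + L)"
    let ?c = "2 powr (- (real j * \<beta> * r)) * 2 powr (?s * ?d / 2 * r)"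
    have "(\<integral>\<^sup>+\<omega>. ennreal (f j \<omega>) \<partial>P) = (\<integral>\<^sup>+\<omega>. (\<Sum>x\<in>block j. ennreal ?c * ennreal (\<bar>X (j, x) \<omega>\<bar> powr r)) \<partial>P)"
    proof (intro nn_integral_cong)
      fix \<omega>
      have "f j \<omega> = (\<Sum>x\<in>block j. ?c * \<bar>X (j, x) \<omega>\<bar> powr r)"
        unfolding f_def sum_distrib_left by (intro sum.cong refl) (simp add: abs_mult powr_mult powr_powr)
      then show "ennreal (f j \<omega>) = (\<Sum>x\<in>block j. ennreal ?c * ennreal (\<bar>X (j, x) \<omega>\<bar> powr r))"
        by (simp only: ennreal_mult'[symmetric] sum_ennreal mult_nonneg_nonneg powr_ge_zero)
    qed
    also have "\<dots> = (\<Sum>x\<in>block j. ennreal ?c * (\<integral>\<^sup>+\<omega>. ennreal (\<bar>X (j, x) \<omega>\<bar> powr r) \<partial>P))"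
      by (subst nn_integral_sum) (auto simp: nn_integral_cmult)
    also have "\<dots> \<le> (\<Sum>x\<in>block j. ennreal ?c * ennreal (moment_const r * \<sigma> j powr r))"
      by (intro sum_mono mult_left_mono X_moment r) auto
    also have "\<dots> = ennreal (real (card (block j))) * (ennreal ?c * ennreal (moment_const r * \<sigma> j powr r))"
      by (simp add: ennreal_of_nat_eq_real_of_nat)
    also have "\<dots> = ennreal (real (card (block j)) * (?c * (moment_const r * \<sigma> j powr r)))"
      using K by (simp only: ennreal_mult[symmetric] of_nat_0_le_iff mult_nonneg_nonneg powr_ge_zero)
    also have "\<dots> \<le> ennreal (A * q ^ j)"
    proof (rule ennreal_leI)
      have sig: "\<sigma> j powr r = 2 powr (?s * ?d * (1 / 2 - 1 / \<alpha>) * r) * B powr r"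
        by (simp add: \<sigma>_def B_def powr_mult powr_powr)
      have "real (card (block j)) * (?c * (moment_const r * \<sigma> j powr r)) \<le>
        (?cg * 2 powr (?s * ?d)) * (?c * (moment_const r * \<sigma> j powr r))"
        using K by (intro mult_right_mono card_block) auto
      also have "\<dots> = ?cg * moment_const r * B powr r * (2 powr (?s * ?d) * (2 powr (- (real j * \<beta> * r)) * 2 powr (?s * ?d / 2 * r)) * 2 powr (?s * ?d * (1 / 2 - 1 / \<alpha>) * r))"
        unfolding sig by (simp only: ac_simps)
      also have "2 powr (?s * ?d) * (2 powr (- (real j * \<beta> * r)) * 2 powr (?s * ?d / 2 * r)) * 2 powr (?s * ?d * (1 / 2 - 1 / \<alpha>) * r)
        = 2 powr (real L * (r * \<rho>)) * q ^ j"
      proof -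
        have "r * \<rho> = ?d + ?d * r * (1 - 1 / \<alpha>)" using r(1) by (simp add: \<rho>_def field_simps)
        moreover have "s * d + (- b + s * d / 2 * r) + s * d * (1 / 2 - a) * r = s * (d + d * r * (1 - a)) - b" for s d b a :: real
          by (simp add: field_simps)
        ultimately have "?s * ?d + (- (real j * \<beta> * r) + ?s * ?d / 2 * r) + ?s * ?d * (1 / 2 - 1 / \<alpha>) * r = ?s * (r * \<rho>) - real j * \<beta> * r"
          by (simp only:)
        also have "\<dots> = real L * (r * \<rho>) + real j * (r * (\<rho> - \<beta>))" by (simp add: algebra_simps)
        finally show ?thesis
          unfolding q_def by (simp only: powr_add[symmetric]) (simp add: powr_add powr_realpow[symmetric] powr_powr mult.commute)
      qed
      finally show "real (card (block j)) * (?c * (moment_const r * \<sigma> j powr r)) \<le> A * q ^ j"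
        by (simp only: A_def mult.assoc)
    qed
    finally show "(\<integral>\<^sup>+\<omega>. ennreal (f j \<omega>) \<partial>P) \<le> ennreal (A * q ^ j)" .
  qed
  then show ?thesis
  proof eventually_elim
    case (elim \<omega>)
    then obtain C where C: "C \<ge> 0" "\<And>j. f j \<omega> \<le> C" by blast
    show ?case
    proof (intro exI[of _ "C powr (1 / r)"] conjI allI)
      fix j
      have "2 powr (real j * \<beta> * r) * f j \<omega> \<le> 2 powr (real j * \<beta> * r) * C" by (intro mult_left_mono C) auto
      moreover have "2 powr (real j * \<beta> * r) * f j \<omega> = (\<Sum>x\<in>block j. \<bar>2 powr (real (j + L) * ?d / 2) * X (j, x) \<omega>\<bar> powr r)"
        by (simp add: f_def powr_minus)
      moreover have "(C powr (1 / r) * 2 powr (real j * \<beta>)) powr r = 2 powr (real j * \<beta> * r) * C"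
        using C r(1) by (simp add: powr_mult powr_powr)
      ultimately show "(\<Sum>x\<in>block j. \<bar>2 powr (real (j + L) * ?d / 2) * X (j, x) \<omega>\<bar> powr r) \<le> (C powr (1 / r) * 2 powr (real j * \<beta>)) powr r"
        by simp
    qed simp
  qed
qed

definition partial :: "nat \<Rightarrow> (real^'d \<Rightarrow> real) \<Rightarrow> 'a \<Rightarrow> real" where
  "partial J \<phi> \<omega> = (\<Sum>i\<in>idx_below J. co i \<phi> * X i \<omega>)"

text \<open>The remainder of the wavelet expansion of \<phi> is uniformly of order 2^-J, so the
  moments of order r = \<alpha>/2 of its pairing with the noise decay like 2^(-Jr). As in
  \<open>AE_convergent\<close>, half of this decay is traded for an almost sure rate. The
  exceptional null set still depends on \<phi>.\<close>

lemma partial_converges: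
  assumes \<phi>: "\<phi> \<in> test_functions"
  shows "AE \<omega> in P. (\<lambda>J. partial (Suc J) \<phi> \<omega>) \<longlonglongrightarrow> w \<omega> \<phi>"
proof -
  define r where "r = \<alpha> / 2"
  have r: "0 < r" "r < \<alpha> \<or> \<alpha> = 2" using \<alpha> by (auto simp: r_def)
  let ?K = "moment_const r"
  have K: "0 \<le> ?K" by (rule moment(1)[OF r])
  note \<phi>c = test_continuous'[OF \<phi>, of UNIV] and \<phi>p = test_periodic[OF \<phi>]
  obtain E where E: "\<And>s x. \<bar>level s (\<lambda>_. Father) \<phi> x - \<phi> x\<bar> \<le> E / 2 ^ s"
    using level_converges[OF \<phi>] by blast
  have E0: "0 \<le> E" using order_trans[OF abs_ge_zero E[of 0 undefined]] by simp
  define q where "q = 2 powr (- r / 2)"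
  have q: "0 < q" "q < 1" using r(1) by (auto simp: q_def powr_less_one)
  define g where "g J x = \<phi> x - (\<Sum>i\<in>idx_below (Suc J). co i \<phi> * PW i x)" for J x
  have g_le: "\<bar>g J x\<bar> \<le> E / 2 ^ J" for J x
  proof -
    have "(\<Sum>i\<in>idx_below (Suc J). co i \<phi> * PW i x) = level (Suc J + L) (\<lambda>_. Father) \<phi> x"
      unfolding partial_sum_level[OF \<phi>c \<phi>p, symmetric] sum_idx_below sum_block co_def PW_def by simp
    then have "\<bar>g J x\<bar> \<le> E / 2 ^ (Suc J + L)" using E[of "Suc J + L" x] by (simp add: g_def abs_minus_commute)
    also have "\<dots> \<le> E / 2 ^ J" using E0 by (intro divide_left_mono power_increasing) auto
    finally show ?thesis .
  qed
  have g_meas: "g J \<in> borel_measurable borel" for J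
    unfolding g_def[abs_def] by (intro borel_measurable_continuous_onI continuous_intros \<phi>c PW_continuous)
  have limX: "AE \<omega> in P. \<forall>i\<in>idx. (\<lambda>n. w \<omega> (approx i n)) \<longlonglongrightarrow> X i \<omega>"
    using X_lim by (subst AE_ball_countable[OF countable_idx]) auto
  have [measurable]: "(\<lambda>\<omega>. w \<omega> \<phi>) \<in> borel_measurable P" by (rule w_meas[OF \<phi>])
  have [measurable]: "partial J \<phi> \<in> borel_measurable P" for J unfolding partial_def[abs_def] by measurable
  have mom: "(\<integral>\<^sup>+\<omega>. ennreal (\<bar>w \<omega> \<phi> - partial (Suc J) \<phi> \<omega>\<bar> powr r) \<partial>P) \<le> ennreal (?K * ((E + 1) / 2 ^ J) powr r)" for J
  proof (rule limit_moment[OF r])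
    \<comment> \<open>Replacing each wavelet by its approximations yields test functions on which
      \<open>w \<omega>\<close> is linear; they converge uniformly to the remainder g J.\<close>
    define h where "h n x = \<phi> x - (\<Sum>i\<in>idx_below (Suc J). co i \<phi> * approx i n x)" for n x
    show "h n \<in> test_functions" for n
      unfolding h_def[abs_def] by (intro test_diff \<phi> test_sum approx)
    show "g J \<in> borel_measurable borel" by (rule g_meas)
    show "\<bar>g J x\<bar> \<le> E / 2 ^ J" for x by (rule g_le)
    show "\<bar>h n x - g J x\<bar> \<le> (\<Sum>i\<in>idx_below (Suc J). \<bar>co i \<phi>\<bar>) / 2 ^ n" for n x
    proof -
      have "\<bar>h n x - g J x\<bar> = \<bar>\<Sum>i\<in>idx_below (Suc J). co i \<phi> * (approx i n x - PW i x)\<bar>"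
        by (simp add: h_def g_def sum_subtractf right_diff_distrib abs_minus_commute)
      also have "\<dots> \<le> (\<Sum>i\<in>idx_below (Suc J). \<bar>co i \<phi>\<bar> * (1 / 2 ^ n))"
      proof (rule order_trans[OF sum_abs], rule sum_mono)
        fix i
        show "\<bar>co i \<phi> * (approx i n x - PW i x)\<bar> \<le> \<bar>co i \<phi>\<bar> * (1 / 2 ^ n)"
          unfolding abs_mult by (intro mult_left_mono approx(2)) simp
      qed
      finally show ?thesis by (simp add: sum_divide_distrib)
    qed
    show "AE \<omega> in P. (\<lambda>n. w \<omega> (h n)) \<longlonglongrightarrow> w \<omega> \<phi> - partial (Suc J) \<phi> \<omega>"
      using limX AE_space
    proof eventually_elim
      case (elim \<omega>)
      have "w \<omega> (h n) = w \<omega> \<phi> - (\<Sum>i\<in>idx_below (Suc J). co i \<phi> * w \<omega> (approx i n))" for n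
        unfolding h_def[abs_def] using elim(2)
        by (simp add: w_diff[OF _ \<phi> test_sum] w_sum approx)
      then show ?case unfolding partial_def
        using elim(1) idx_below_subset[of "Suc J"] by (auto intro!: tendsto_intros)
    qed
    \<comment> \<open>E may be 0; enlarging it by 1 provides the positive \<sigma> and the strict
      inequality that \<open>limit_moment\<close> asks for.\<close>
    show pos: "0 < (E + 1) / 2 ^ J" using E0 by simp
    have "(\<integral>x. \<bar>g J x\<bar> powr \<alpha> \<partial>torus_measure) \<le> (E / 2 ^ J) powr \<alpha>"
    proof (rule torus_integral_le)
      show "(\<lambda>x. \<bar>g J x\<bar> powr \<alpha>) \<in> borel_measurable borel" using g_meas[of J] by measurable
      show "\<bar>g J x\<bar> powr \<alpha> \<le> (E / 2 ^ J) powr \<alpha>" for x using g_le[of J x] \<alpha> by (intro powr_mono2) auto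
    qed simp
    also have "\<dots> < ((E + 1) / 2 ^ J) powr \<alpha>"
      using E0 \<alpha> by (intro powr_less_mono2 divide_strict_right_mono) auto
    finally show "(\<integral>x. \<bar>g J x\<bar> powr \<alpha> \<partial>torus_measure) < ((E + 1) / 2 ^ J) powr \<alpha>" .
  qed
  have "AE \<omega> in P. \<exists>C\<ge>0. \<forall>J. 2 powr (real J * r / 2) * \<bar>w \<omega> \<phi> - partial (Suc J) \<phi> \<omega>\<bar> powr r \<le> C"
  proof (rule AE_bounded_if_sum_finite)
    show "(\<lambda>\<omega>. 2 powr (real J * r / 2) * \<bar>w \<omega> \<phi> - partial (Suc J) \<phi> \<omega>\<bar> powr r) \<in> borel_measurable P" for J
      by measurable
    show "summable (\<lambda>J. (?K * (E + 1) powr r) * q ^ J)" using q by (intro summable_mult summable_geometric) auto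
    show "0 \<le> (?K * (E + 1) powr r) * q ^ J" for J using q K by simp
    fix J
    have "(\<integral>\<^sup>+\<omega>. ennreal (2 powr (real J * r / 2) * \<bar>w \<omega> \<phi> - partial (Suc J) \<phi> \<omega>\<bar> powr r) \<partial>P)
      = ennreal (2 powr (real J * r / 2)) * (\<integral>\<^sup>+\<omega>. ennreal (\<bar>w \<omega> \<phi> - partial (Suc J) \<phi> \<omega>\<bar> powr r) \<partial>P)"
      by (simp add: ennreal_mult' nn_integral_cmult)
    also have "\<dots> \<le> ennreal (2 powr (real J * r / 2)) * ennreal (?K * ((E + 1) / 2 ^ J) powr r)"
      by (intro mult_left_mono mom) auto
    also have "\<dots> = ennreal (2 powr (real J * r / 2) * (?K * ((E + 1) / 2 ^ J) powr r))"
      by (simp add: ennreal_mult')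
    also have "2 powr (real J * r / 2) * (?K * ((E + 1) / 2 ^ J) powr r) = (?K * (E + 1) powr r) * q ^ J"
    proof -
      have h: "((E + 1) / 2 ^ J) powr r = (E + 1) powr r * 2 powr (- (real J * r))"
      proof -
        have "(E + 1) / 2 ^ J = (E + 1) * 2 powr (- real J)" by (simp add: powr_minus powr_realpow divide_inverse)
        then show ?thesis using E0 by (simp add: powr_mult powr_powr)
      qed
      have qJ: "q ^ J = 2 powr (- (real J * r / 2))"
        unfolding q_def by (simp add: powr_realpow[symmetric] powr_powr mult.commute)
      have e: "2 powr (real J * r / 2) * 2 powr (- (real J * r)) = (2 :: real) powr (- (real J * r / 2))"
        by (simp add: mult.commute flip: powr_add)
      have "2 powr (real J * r / 2) * (?K * ((E + 1) / 2 ^ J) powr r) =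
        ?K * (E + 1) powr r * (2 powr (real J * r / 2) * 2 powr (- (real J * r)))"
        unfolding h by (simp only: ac_simps)
      then show ?thesis unfolding e qJ .
    qed
    finally show "(\<integral>\<^sup>+\<omega>. ennreal (2 powr (real J * r / 2) * \<bar>w \<omega> \<phi> - partial (Suc J) \<phi> \<omega>\<bar> powr r) \<partial>P) \<le> ennreal ((?K * (E + 1) powr r) * q ^ J)" .
  qed
  then show ?thesis
  proof eventually_elim
    case (elim \<omega>)
    then obtain C where C: "C \<ge> 0" "\<And>J. 2 powr (real J * r / 2) * \<bar>w \<omega> \<phi> - partial (Suc J) \<phi> \<omega>\<bar> powr r \<le> C" by blast
    have bd: "\<bar>w \<omega> \<phi> - partial (Suc J) \<phi> \<omega>\<bar> \<le> C powr (1 / r) * (2 powr (- 1 / 2)) ^ J" for J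
    proof -
      let ?x = "\<bar>w \<omega> \<phi> - partial (Suc J) \<phi> \<omega>\<bar>"
      have "?x powr r \<le> C * 2 powr (- (real J * r / 2))"
        using C(2)[of J] by (simp add: powr_minus field_simps)
      then have "(?x powr r) powr (1 / r) \<le> (C * 2 powr (- (real J * r / 2))) powr (1 / r)"
        using r by (intro powr_mono2) auto
      also have "\<dots> = C powr (1 / r) * 2 powr (- (real J / 2))"
        using r C by (simp add: powr_mult powr_powr)
      also have "2 powr (- (real J / 2)) = (2 powr (- 1 / 2) :: real) ^ J"
        by (simp add: powr_realpow[symmetric] powr_powr)
      finally show ?thesis using r by (simp add: powr_powr)
    qed
    have "(\<lambda>J. C powr (1 / r) * (2 powr (- 1 / 2)) ^ J) \<longlonglongrightarrow> C powr (1 / r) * 0"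
      by (intro tendsto_mult tendsto_const LIMSEQ_power_zero) (simp add: powr_less_one)
    then have lim: "(\<lambda>J. C powr (1 / r) * (2 powr (- 1 / 2)) ^ J) \<longlonglongrightarrow> 0" by simp
    have "\<forall>\<^sub>F J in sequentially. norm (w \<omega> \<phi> - partial (Suc J) \<phi> \<omega>) \<le> C powr (1 / r) * (2 powr (- 1 / 2)) ^ J"
      unfolding real_norm_def by (intro always_eventually allI bd)
    then have "(\<lambda>J. w \<omega> \<phi> - partial (Suc J) \<phi> \<omega>) \<longlonglongrightarrow> 0"
      by (rule Lim_null_comparison) (rule lim)
    from tendsto_diff[OF tendsto_const[of "w \<omega> \<phi>"] this] show ?case by simp
  qed
qed


lemma co_diff:
  assumes "\<phi> \<in> test_functions" "\<eta> \<in> test_functions"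
  shows "co i (\<lambda>x. \<phi> x - \<eta> x) = co i \<phi> - co i \<eta>"
proof -
  obtain j G m where i: "i = (j, G, m)" by (cases i)
  have "integrable lborel (\<lambda>x. wavelet L \<psi> j G m x * \<phi> x)" "integrable lborel (\<lambda>x. wavelet L \<psi> j G m x * \<eta> x)"
    by (intro wavelet_integrable test_continuous' assms)+
  then show ?thesis
    unfolding i co_def using assms
    by (simp add: coef_eq test_continuous' test_periodic test_diff right_diff_distrib)
qed

definition decay :: real where
  "decay = absint ^ CARD('d) * R ^ u * 2 ^ (L * u)"

lemma decay_nonneg: "0 \<le> decay"
  using absint_nonneg R_ge by (simp add: decay_def)

lemma co_decay:
  assumes "\<phi> \<in> test_functions" "x \<in> block j"
  shows "\<bar>co (j, x) \<phi>\<bar> \<le> decay * 2 powr (- (real (j + L) * real CARD('d) / 2) - real (j + L) * real u) * test_seminorm u \<phi>"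
proof -
  obtain G m where "x = (G, m)" "G \<in> genders j" using assms(2) by (auto simp: block_def)
  then show ?thesis using coef_decay[OF assms(1), of G j m] by (simp add: co_def decay_def)
qed

text \<open>On each level, the \<open>\<ell>\<^sub>r\<close> bound of the coefficients is turned into an \<open>\<ell>\<^sub>1\<close> bound and paired with
  the decay of the wavelet coefficients of a test function.\<close>

lemma absolute_bound:
  assumes r: "0 < r" and C: "0 \<le> C"
    and \<theta>: "\<beta> - real CARD('d) - real u + real CARD('d) * max 0 (1 - 1 / r) < 0"
    and growth: "\<And>j. (\<Sum>x\<in>block j. \<bar>2 powr (real (j + L) * real CARD('d) / 2) * X (j, x) \<omega>\<bar> powr r) \<le> (C * 2 powr (real j * \<beta>)) powr r"
  shows "\<exists>K. \<forall>\<phi>\<in>test_functions. \<forall>F. finite F \<longrightarrow> F \<subseteq> idx \<longrightarrow> (\<Sum>i\<in>F. \<bar>co i \<phi> * X i \<omega>\<bar>) \<le> K * test_seminorm u \<phi>"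
proof -
  let ?d = "real CARD('d)"
  define cg where "cg = real (card (UNIV :: ('d \<Rightarrow> gender) set)) "
  have cg: "1 \<le> cg"
  proof -
    have "finite (UNIV :: ('d \<Rightarrow> gender) set)" using finite_genders[of 0] by (simp add: genders_def)
    then have "0 < card (UNIV :: ('d \<Rightarrow> gender) set)" by (simp add: card_gt_0_iff)
    then show ?thesis by (simp add: cg_def)
  qed
  define \<kappa> where "\<kappa> = max 0 (1 - 1 / r)"
  \<comment> \<open>The growth per level: \<beta> from the coefficients, -d from the two
    normalizations 2^(-(j+L)d/2), -u from the decay of the test function, and d \<kappa> from
    passing from l_r to l_1.\<close>
  define q where "q = 2 powr (\<beta> - ?d - real u + ?d * \<kappa>)"
  have q: "0 < q" "q < 1" using \<theta> by (auto simp: q_def \<kappa>_def powr_less_one)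
  define A where "A = decay * (2 * C * cg powr \<kappa>) * 2 powr (real L * (- ?d - real u + ?d * \<kappa>))"
  have A: "0 \<le> A" using decay_nonneg C by (simp add: A_def)
  have level: "(\<Sum>x\<in>block j. \<bar>co (j, x) \<phi> * X (j, x) \<omega>\<bar>) \<le> A * q ^ j * test_seminorm u \<phi>"
    if \<phi>: "\<phi> \<in> test_functions" for \<phi> j
  proof -
    let ?s = "real (j + L)" and ?S = "test_seminorm u \<phi>"
    have S: "0 \<le> ?S" by (rule test_seminorm_nonneg[OF \<phi>])
    define lam where "lam x = \<bar>2 powr (?s * ?d / 2) * X (j, x) \<omega>\<bar>" for x
    have X_lam: "\<bar>X (j, x) \<omega>\<bar> = 2 powr (- (?s * ?d / 2)) * lam x" for x
      by (simp add: lam_def abs_mult powr_minus)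
    have "(\<Sum>x\<in>block j. lam x) \<le> 2 * (C * 2 powr (real j * \<beta>)) * (cg * 2 powr (?s * ?d)) powr \<kappa>"
      unfolding \<kappa>_def
    proof (rule sum_le_of_sum_powr[OF finite_block _ r])
      show "real (card (block j)) \<le> cg * 2 powr (?s * ?d)" unfolding cg_def by (rule card_block)
      have "1 * 1 \<le> cg * 2 powr (?s * ?d)" using cg by (intro mult_mono ge_one_powr_ge_zero) auto
      then show "1 \<le> cg * 2 powr (?s * ?d)" by simp
      show "(\<Sum>x\<in>block j. lam x powr r) \<le> (C * 2 powr (real j * \<beta>)) powr r"
        unfolding lam_def by (rule growth)
    qed (use C in \<open>auto simp: lam_def\<close>)
    also have "\<dots> = 2 * C * cg powr \<kappa> * (2 powr (real j * \<beta>) * 2 powr (?s * ?d * \<kappa>))"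
      using cg by (simp add: powr_mult powr_powr)
    finally have l1: "(\<Sum>x\<in>block j. lam x) \<le> 2 * C * cg powr \<kappa> * (2 powr (real j * \<beta>) * 2 powr (?s * ?d * \<kappa>))" .
    have "(\<Sum>x\<in>block j. \<bar>co (j, x) \<phi> * X (j, x) \<omega>\<bar>) \<le>
      (\<Sum>x\<in>block j. decay * 2 powr (- (?s * ?d / 2) - ?s * real u) * ?S * (2 powr (- (?s * ?d / 2)) * lam x))"
    proof (rule sum_mono)
      fix x assume x: "x \<in> block j"
      show "\<bar>co (j, x) \<phi> * X (j, x) \<omega>\<bar> \<le> decay * 2 powr (- (?s * ?d / 2) - ?s * real u) * ?S * (2 powr (- (?s * ?d / 2)) * lam x)"
        unfolding abs_mult X_lam by (intro mult_right_mono co_decay \<phi> x) (simp add: lam_def)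
    qed
    also have "\<dots> = decay * ?S * (2 powr (- (?s * ?d / 2) - ?s * real u) * 2 powr (- (?s * ?d / 2))) * (\<Sum>x\<in>block j. lam x)"
      unfolding sum_distrib_left by (intro sum.cong refl) (simp only: ac_simps)
    also have "\<dots> \<le> decay * ?S * (2 powr (- (?s * ?d / 2) - ?s * real u) * 2 powr (- (?s * ?d / 2))) *
       (2 * C * cg powr \<kappa> * (2 powr (real j * \<beta>) * 2 powr (?s * ?d * \<kappa>)))"
      using S decay_nonneg by (intro mult_left_mono l1) auto
    also have "\<dots> = decay * (2 * C * cg powr \<kappa>) * ((2 powr (- (?s * ?d / 2) - ?s * real u) * 2 powr (- (?s * ?d / 2))) * (2 powr (real j * \<beta>) * 2 powr (?s * ?d * \<kappa>))) * ?S"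
      by (simp only: ac_simps)
    also have "(2 powr (- (?s * ?d / 2) - ?s * real u) * 2 powr (- (?s * ?d / 2))) * (2 powr (real j * \<beta>) * 2 powr (?s * ?d * \<kappa>))
      = 2 powr (real L * (- ?d - real u + ?d * \<kappa>)) * q ^ j"
    proof -
      have "(- (?s * ?d / 2) - ?s * real u + - (?s * ?d / 2)) + (real j * \<beta> + ?s * ?d * \<kappa>)
        = real L * (- ?d - real u + ?d * \<kappa>) + real j * (\<beta> - ?d - real u + ?d * \<kappa>)"
        by (simp add: field_simps)
      moreover have "q ^ j = 2 powr (real j * (\<beta> - ?d - real u + ?d * \<kappa>))"
        by (simp add: q_def powr_realpow[symmetric] powr_powr mult.commute)
      ultimately show ?thesis by (simp only: powr_add[symmetric])
    qed
    finally show ?thesis by (simp only: A_def mult.assoc)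
  qed
  show ?thesis
  proof (intro exI[of _ "A * (1 / (1 - q))"] ballI allI impI)
    fix \<phi> :: "real^'d \<Rightarrow> real" and F :: "'d index set"
    assume \<phi>: "\<phi> \<in> test_functions" and F: "finite F" "F \<subseteq> idx"
    have S: "0 \<le> test_seminorm u \<phi>" by (rule test_seminorm_nonneg[OF \<phi>])
    have "finite (fst ` F)" using F by simp
    then obtain J where J: "\<forall>j\<in>fst ` F. j < J" using finite_nat_set_iff_bounded by blast
    then have "F \<subseteq> idx_below J" using F(2) by (force simp: idx_below_def idx_def)
    then have "(\<Sum>i\<in>F. \<bar>co i \<phi> * X i \<omega>\<bar>) \<le> (\<Sum>i\<in>idx_below J. \<bar>co i \<phi> * X i \<omega>\<bar>)"
      by (intro sum_mono2 finite_idx_below) auto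
    also have "\<dots> = (\<Sum>j<J. \<Sum>x\<in>block j. \<bar>co (j, x) \<phi> * X (j, x) \<omega>\<bar>)" by (rule sum_idx_below)
    also have "\<dots> \<le> (\<Sum>j<J. A * q ^ j * test_seminorm u \<phi>)" by (intro sum_mono level \<phi>)
    also have "\<dots> = A * (\<Sum>j<J. q ^ j) * test_seminorm u \<phi>" by (simp add: sum_distrib_left sum_distrib_right)
    also have "\<dots> \<le> A * (1 / (1 - q)) * test_seminorm u \<phi>"
    proof (intro mult_right_mono mult_left_mono A S)
      have "(\<Sum>j<J. q ^ j) \<le> (\<Sum>j. q ^ j)" using q by (intro sum_le_suminf summable_geometric) auto
      then show "(\<Sum>j<J. q ^ j) \<le> 1 / (1 - q)" using q by (simp add: suminf_geometric)
    qed
    finally show "(\<Sum>i\<in>F. \<bar>co i \<phi> * X i \<omega>\<bar>) \<le> A * (1 / (1 - q)) * test_seminorm u \<phi>" .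
  qed
qed

text \<open>Lets an unconditional sum be computed as the limit of its partial sums over
  levels.\<close>

lemma idx_below_exhausts: "filterlim (\<lambda>J. idx_below (Suc J)) (finite_subsets_at_top idx) sequentially"
  unfolding filterlim_finite_subsets_at_top
proof (intro allI impI)
  fix F assume F: "finite F \<and> F \<subseteq> idx"
  then have "finite (fst ` F)" by simp
  then obtain J where J: "\<forall>j\<in>fst ` F. j < J" using finite_nat_set_iff_bounded by blast
  show "\<forall>\<^sub>F J in sequentially. finite (idx_below (Suc J)) \<and> F \<subseteq> idx_below (Suc J) \<and> idx_below (Suc J) \<subseteq> idx"
    using eventually_ge_at_top[of J]
  proof eventually_elim
    case (elim n)
    then have "F \<subseteq> idx_below (Suc n)" using F J by (force simp: idx_below_def idx_def)
    then show ?case using finite_idx_below idx_below_subset by blast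
  qed
qed

text \<open>For fixed \<omega>, the sum S of the expansion is linear and bounded by the seminorm of
  order u, and \<open>w \<omega>\<close> is bounded by some seminorm as well. Both agree on the
  dense set D, hence everywhere. D is countable in the application, so that one null set serves all
  its elements.\<close>

lemma expansion_everywhere:
  assumes \<omega>: "\<omega> \<in> space P"
    and K: "\<And>\<phi> F. \<phi> \<in> test_functions \<Longrightarrow> finite F \<Longrightarrow> F \<subseteq> idx \<Longrightarrow> (\<Sum>i\<in>F. \<bar>co i \<phi> * X i \<omega>\<bar>) \<le> K * test_seminorm u \<phi>"
    and D: "D \<subseteq> test_functions"
      "\<And>\<phi> N \<epsilon>. \<phi> \<in> test_functions \<Longrightarrow> 0 < \<epsilon> \<Longrightarrow> \<exists>\<eta>\<in>D. test_seminorm N (\<lambda>x. \<phi> x - \<eta> x) < \<epsilon>"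
      "\<And>\<eta>. \<eta> \<in> D \<Longrightarrow> (\<lambda>J. partial (Suc J) \<eta> \<omega>) \<longlonglongrightarrow> w \<omega> \<eta>"
    and \<phi>: "\<phi> \<in> test_functions"
  shows "((\<lambda>i. co i \<phi> * X i \<omega>) has_sum w \<omega> \<phi>) idx"
proof -
  define S where "S \<phi> = (\<Sum>\<^sub>\<infinity>i\<in>idx. co i \<phi> * X i \<omega>)" for \<phi>
  have abs_summable: "(\<lambda>i. norm (co i \<phi> * X i \<omega>)) summable_on idx" if "\<phi> \<in> test_functions" for \<phi>
    by (rule nonneg_bdd_above_summable_on) (use K[OF that] in \<open>auto intro!: bdd_aboveI2 simp: abs_mult\<close>)
  have summable: "(\<lambda>i. co i \<phi> * X i \<omega>) summable_on idx" if "\<phi> \<in> test_functions" for \<phi>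
    by (rule abs_summable_summable[OF abs_summable[OF that]])
  have S_le: "\<bar>S \<phi>\<bar> \<le> K * test_seminorm u \<phi>" if "\<phi> \<in> test_functions" for \<phi>
  proof -
    have "norm (S \<phi>) \<le> (\<Sum>\<^sub>\<infinity>i\<in>idx. norm (co i \<phi> * X i \<omega>))"
      unfolding S_def by (rule norm_infsum_bound[OF abs_summable[OF that]])
    also have "\<dots> \<le> K * test_seminorm u \<phi>"
      by (rule infsum_le_finite_sums[OF abs_summable[OF that]]) (use K[OF that] in auto)
    finally show ?thesis by simp
  qed
  have S_D: "S \<eta> = w \<omega> \<eta>" if "\<eta> \<in> D" for \<eta>
  proof -
    have "((\<lambda>i. co i \<eta> * X i \<omega>) has_sum S \<eta>) idx"
      unfolding S_def using summable D(1) that by (intro has_sum_infsum) auto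
    then have "(\<lambda>J. partial (Suc J) \<eta> \<omega>) \<longlonglongrightarrow> S \<eta>"
      unfolding has_sum_def partial_def by (rule filterlim_compose[OF _ idx_below_exhausts])
    then show ?thesis using D(3)[OF that] by (rule LIMSEQ_unique)
  qed
  obtain N C where NC: "\<And>\<phi>. \<phi> \<in> test_functions \<Longrightarrow> \<bar>w \<omega> \<phi>\<bar> \<le> C * test_seminorm N \<phi>"
    using w_dist[OF \<omega>] unfolding periodic_distributions_def by blast
  define M where "M = \<bar>C\<bar> + \<bar>K\<bar> + 1"
  have "\<bar>w \<omega> \<phi> - S \<phi>\<bar> \<le> e" if e: "e > 0" for e
  proof -
    have M: "M > 0" by (simp add: M_def)
    \<comment> \<open>The order N of \<open>w \<omega>\<close> depends on \<omega>, so D has to be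
      dense for every seminorm; the maximum with u controls S as well.\<close>
    then obtain \<eta> where \<eta>: "\<eta> \<in> D" "test_seminorm (max N u) (\<lambda>x. \<phi> x - \<eta> x) < e / M"
      using D(2)[OF \<phi>, of "e / M" "max N u"] e by auto
    have \<eta>t: "\<eta> \<in> test_functions" using \<eta> D by blast
    let ?d = "\<lambda>x. \<phi> x - \<eta> x" and ?m = "test_seminorm (max N u) (\<lambda>x. \<phi> x - \<eta> x)"
    have t: "?d \<in> test_functions" by (rule test_diff[OF \<phi> \<eta>t])
    have m0: "0 \<le> ?m" by (rule test_seminorm_nonneg[OF t])
    have "S \<phi> = (\<Sum>\<^sub>\<infinity>i\<in>idx. co i ?d * X i \<omega> + co i \<eta> * X i \<omega>)"
      unfolding S_def by (simp add: co_diff[OF \<phi> \<eta>t] left_diff_distrib)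
    also have "\<dots> = S ?d + S \<eta>"
      unfolding S_def by (rule infsum_add) (intro summable t \<eta>t)+
    finally have "S \<phi> = S ?d + S \<eta>" .
    then have "w \<omega> \<phi> - S \<phi> = w \<omega> ?d - S ?d"
      by (simp add: w_diff[OF \<omega> \<phi> \<eta>t] S_D[OF \<eta>(1)])
    moreover have "\<bar>w \<omega> ?d\<bar> \<le> \<bar>C\<bar> * ?m"
      by (rule order_trans[OF NC[OF t]]) (intro mult_mono test_seminorm_mono t test_seminorm_nonneg; simp)
    moreover have "\<bar>S ?d\<bar> \<le> \<bar>K\<bar> * ?m"
      by (rule order_trans[OF S_le[OF t]]) (intro mult_mono test_seminorm_mono t test_seminorm_nonneg; simp)
    ultimately have "\<bar>w \<omega> \<phi> - S \<phi>\<bar> \<le> \<bar>C\<bar> * ?m + \<bar>K\<bar> * ?m" by linarith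
    also have "\<dots> \<le> M * ?m" using m0 by (simp add: M_def distrib_right)
    also have "\<dots> \<le> M * (e / M)" using \<eta>(2) M by (intro mult_left_mono) auto
    finally show ?thesis using M by simp
  qed
  then have "\<bar>w \<omega> \<phi> - S \<phi>\<bar> \<le> 0" by (rule field_le_epsilon) simp
  then have "S \<phi> = w \<omega> \<phi>" by simp
  then show ?thesis using has_sum_infsum[OF summable[OF \<phi>]] by (simp add: S_def)
qed

text \<open>The hypothesis on \<tau> leaves room for a growth rate \<beta> that the coefficients
  satisfy almost surely and the Besov weight still beats. The hypothesis on u makes the expansion
  absolutely summable at this \<beta>.\<close>

lemma in_besov_space:
  assumes r: "0 < r" "r < \<alpha> \<or> \<alpha> = 2" "ennreal r \<le> p" and pq: "0 < p" "0 < q"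
    and \<tau>: "real CARD('d) * (1 / r + 1 - 1 / \<alpha>) < real CARD('d) * enn2real (1 / p) - \<tau>"
    and u: "real CARD('d) * max (enn2real (1 / p) - 1) 0 - \<tau> < real u"
  shows "AE \<omega> in P. w \<omega> \<in> besov_space L \<psi> p q \<tau>"
proof -
  let ?d = "real CARD('d)" and ?e = "enn2real (1 / p)"
  obtain \<beta> where \<beta>: "?d * (1 / r + 1 - 1 / \<alpha>) < \<beta>" "\<beta> < ?d * ?e - \<tau>"
    using dense[OF \<tau>] by blast
  have e: "?e \<le> 1 / r"
  proof (cases p)
    case (real x)
    then have "r \<le> x" "0 < x" using r by auto
    then show ?thesis using real r by (simp add: enn2real_inverse_ennreal frac_le)
  qed (use r in simp)
  \<comment> \<open>For r \<le> 1 the last summand is 0 and the bound \<beta> < d/p - \<tau> meets u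
    > d(1/p-1) - \<tau>. For r > 1 the left side is \<beta> - u - d/r, and 1/p \<le> 1/r together
    with u > -\<tau> suffices.\<close>
  have "\<beta> - ?d - real u + ?d * max 0 (1 - 1 / r) < 0"
  proof (cases "r \<le> 1")
    case True
    have "?d * (?e - 1) \<le> ?d * max (?e - 1) 0" by (intro mult_left_mono) auto
    then have "?d * ?e - ?d - \<tau> < real u" using u by (simp add: right_diff_distrib)
    moreover have "max 0 (1 - 1 / r) = 0" using True r by (simp add: field_simps)
    ultimately show ?thesis using \<beta> by simp
  next
    case False
    have "0 \<le> ?d * max (?e - 1) 0" by simp
    then have "- \<tau> < real u" using u by linarith
    moreover have "?d * ?e \<le> ?d * (1 / r)" by (intro mult_left_mono e) simp
    moreover have "?d * max 0 (1 - 1 / r) = ?d - ?d * (1 / r)" using False by (simp add: max_def right_diff_distrib)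
    ultimately show ?thesis using \<beta> by linarith
  qed
  note \<theta> = this
  obtain D :: "(real^'d \<Rightarrow> real) set" where D: "countable D" "D \<subseteq> test_functions"
    "\<And>\<phi> N \<epsilon>. \<phi> \<in> test_functions \<Longrightarrow> 0 < \<epsilon> \<Longrightarrow> \<exists>\<eta>\<in>D. test_seminorm N (\<lambda>x. \<phi> x - \<eta> x) < \<epsilon>"
    using test_separable by (elim exE conjE, intro that) auto
  have "AE \<omega> in P. \<forall>\<eta>\<in>D. (\<lambda>J. partial (Suc J) \<eta> \<omega>) \<longlonglongrightarrow> w \<omega> \<eta>"
    using partial_converges D(2) by (subst AE_ball_countable[OF D(1)]) auto
  then show ?thesis
    using coefficient_growth[OF r(1,2) \<beta>(1)] AE_space
  proof eventually_elim
    case (elim \<omega>)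
    then obtain C where C: "0 \<le> C" and growth: "\<And>j. (\<Sum>x\<in>block j. \<bar>2 powr (real (j + L) * ?d / 2) * X (j, x) \<omega>\<bar> powr r) \<le> (C * 2 powr (real j * \<beta>)) powr r"
      by blast
    obtain K where K: "\<And>\<phi> F. \<phi> \<in> test_functions \<Longrightarrow> finite F \<Longrightarrow> F \<subseteq> idx \<Longrightarrow> (\<Sum>i\<in>F. \<bar>co i \<phi> * X i \<omega>\<bar>) \<le> K * test_seminorm u \<phi>"
      using absolute_bound[OF r(1) C \<theta> growth] by blast
    \<comment> \<open>\<open>besov_space\<close> expands in wavelets scaled by 2^(-(j+L)d/2); the
      coefficients are scaled up to compensate.\<close>
    define lam :: "nat \<Rightarrow> ('d \<Rightarrow> gender) \<Rightarrow> int^'d \<Rightarrow> complex"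
      where "lam j G m = complex_of_real (2 powr (real (j + L) * ?d / 2) * X (j, G, m) \<omega>)" for j G m
    have "lam \<in> besov_seq L p q \<tau>"
    proof (rule besov_seq_membership[OF r(1) r(3) pq(2) C])
      show "\<beta> + \<tau> - ?d * ?e < 0" using \<beta>(2) by simp
      fix j and G :: "'d \<Rightarrow> gender" assume G: "G \<in> genders j"
      have "(\<Sum>m\<in>positions L j. cmod (lam j G m) powr r) \<le> (\<Sum>G\<in>genders j. \<Sum>m\<in>positions L j. cmod (lam j G m) powr r)"
        by (rule member_le_sum[OF G]) (auto intro!: sum_nonneg finite_genders)
      also have "\<dots> \<le> (C * 2 powr (real j * \<beta>)) powr r"
        using growth[of j] unfolding sum_block lam_def norm_of_real .
      finally show "(\<Sum>m\<in>positions L j. cmod (lam j G m) powr r) \<le> (C * 2 powr (real j * \<beta>)) powr r" .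
    qed
    moreover have "((\<lambda>(j, G, m). lam j G m *
            complex_of_real (2 powr (- (real (j + L) * ?d / 2)) *
              (\<integral>x. periodic_wavelet L \<psi> j G m x * \<phi> x \<partial>torus_measure)))
          has_sum complex_of_real (w \<omega> \<phi>))
        {(j, G, m). G \<in> genders j \<and> m \<in> positions L j}" if \<phi>: "\<phi> \<in> test_functions" for \<phi>
    proof -
      have "((\<lambda>i. co i \<phi> * X i \<omega>) has_sum w \<omega> \<phi>) idx"
        by (rule expansion_everywhere[OF _ K D(2) D(3) _ \<phi>]) (use elim in auto)
      then have "((\<lambda>i. complex_of_real (co i \<phi> * X i \<omega>)) has_sum complex_of_real (w \<omega> \<phi>)) idx"
        by (rule has_sum_of_real)
      moreover have "idx = {(j, G, m). G \<in> genders j \<and> m \<in> positions L j}"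
        by (auto simp: idx_def block_def)
      moreover have "(\<lambda>i. complex_of_real (co i \<phi> * X i \<omega>)) = (\<lambda>(j, G, m). lam j G m *
            complex_of_real (2 powr (- (real (j + L) * ?d / 2)) *
              (\<integral>x. periodic_wavelet L \<psi> j G m x * \<phi> x \<partial>torus_measure)))"
      proof (rule ext, clarify)
        have gen: "x = y * m \<Longrightarrow> i * x = y * (m * i)" for x y m i :: real by simp
        fix j G m
        have "X (j, G, m) \<omega> = (2 powr (real (j + L) * ?d / 2) * X (j, G, m) \<omega>) * 2 powr (- (real (j + L) * ?d / 2))"
          by (simp add: powr_minus)
        then show "complex_of_real (co (j, G, m) \<phi> * X (j, G, m) \<omega>) = lam j G m *
            complex_of_real (2 powr (- (real (j + L) * ?d / 2)) *
              (\<integral>x. periodic_wavelet L \<psi> j G m x * \<phi> x \<partial>torus_measure))"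
          unfolding lam_def co_def coef_def prod.case of_real_mult[symmetric] of_real_eq_iff by (rule gen)
      qed
      ultimately show ?thesis by (simp only:)
    qed
    ultimately show ?case
      unfolding besov_space_def by (intro CollectI conjI w_dist elim(3) bexI[of _ lam] ballI)
  qed
qed

end

section \<open>Choice of the moment order\<close>

lemma wavelet_support_bound:
  assumes "wavelet_system u \<psi>"
  shows "\<exists>R\<ge>1. \<forall>g x. R \<le> \<bar>x\<bar> \<longrightarrow> \<psi> g x = (0 :: real)"
proof -
  have "\<exists>b. \<forall>x. \<psi> g x \<noteq> 0 \<longrightarrow> \<bar>x\<bar> \<le> b" for g
  proof -
    have "compact (closure {x. \<psi> g x \<noteq> 0})" using assms by (simp add: wavelet_system_def)
    then obtain b where "\<forall>x\<in>closure {x. \<psi> g x \<noteq> 0}. norm x \<le> b"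
      using compact_imp_bounded bounded_iff by blast
    then show ?thesis using closure_subset[of "{x. \<psi> g x \<noteq> 0}"] by auto
  qed
  then obtain b where b: "\<And>g x. \<psi> g x \<noteq> 0 \<Longrightarrow> \<bar>x\<bar> \<le> b g" by metis
  have "\<psi> g x = 0" if "max 1 (max (b Father) (b Mother) + 1) \<le> \<bar>x\<bar>" for g x
  proof (rule ccontr)
    assume "\<psi> g x \<noteq> 0"
    then have "\<bar>x\<bar> \<le> b g" by (rule b)
    moreover have "b g \<le> max (b Father) (b Mother)" by (cases g) auto
    ultimately show False using that by linarith
  qed
  then show ?thesis by (intro exI[of _ "max 1 (max (b Father) (b Mother) + 1)"]) auto
qed

lemma noise_in_besov_space:
  fixes w :: "'a \<Rightarrow> (real^'d \<Rightarrow> real) \<Rightarrow> real"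
  assumes "sas_white_noise \<alpha> \<gamma> P w" and adm: "admissible_wavelets CARD('d) u L \<psi> p \<tau>"
    and r: "0 < r" "r < \<alpha> \<or> \<alpha> = 2" "ennreal r \<le> p" and pq: "0 < p" "0 < q"
    and \<tau>: "real CARD('d) * (1 / r + 1 - 1 / \<alpha>) < real CARD('d) * enn2real (1 / p) - \<tau>"
  shows "AE \<omega> in P. w \<omega> \<in> besov_space L \<psi> p q \<tau>"
proof -
  have ws: "wavelet_system u \<psi>" "fits_torus L \<psi>"
    and u: "real u > max \<tau> (real CARD('d) * max (enn2real (1 / p) - 1) 0 - \<tau>)"
    using adm by (auto simp: admissible_wavelets_def)
  have "0 \<le> real CARD('d) * max (enn2real (1 / p) - 1) 0" by simp
  then have "0 < real u" using u by linarith
  then have u0: "0 < u" by simp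
  obtain R where R: "1 \<le> R" "\<And>g x. R \<le> \<bar>x\<bar> \<Longrightarrow> \<psi> g x = 0"
    using wavelet_support_bound[OF ws(1)] by blast
  interpret noise_wavelets \<alpha> \<gamma> P w u \<psi> R L
    by unfold_locales (fact assms(1) ws u0 R)+
  show ?thesis
    by (rule in_besov_space[OF r pq \<tau>]) (use u in simp)
qed

theorem theorem5:
  fixes P :: "'a measure"
    and w :: "'a \<Rightarrow> (real^'d \<Rightarrow> real) \<Rightarrow> real"
    and \<alpha> \<gamma> :: real
  assumes "0 < \<alpha>" and "\<alpha> \<le> 2"
    and "sas_white_noise \<alpha> \<gamma> P w"
  shows "(\<alpha> = 2 \<longrightarrow>
      (\<forall>(p::ennreal) (q::ennreal) (\<tau>::real) u L \<psi>.
         0 < p \<and> 0 < q \<and> \<tau> < - real CARD('d) / 2 \<and>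
         admissible_wavelets CARD('d) u L \<psi> p \<tau> \<longrightarrow>
           (AE \<omega> in P. w \<omega> \<in> besov_space L \<psi> p q \<tau>))) \<and>
    (\<alpha> < 2 \<longrightarrow>
      (\<forall>(p::ennreal) (q::ennreal) (\<tau>::real) u L \<psi>.
         0 < p \<and> 0 < q \<and> \<tau> < real CARD('d) * (enn2real (1 / max p (ennreal \<alpha>)) - 1) \<and>
         admissible_wavelets CARD('d) u L \<psi> p \<tau> \<longrightarrow>
           (AE \<omega> in P. w \<omega> \<in> besov_space L \<psi> p q \<tau>)))"
proof (intro conjI impI allI; elim conjE)
  let ?d = "real CARD('d)"
  have d: "0 < ?d" by simp
  fix p q :: ennreal and \<tau> :: real and u L \<psi>
  assume pq: "0 < p" "0 < q" and adm: "admissible_wavelets CARD('d) u L \<psi> p \<tau>"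
  {
    assume \<alpha>: "\<alpha> = 2" and \<tau>: "\<tau> < - ?d / 2"
    define \<delta> where "\<delta> = - \<tau> - ?d / 2"
    have \<delta>: "0 < \<delta>" using \<tau> by (simp add: \<delta>_def)
    \<comment> \<open>For finite p take r = p. For p = \<infinity> the choice r = 2d/\<delta> makes
      d/r equal to \<delta>/2, within the slack \<delta>.\<close>
    obtain r where r: "0 < r" "ennreal r \<le> p" "?d * (1 / r) < ?d * enn2real (1 / p) + \<delta>"
    proof (cases p)
      case (real x)
      then have "0 < x" using pq by simp
      then show ?thesis using that[of x] real \<delta> by (simp add: enn2real_inverse_ennreal)
    next
      case top
      have "?d * (1 / (2 * ?d / \<delta>)) = \<delta> / 2" using d by simp
      then show ?thesis using that[of "2 * ?d / \<delta>"] top \<delta> d by (simp add: ennreal_divide_top)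
    qed
    have "?d * (1 / r + 1 - 1 / \<alpha>) = ?d * (1 / r) + ?d / 2" by (simp add: \<alpha> field_simps)
    then have "?d * (1 / r + 1 - 1 / \<alpha>) < ?d * enn2real (1 / p) - \<tau>"
      using r(3) by (simp add: \<delta>_def)
    with \<alpha> r show "AE \<omega> in P. w \<omega> \<in> besov_space L \<psi> p q \<tau>"
      by (intro noise_in_besov_space[OF assms(3) adm _ _ _ pq]) auto
  next
    assume \<alpha>: "\<alpha> < 2" and \<tau>: "\<tau> < ?d * (enn2real (1 / max p (ennreal \<alpha>)) - 1)"
    show "AE \<omega> in P. w \<omega> \<in> besov_space L \<psi> p q \<tau>"
    proof (cases "p < ennreal \<alpha>")
      case True
      \<comment> \<open>Below \<alpha> the moment of order p itself is available; with r = p the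
        terms d/r and d/p cancel and the condition reads \<tau> < d(1/\<alpha> - 1).\<close>
      then obtain x where x: "p = ennreal x" "0 \<le> x" by (cases p) auto
      then have x0: "0 < x" "x < \<alpha>" using pq True by (auto simp: ennreal_less_iff)
      have "max p (ennreal \<alpha>) = ennreal \<alpha>" using True by simp
      then have "\<tau> < ?d * (1 / \<alpha> - 1)" using \<tau> assms(1) by (simp add: enn2real_inverse_ennreal)
      then have "?d * (1 / x + 1 - 1 / \<alpha>) < ?d * enn2real (1 / p) - \<tau>"
        using x x0 by (simp add: enn2real_inverse_ennreal algebra_simps)
      then show ?thesis
        using x x0 by (intro noise_in_besov_space[OF assms(3) adm x0(1) _ _ pq]) auto
    next
      case False
      define \<delta> where "\<delta> = ?d * (enn2real (1 / p) - 1) - \<tau>"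
      have "max p (ennreal \<alpha>) = p" using False by (simp add: max_def)
      then have \<delta>: "0 < \<delta>" using \<tau> by (simp add: \<delta>_def)
      \<comment> \<open>Slightly below \<alpha>: 1/r exceeds 1/\<alpha> by \<delta>/(2d), which uses
        up half of the slack \<delta>. Then r < \<alpha> \<le> p.\<close>
      define r where "r = 1 / (1 / \<alpha> + \<delta> / (2 * ?d))"
      have "1 / \<alpha> < 1 / \<alpha> + \<delta> / (2 * ?d)" using \<delta> d by simp
      then have r: "0 < r" "r < \<alpha>"
        using assms(1) by (auto simp: r_def divide_less_eq less_divide_eq field_simps add_pos_pos)
      have inv: "1 / r = 1 / \<alpha> + \<delta> / (2 * ?d)" by (simp add: r_def)
      have "?d * (1 / r + 1 - 1 / \<alpha>) = ?d + \<delta> / 2" unfolding inv using d by (simp add: field_simps)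
      also have "\<dots> < ?d + \<delta>" using \<delta> by simp
      also have "\<dots> = ?d * enn2real (1 / p) - \<tau>" by (simp add: \<delta>_def right_diff_distrib)
      finally have lt: "?d * (1 / r + 1 - 1 / \<alpha>) < ?d * enn2real (1 / p) - \<tau>" .
      have "ennreal r \<le> p"
        using r False by (meson ennreal_leI less_imp_le not_less order_trans)
      then show ?thesis
        using r lt by (intro noise_in_besov_space[OF assms(3) adm r(1) _ _ pq]) auto
    qed
  }
qed

end
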